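(* Fix any $1/2<t<1$. There is a constant $C>0$ such that for every sufficiently small $\epsilon>0$ there exist a complete weighted graph $G(V,{\rm wt})$ with ${\rm wt}(e)\ge0$ and $\sum_e{\rm wt}(e)=1$, a partition $V=\bigcup_{i=1}^r V_i$ into parts each of size $|V|/r$, and a unit vector $v_x$ for every $x\in V$, such that: (1) $|V|\le 2^{2^{C/\epsilon^3}}$; (2) every $5/6$-piecewise balanced cut $A$ satisfies $\sum_{e\in E(A,\overline A)}{\rm wt}(e)\ge\epsilon^t$; (3) for all $x,y,z\in V$, $\|v_x-v_y\|^2+\|v_y-v_z\|^2\ge\|v_x-v_z\|^2$; (4) for each part $V_i$, $\frac12\,\mathbb E_{x,y\in V_i}\big[\|v_x-v_y\|^2\big]=1$, with $x,y$ independent and uniform in $V_i$; (5) $\frac14\sum_{e\{x,y\}}{\rm wt}(e)\|v_x-v_y\|^2\le\epsilon$.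
   Context: A cut is a function $A:V\to\{-1,1\}$; $E(A,\overline A)$ is the set of edges whose endpoints receive different values. For $0\le\theta\le1$, the cut $A$ is $\theta$-piecewise balanced if $\mathbb E_{i\in[r]}\big|\mathbb E_{x\in V_i}[A(x)]\big|\le\theta$, where $i$ is uniform in $[r]$ and $x$ uniform in $V_i$. *)

theory Defs
  imports "HOL-Probability.Probability" "HOL-Library.Ramsey"
begin

text \<open>
  The complete graph on a vertex set \<open>V\<close> has the edge set \<^term>\<open>nsets V 2\<close>, the two-element
  subsets of \<open>V\<close>; weights are functions on edges, so they are symmetric by construction. A cut is
  a function with values in \<open>{-1, 1}\<close>; only its values on \<open>V\<close> matter below.
\<close>

definition cut_edges :: "'a set \<Rightarrow> ('a \<Rightarrow> real) \<Rightarrow> 'a set set" where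
  "cut_edges V A = {e \<in> nsets V 2. \<exists>x\<in>e. \<exists>y\<in>e. A x \<noteq> A y}"

definition piecewise_balanced :: "real \<Rightarrow> nat \<Rightarrow> (nat \<Rightarrow> 'a set) \<Rightarrow> ('a \<Rightarrow> real) \<Rightarrow> bool" where
  "piecewise_balanced \<theta> r P A \<longleftrightarrow>
     measure_pmf.expectation (pmf_of_set {1..r})
       (\<lambda>i. \<bar>measure_pmf.expectation (pmf_of_set (P i)) A\<bar>) \<le> \<theta>"

definition equipartition :: "'a set \<Rightarrow> nat \<Rightarrow> (nat \<Rightarrow> 'a set) \<Rightarrow> bool" where
  "equipartition V r P \<longleftrightarrow>
     r \<ge> 1 \<and> V = (\<Union>i\<in>{1..r}. P i) \<and> disjoint_family_on P {1..r} \<and>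
     (\<forall>i\<in>{1..r}. real (card (P i)) = real (card V) / real r)"

text \<open>
  The dimension of the Euclidean space depends on the graph and so cannot be a type: a vector of
  \<open>\<real>\<^sup>d\<close> is a function \<^typ>\<open>nat \<Rightarrow> real\<close> of which only the coordinates below \<open>d\<close> are used.
\<close>

definition vnorm :: "nat \<Rightarrow> (nat \<Rightarrow> real) \<Rightarrow> real" where
  "vnorm d u = L2_set u {..<d}"

definition vdist :: "nat \<Rightarrow> (nat \<Rightarrow> real) \<Rightarrow> (nat \<Rightarrow> real) \<Rightarrow> real" where
  "vdist d u w = vnorm d (\<lambda>k. u k - w k)"

text \<open>The endpoints of an edge \<open>e = {x, y}\<close> are recovered as \<^term>\<open>Min e\<close> and \<^term>\<open>Max e\<close>.\<close>

definition sdp_value ::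
    "nat \<Rightarrow> ('a::linorder) set \<Rightarrow> ('a set \<Rightarrow> real) \<Rightarrow> ('a \<Rightarrow> nat \<Rightarrow> real) \<Rightarrow> real" where
  "sdp_value d V wt v =
     1 / 4 * (\<Sum>e\<in>nsets V 2. wt e * (vdist d (v (Min e)) (v (Max e)))\<^sup>2)"

end

theory Submission
  imports Defs
begin

text \<open>
  Points are pairs \<open>(f, x)\<close> of sign functions on the group \<open>G = \<int>\<^sub>2\<^sup>n\<close>, and \<open>u \<in> G\<close> acts by
  \<open>(f, x) \<mapsto> (f\<cdot>\<chi>\<^sub>u, x(\<cdot> + u))\<close>. The vertices are the orbits, a part consists of the orbits with
  a common class of \<open>f\<close>, and the edges come from independent noise of rate \<open>\<delta> \<sim> \<epsilon>\<close> on all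
  coordinates. The vector of an orbit is the normalised sum of \<open>x\<^sub>u (f\<cdot>\<chi>\<^sub>u)\<close> over \<open>u \<in> G\<close>, with each \<open>f\<cdot>\<chi>\<^sub>u\<close> replaced
  by its eighth tensor power. As the functions \<open>f\<cdot>\<chi>\<^sub>u\<close> are orthogonal, these are exact unit vectors,
  and the high power makes the largest Fourier coefficient of \<open>f\<cdot>g\<close> dominate, which gives the
  triangle inequality.

  A cut is a function \<open>A(f, x)\<close> invariant under \<open>G\<close>. Invariance makes all \<open>x\<close>-coordinates equally
  influential, so each has tiny low-degree influence. If \<open>A\<close> had noise sensitivity \<open>\<eta>\<close>, its part
  \<open>g\<close> of degree at most \<open>1/\<delta>\<close> would be close to \<open>A\<close>, and by the invariance principle still close to
  \<open>\<plusminus>1\<close> at the real points \<open>cos \<theta> x + sin \<theta> y\<close>. Rotating \<open>x\<close> into an independent \<open>y\<close> in \<open>1/\<surd>\<delta>\<close>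
  steps changes the sign of \<open>g\<close> with probability \<open>O(\<eta>)\<close> in each step, whereas balancedness forces a
  constant probability of a change in total; hence \<open>\<eta>\<close> is at least of order \<open>\<surd>\<epsilon>\<close>.
\<close>

section \<open>Fourier analysis on the discrete cube\<close>

text \<open>Closeness to the values 1 and -1 is measured by \<open>1 + cos (pi * u)\<close>, which
  vanishes to second order at both. It is bounded with bounded derivatives, so coordinates can be
  replaced one at a time between signs and rotated signs, and no Gaussian limit enters. Only the
  \<open>x\<close>-coordinates are rotated: translation moves them transitively, whereas the action
  keeps the position of every \<open>f\<close>-coordinate; moreover, resampling \<open>x\<close>
  alone is resampling inside a part, which is what balancedness controls. The tensor exponent is
  even, so that the sign of a coefficient does not matter; its value 8 enters the edge cost only as
  a linear factor and is large enough for two polynomial inequalities in the largest coefficient.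
  The group order has to beat the factor \<open>9 ^ k\<close> that hypercontractivity costs at
  degree \<open>k\<close> of order 1/\<epsilon>; this makes the number of vertices doubly
  exponential. Noise can stay within an orbit, but the graph has no loops; that mass is moved to one
  very short edge.\<close>

definition sg :: "'i set \<Rightarrow> 'i \<Rightarrow> real" where
  "sg X i = (if i \<in> X then -1 else 1)"

definition chi :: "'i set \<Rightarrow> 'i set \<Rightarrow> real" where
  "chi S X = (\<Prod>i\<in>S. sg X i)"

text \<open>The expectation over two independent uniform points of the cube, a point being the set
  of its coordinates equal to -1. Averages over one point use it too, with an integrand that ignores
  \<open>Y\<close>.\<close>

definition avg2 :: "'i set \<Rightarrow> ('i set \<Rightarrow> 'i set \<Rightarrow> real) \<Rightarrow> real" where
  "avg2 K \<phi> = (\<Sum>X\<in>Pow K. \<Sum>Y\<in>Pow K. \<phi> X Y) / 4 ^ card K"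

lemma sg_square [simp]: "sg X i * sg X i = 1"
  by (simp add: sg_def)

lemma sg_abs [simp]: "\<bar>sg X i\<bar> = 1"
  by (simp add: sg_def)

lemma sg_cases: "sg X i = 1 \<or> sg X i = -1"
  by (simp add: sg_def)

lemma sg_flip: "sg (sym_diff X {i}) j = (if j = i then - sg X j else sg X j)"
  by (auto simp: sg_def)

lemma avg2_add: "avg2 K (\<lambda>X Y. \<phi> X Y + \<psi> X Y) = avg2 K \<phi> + avg2 K \<psi>"
  by (simp add: avg2_def sum.distrib add_divide_distrib)

lemma avg2_diff: "avg2 K (\<lambda>X Y. \<phi> X Y - \<psi> X Y) = avg2 K \<phi> - avg2 K \<psi>"
  by (simp add: avg2_def sum_subtractf diff_divide_distrib)

lemma avg2_cmult: "avg2 K (\<lambda>X Y. c * \<phi> X Y) = c * avg2 K \<phi>"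
  by (simp add: avg2_def sum_distrib_left)

lemma avg2_sum: "avg2 K (\<lambda>X Y. \<Sum>s\<in>A. \<phi> s X Y) = (\<Sum>s\<in>A. avg2 K (\<phi> s))"
proof (cases "finite A")
  case True
  then show ?thesis
    by (induction A) (simp_all add: avg2_add, simp add: avg2_def)
next
  case False
  then show ?thesis by (simp add: avg2_def)
qed

lemma avg2_const: "finite K \<Longrightarrow> avg2 K (\<lambda>X Y. c) = c"
  using power_mult_distrib[of "2::real" 2 "card K"] by (simp add: avg2_def card_Pow)

lemma avg2_cong:
  "(\<And>X Y. X \<subseteq> K \<Longrightarrow> Y \<subseteq> K \<Longrightarrow> \<phi> X Y = \<psi> X Y) \<Longrightarrow> avg2 K \<phi> = avg2 K \<psi>"
  by (simp add: avg2_def)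

lemma avg2_mono:
  "(\<And>X Y. X \<subseteq> K \<Longrightarrow> Y \<subseteq> K \<Longrightarrow> \<phi> X Y \<le> \<psi> X Y) \<Longrightarrow> avg2 K \<phi> \<le> avg2 K \<psi>"
  by (auto simp: avg2_def intro!: divide_right_mono sum_mono)

lemma avg2_abs: "\<bar>avg2 K \<phi>\<bar> \<le> avg2 K (\<lambda>X Y. \<bar>\<phi> X Y\<bar>)"
proof -
  have "\<bar>\<Sum>X\<in>Pow K. \<Sum>Y\<in>Pow K. \<phi> X Y\<bar> \<le> (\<Sum>X\<in>Pow K. \<bar>\<Sum>Y\<in>Pow K. \<phi> X Y\<bar>)"
    by (rule sum_abs)
  also have "\<dots> \<le> (\<Sum>X\<in>Pow K. \<Sum>Y\<in>Pow K. \<bar>\<phi> X Y\<bar>)"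
    by (intro sum_mono sum_abs)
  finally show ?thesis
    by (simp add: avg2_def abs_divide divide_right_mono)
qed

lemma sum_Pow_flip:
  assumes "i \<in> K"
  shows "(\<Sum>X\<in>Pow K. \<phi> (sym_diff X {i})) = (\<Sum>X\<in>Pow K. \<phi> X)"
  by (rule sum.reindex_bij_witness[where i="\<lambda>X. sym_diff X {i}" and j="\<lambda>X. sym_diff X {i}"])
     (use assms in \<open>auto intro: arg_cong[where f=\<phi>]\<close>)

lemma avg2_flip1: "i \<in> K \<Longrightarrow> avg2 K (\<lambda>X Y. \<phi> (sym_diff X {i}) Y) = avg2 K \<phi>"
  unfolding avg2_def using sum_Pow_flip[of i K "\<lambda>X. \<Sum>Y\<in>Pow K. \<phi> X Y"] by simp

lemma avg2_flip2: "i \<in> K \<Longrightarrow> avg2 K (\<lambda>X Y. \<phi> X (sym_diff Y {i})) = avg2 K \<phi>"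
  unfolding avg2_def by (simp add: sum_Pow_flip[of i K])

lemma avg2_average1:
  assumes "i \<in> K"
  shows "avg2 K \<phi> = avg2 K (\<lambda>X Y. (\<phi> X Y + \<phi> (sym_diff X {i}) Y) / 2)"
  using avg2_flip1[OF assms, of \<phi>] avg2_add[of K \<phi> "\<lambda>X Y. \<phi> (sym_diff X {i}) Y"]
    avg2_cmult[of K "1/2" "\<lambda>X Y. \<phi> X Y + \<phi> (sym_diff X {i}) Y"]
  by simp

lemma avg2_average2:
  assumes "i \<in> K"
  shows "avg2 K \<phi> = avg2 K (\<lambda>X Y. (\<phi> X Y + \<phi> X (sym_diff Y {i})) / 2)"
  using avg2_flip2[OF assms, of \<phi>] avg2_add[of K \<phi> "\<lambda>X Y. \<phi> X (sym_diff Y {i})"]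
    avg2_cmult[of K "1/2" "\<lambda>X Y. \<phi> X Y + \<phi> X (sym_diff Y {i})"]
  by simp

lemma avg2_Cauchy_Schwarz:
  "(avg2 K (\<lambda>X Y. \<phi> X Y * \<psi> X Y))\<^sup>2 \<le> avg2 K (\<lambda>X Y. (\<phi> X Y)\<^sup>2) * avg2 K (\<lambda>X Y. (\<psi> X Y)\<^sup>2)"
proof -
  have "(\<Sum>p\<in>Pow K \<times> Pow K. \<phi> (fst p) (snd p) * \<psi> (fst p) (snd p))\<^sup>2
    \<le> (\<Sum>p\<in>Pow K \<times> Pow K. (\<phi> (fst p) (snd p))\<^sup>2) * (\<Sum>p\<in>Pow K \<times> Pow K. (\<psi> (fst p) (snd p))\<^sup>2)"
    by (rule Cauchy_Schwarz_ineq_sum)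
  then have "(\<Sum>X\<in>Pow K. \<Sum>Y\<in>Pow K. \<phi> X Y * \<psi> X Y)\<^sup>2
    \<le> (\<Sum>X\<in>Pow K. \<Sum>Y\<in>Pow K. (\<phi> X Y)\<^sup>2) * (\<Sum>X\<in>Pow K. \<Sum>Y\<in>Pow K. (\<psi> X Y)\<^sup>2)"
    by (simp add: sum.cartesian_product case_prod_unfold)
  then show ?thesis
    by (simp add: avg2_def power_divide power2_eq_square divide_right_mono)
qed

text \<open>One expansion with two uses: with \<rho> = 1 it gives the orthogonality of characters,
  and for general \<rho> it diagonalises the noise.\<close>

lemma prod_one_plus_sg:
  assumes "finite K"
  shows "(\<Prod>i\<in>K. 1 + \<rho> * (sg X i * sg Y i)) = (\<Sum>S\<in>Pow K. \<rho> ^ card S * (chi S X * chi S Y))"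
proof -
  have "(\<Prod>i\<in>K. 1 + \<rho> * (sg X i * sg Y i)) = (\<Prod>i\<in>K. \<rho> * (sg X i * sg Y i) + 1)"
    by (simp add: add.commute)
  also have "\<dots> = (\<Sum>S\<in>Pow K. (\<Prod>i\<in>S. \<rho> * (sg X i * sg Y i)) * (\<Prod>i\<in>K - S. 1))"
    by (rule prod_add[OF assms])
  finally show ?thesis
    by (simp add: chi_def prod.distrib)
qed

lemma sum_chi_chi:
  assumes "finite K" "X \<subseteq> K" "Y \<subseteq> K"
  shows "(\<Sum>S\<in>Pow K. chi S X * chi S Y) = (if X = Y then 2 ^ card K else 0)"
proof -
  have "(\<Sum>S\<in>Pow K. chi S X * chi S Y) = (\<Prod>i\<in>K. 1 + sg X i * sg Y i)"
    using prod_one_plus_sg[OF assms(1), of 1 X Y] by simp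
  also have "\<dots> = (if X = Y then 2 ^ card K else 0)"
  proof (cases "X = Y")
    case False
    then obtain i where "i \<in> K" "i \<in> X \<longleftrightarrow> i \<notin> Y"
      using assms by blast
    then have "\<exists>i\<in>K. 1 + sg X i * sg Y i = 0"
      by (auto simp: sg_def)
    with False assms(1) show ?thesis by simp
  qed simp
  finally show ?thesis .
qed

definition four :: "'i set \<Rightarrow> ('i set \<Rightarrow> real) \<Rightarrow> 'i set \<Rightarrow> real" where
  "four K A S = (\<Sum>X\<in>Pow K. A X * chi S X) / 2 ^ card K"

text \<open>The multilinear extension takes real arguments because the rotated points used later are
  not sign vectors.\<close>

definition mlin :: "'i set \<Rightarrow> ('i set \<Rightarrow> real) \<Rightarrow> ('i \<Rightarrow> real) \<Rightarrow> real" where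
  "mlin K a w = (\<Sum>S\<in>Pow K. a S * (\<Prod>i\<in>S. w i))"

text \<open>The density of a \<open>\<rho>\<close>-correlated pair of points relative to the uniform distribution.\<close>

definition noise :: "'i set \<Rightarrow> real \<Rightarrow> 'i set \<Rightarrow> 'i set \<Rightarrow> real" where
  "noise K \<rho> X Y = (\<Prod>i\<in>K. 1 + \<rho> * (sg X i * sg Y i))"

lemma fourier_inversion:
  assumes "finite K" "X \<subseteq> K"
  shows "mlin K (four K A) (sg X) = A X"
proof -
  have "mlin K (four K A) (sg X) = (\<Sum>S\<in>Pow K. \<Sum>Y\<in>Pow K. A Y * (chi S Y * chi S X) / 2 ^ card K)"
    by (simp add: mlin_def four_def chi_def[symmetric] sum_divide_distrib sum_distrib_right
        mult.assoc)
  also have "\<dots> = (\<Sum>Y\<in>Pow K. A Y * (\<Sum>S\<in>Pow K. chi S Y * chi S X) / 2 ^ card K)"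
    by (subst sum.swap) (simp add: sum_divide_distrib sum_distrib_left)
  also have "\<dots> = (\<Sum>Y\<in>Pow K. if Y = X then A Y else 0)"
    by (intro sum.cong refl) (use assms in \<open>simp add: sum_chi_chi\<close>)
  also have "\<dots> = A X"
    using assms by (simp add: finite_Pow_iff)
  finally show ?thesis .
qed

lemma noise_fourier:
  assumes "finite K"
  shows "avg2 K (\<lambda>X Y. noise K \<rho> X Y * (A X * B Y))
    = (\<Sum>S\<in>Pow K. \<rho> ^ card S * (four K A S * four K B S))"
proof -
  have *: "\<rho> ^ card S * (four K A S * four K B S)
      = avg2 K (\<lambda>X Y. \<rho> ^ card S * (chi S X * chi S Y) * (A X * B Y))" for S
  proof -
    have "four K A S * four K B S = avg2 K (\<lambda>X Y. (A X * chi S X) * (B Y * chi S Y))"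
      by (simp add: four_def avg2_def flip: sum_product power_mult_distrib)
    then show ?thesis
      by (simp add: avg2_cmult[symmetric] ac_simps)
  qed
  have "avg2 K (\<lambda>X Y. noise K \<rho> X Y * (A X * B Y))
    = avg2 K (\<lambda>X Y. \<Sum>S\<in>Pow K. \<rho> ^ card S * (chi S X * chi S Y) * (A X * B Y))"
    by (simp add: noise_def prod_one_plus_sg[OF assms] sum_distrib_right)
  also have "\<dots> = (\<Sum>S\<in>Pow K. \<rho> ^ card S * (four K A S * four K B S))"
    by (simp add: avg2_sum *)
  finally show ?thesis .
qed

text \<open>At rate 1 the noise density is \<open>2 ^ card K\<close> on the diagonal and 0
  elsewhere, so this is the case \<rho> = 1 of \<open>noise_fourier\<close>.\<close>

lemma parseval:
  assumes "finite K"
  shows "avg2 K (\<lambda>X Y. A X * B X) = (\<Sum>S\<in>Pow K. four K A S * four K B S)"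
proof -
  have "avg2 K (\<lambda>X Y. noise K 1 X Y * (A X * B Y)) = avg2 K (\<lambda>X Y. A X * B X)"
  proof -
    have "(\<Sum>Y\<in>Pow K. noise K 1 X Y * (A X * B Y)) = (\<Sum>Y\<in>Pow K. A X * B X)" if "X \<in> Pow K" for X
    proof -
      have "(\<Sum>Y\<in>Pow K. noise K 1 X Y * (A X * B Y)) = (\<Sum>Y\<in>Pow K. if X = Y then 2 ^ card K * (A X *
          B X) else 0)"
        unfolding noise_def prod_one_plus_sg[OF assms]
        by (intro sum.cong refl) (use that assms in \<open>simp add: sum_chi_chi\<close>)
      then show ?thesis
        using that assms by (simp add: card_Pow)
    qed
    then show ?thesis by (simp add: avg2_def)
  qed
  then show ?thesis
    using noise_fourier[OF assms, of 1 A B] by simp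
qed

section \<open>Multilinear polynomials in rotated sign vectors\<close>

text \<open>The angle may vary with the coordinate: the pair (1, 0) leaves a coordinate at
  \<open>X\<close>, so a rotation can be confined to a subset, and partially replaced points have
  the same form.\<close>

definition rot :: "('i \<Rightarrow> real) \<Rightarrow> ('i \<Rightarrow> real) \<Rightarrow> 'i set \<Rightarrow> 'i set \<Rightarrow> 'i \<Rightarrow> real" where
  "rot c s X Y i = c i * sg X i + s i * sg Y i"

lemma rot_flip1: "rot c s (sym_diff X {i}) Y j
    = (if j = i then - c j * sg X j + s j * sg Y j else rot c s X Y j)"
  by (simp add: rot_def sg_flip)

lemma rot_flip2: "rot c s X (sym_diff Y {i}) j
    = (if j = i then c j * sg X j - s j * sg Y j else rot c s X Y j)"
  by (simp add: rot_def sg_flip)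

text \<open>Averaging over a flip of \<open>X\<close> at \<open>j\<close> cancels the mixed terms
  \<open>sg X j * sg Y j\<close> and leaves the scalar product of the coefficient pairs; the
  coordinates are peeled off one by one.\<close>

lemma avg2_rot_prod_same:
  assumes "finite S" "S \<subseteq> K"
  shows "avg2 K (\<lambda>X Y. \<Prod>i\<in>S. rot c s X Y i * rot c' s' X Y i) = (\<Prod>i\<in>S. c i * c' i + s i * s' i) *
      avg2 K (\<lambda>X Y. 1)"
  using assms
proof (induction S)
  case empty
  then show ?case by (simp add: avg2_const)
next
  case (insert j S)
  let ?P = "\<lambda>X Y. \<Prod>i\<in>S. rot c s X Y i * rot c' s' X Y i"
  have *: "(\<Prod>i\<in>S. rot c s (sym_diff X {j}) Y i * rot c' s' (sym_diff X {j}) Y i) = ?P X Y" for X Y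
    by (intro prod.cong refl) (use insert in \<open>auto simp: rot_flip1\<close>)
  have sq: "sg X i * (sg X i * z) = z" for X :: "'a set" and i z
    by (simp flip: mult.assoc)
  have "avg2 K (\<lambda>X Y. \<Prod>i\<in>insert j S. rot c s X Y i * rot c' s' X Y i)
    = avg2 K (\<lambda>X Y. rot c s X Y j * rot c' s' X Y j * ?P X Y)"
    using insert by simp
  also have "\<dots> = avg2 K (\<lambda>X Y. (c j * c' j + s j * s' j) * ?P X Y)"
  proof -
    have avg: "(rot c s X Y j * rot c' s' X Y j * P
        + rot c s (sym_diff X {j}) Y j * rot c' s' (sym_diff X {j}) Y j * P) / 2
        = (c j * c' j + s j * s' j) * P" for X Y P
      by (simp add: rot_flip1) (simp add: rot_def algebra_simps sq)
    have "j \<in> K" using insert by simp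
    then show ?thesis
      by (subst avg2_average1[of j]) (simp_all only: * avg)
  qed
  also have "\<dots> = (c j * c' j + s j * s' j) * avg2 K ?P"
    by (rule avg2_cmult)
  finally show ?case using insert by simp
qed

text \<open>Flipping \<open>X\<close> and \<open>Y\<close> together at a coordinate that lies in
  only one of the two sets negates exactly one of the products.\<close>

lemma avg2_rot_prod_diff:
  assumes fin: "finite K" and S: "S \<subseteq> K" and T: "T \<subseteq> K" and "S \<noteq> T"
  shows "avg2 K (\<lambda>X Y. (\<Prod>i\<in>S. rot c s X Y i) * (\<Prod>i\<in>T. rot c' s' X Y i)) = 0"
proof -
  obtain j where j: "j \<in> K" "j \<in> S \<longleftrightarrow> j \<notin> T"
    using assms by blast
  have 0: "rot c s (sym_diff X {j}) (sym_diff Y {j}) i = (if i = j then - 1 else 1) * rot c s X Y i"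
    for X Y i and c s :: "'a \<Rightarrow> real"
    by (simp add: rot_def sg_flip)
  have 1: "(\<Prod>i\<in>S. rot c s (sym_diff X {j}) (sym_diff Y {j}) i)
      = (if j \<in> S then - 1 else 1) * (\<Prod>i\<in>S. rot c s X Y i)"
    if "S \<subseteq> K" for S X Y and c s :: "'a \<Rightarrow> real"
  proof -
    have "finite S" using that fin finite_subset by blast
    then show ?thesis
      by (simp add: 0 prod.distrib)
  qed
  let ?F = "\<lambda>X Y. (\<Prod>i\<in>S. rot c s X Y i) * (\<Prod>i\<in>T. rot c' s' X Y i)"
  have "avg2 K ?F = avg2 K (\<lambda>X Y. ?F (sym_diff X {j}) (sym_diff Y {j}))"
    using avg2_flip1[OF j(1), of ?F] avg2_flip2[OF j(1), of "\<lambda>X Y. ?F (sym_diff X {j}) Y"] by simp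
  also have "\<dots> = avg2 K (\<lambda>X Y. (-1) * ?F X Y)"
    unfolding 1[OF S] 1[OF T] using j(2) by (intro avg2_cong) auto
  finally show ?thesis
    unfolding avg2_cmult by simp
qed

text \<open>Monomials at two rotations of the same pair remain orthogonal. For unit coefficient
  pairs, each coordinate of a diagonal term contributes the cosine of the angle between the
  rotations. Equal rotations give norms, consecutive ones the change per step.\<close>

lemma avg2_mlin_mlin:
  assumes "finite K"
  shows "avg2 K (\<lambda>X Y. mlin K a (rot c s X Y) * mlin K b (rot c' s' X Y))
    = (\<Sum>S\<in>Pow K. a S * b S * (\<Prod>i\<in>S. c i * c' i + s i * s' i))"
proof -
  have *: "avg2 K (\<lambda>X Y. (a S * (\<Prod>i\<in>S. rot c s X Y i)) * (b T * (\<Prod>i\<in>T. rot c' s' X Y i)))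
    = (if S = T then a S * b S * (\<Prod>i\<in>S. c i * c' i + s i * s' i) else 0)"
    if "S \<in> Pow K" "T \<in> Pow K" for S T
  proof -
    have "avg2 K (\<lambda>X Y. (a S * (\<Prod>i\<in>S. rot c s X Y i)) * (b T * (\<Prod>i\<in>T. rot c' s' X Y i)))
      = avg2 K (\<lambda>X Y. (a S * b T) * ((\<Prod>i\<in>S. rot c s X Y i) * (\<Prod>i\<in>T. rot c' s' X Y i)))"
      by (simp add: ac_simps)
    also have "\<dots> = (a S * b T) * avg2 K (\<lambda>X Y. ((\<Prod>i\<in>S. rot c s X Y i) * (\<Prod>i\<in>T. rot c' s' X Y i)))"
      by (rule avg2_cmult)
    also have "\<dots> = (if S = T then a S * b S * (\<Prod>i\<in>S. c i * c' i + s i * s' i) else 0)"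
    proof (cases "S = T")
      case True
      moreover have "finite T" using that assms finite_subset by auto
      ultimately show ?thesis
        using that assms by (simp add: avg2_rot_prod_same avg2_const flip: prod.distrib)
    next
      case False
      then show ?thesis using that assms by (simp add: avg2_rot_prod_diff)
    qed
    finally show ?thesis .
  qed
  have "avg2 K (\<lambda>X Y. mlin K a (rot c s X Y) * mlin K b (rot c' s' X Y))
    = (\<Sum>S\<in>Pow K. \<Sum>T\<in>Pow K. avg2 K (\<lambda>X Y. (a S * (\<Prod>i\<in>S. rot c s X Y i)) * (b T * (\<Prod>i\<in>T. rot c' s' X
        Y i))))"
    by (simp add: mlin_def sum_product avg2_sum)
  also have "\<dots> = (\<Sum>S\<in>Pow K. \<Sum>T\<in>Pow K. if S = T then a S * b S * (\<Prod>i\<in>S. c i * c' i + s i * s' i)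
      else 0)"
    by (intro sum.cong refl *)
  finally show ?thesis
    using assms by simp
qed

text \<open>\<open>R\<close> and \<open>D\<close> stand for whatever does not depend on the
  coordinate \<open>j\<close>; conditional on them, the rotated coordinate takes its four values
  with equal weight.\<close>

lemma avg2_rot_average:
  assumes j: "j \<in> K"
    and R1: "\<And>X Y. R (sym_diff X {j}) Y = R X Y" and R2: "\<And>X Y. R X (sym_diff Y {j}) = R X Y"
    and D1: "\<And>X Y. D (sym_diff X {j}) Y = D X Y" and D2: "\<And>X Y. D X (sym_diff Y {j}) = D X Y"
  shows "avg2 K (\<lambda>X Y. F (rot c s X Y j) (R X Y) (D X Y))
    = avg2 K (\<lambda>X Y. (F (c j + s j) (R X Y) (D X Y) + F (c j - s j) (R X Y) (D X Y)
         + F (- c j + s j) (R X Y) (D X Y) + F (- c j - s j) (R X Y) (D X Y)) / 4)"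
proof -
  let ?G = "\<lambda>X Y. F (rot c s X Y j) (R X Y) (D X Y)"
  have "avg2 K ?G = avg2 K (\<lambda>X Y. ((?G X Y + ?G (sym_diff X {j}) Y) / 2
      + (?G X (sym_diff Y {j}) + ?G (sym_diff X {j}) (sym_diff Y {j})) / 2) / 2)"
    using avg2_average1[OF j, of ?G]
      avg2_average2[OF j, of "\<lambda>X Y. (?G X Y + ?G (sym_diff X {j}) Y) / 2"] by simp
  also have "\<dots> = avg2 K (\<lambda>X Y. (F (c j + s j) (R X Y) (D X Y) + F (c j - s j) (R X Y) (D X Y)
         + F (- c j + s j) (R X Y) (D X Y) + F (- c j - s j) (R X Y) (D X Y)) / 4)"
    (is "_ = avg2 K ?H")
  proof (rule avg2_cong)
    fix X Y
    have r: "rot c s X Y j = c j * sg X j + s j * sg Y j"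
      "rot c s (sym_diff X {j}) Y j = - c j * sg X j + s j * sg Y j"
      "rot c s X (sym_diff Y {j}) j = c j * sg X j - s j * sg Y j"
      "rot c s (sym_diff X {j}) (sym_diff Y {j}) j = - c j * sg X j - s j * sg Y j"
      unfolding rot_def sg_flip by simp_all
    show "((?G X Y + ?G (sym_diff X {j}) Y) / 2
      + (?G X (sym_diff Y {j}) + ?G (sym_diff X {j}) (sym_diff Y {j})) / 2) / 2 = ?H X Y"
      unfolding r R1 R2 D1 D2 using sg_cases[of X j] sg_cases[of Y j]
      by (elim disjE) (simp_all add: algebra_simps, simp_all add: add_divide_distrib)
  qed
  finally show ?thesis .
qed

section \<open>Splitting off one variable, and hypercontractivity\<close>

lemma mlin_insert:
  assumes "finite M" "i \<notin> M"
  shows "mlin (insert i M) a w = mlin M a w + w i * mlin M (\<lambda>S. a (insert i S)) w"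
proof -
  have inj: "inj_on (insert i) (Pow M)"
    using assms(2) by (auto simp: inj_on_def)
  have "mlin (insert i M) a w = mlin M a w + (\<Sum>S\<in>insert i ` Pow M. a S * (\<Prod>j\<in>S. w j))"
    unfolding mlin_def Pow_insert
    by (rule sum.union_disjoint) (use assms in auto)
  also have "(\<Sum>S\<in>insert i ` Pow M. a S * (\<Prod>j\<in>S. w j))
      = (\<Sum>S\<in>Pow M. a (insert i S) * (\<Prod>j\<in>insert i S. w j))"
    by (subst sum.reindex[OF inj]) simp
  also have "\<dots> = (\<Sum>S\<in>Pow M. w i * (a (insert i S) * (\<Prod>j\<in>S. w j)))"
  proof (intro sum.cong refl)
    fix S assume "S \<in> Pow M"
    then have "finite S" "i \<notin> S" using assms finite_subset by auto
    then show "a (insert i S) * (\<Prod>j\<in>insert i S. w j) = w i * (a (insert i S) * (\<Prod>j\<in>S. w j))"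
      by simp
  qed
  finally show ?thesis
    by (simp add: mlin_def sum_distrib_left)
qed

lemma mlin_cong:
  assumes "\<And>S. S \<subseteq> M \<Longrightarrow> a S = b S" "\<And>i. i \<in> M \<Longrightarrow> w i = w' i"
  shows "mlin M a w = mlin M b w'"
  unfolding mlin_def
  by (intro sum.cong refl arg_cong2[where f="(*)"] prod.cong) (use assms in auto)

lemma sum_Pow_insert:
  assumes "finite M" "i \<notin> M"
  shows "(\<Sum>S\<in>Pow (insert i M). \<phi> S) = (\<Sum>S\<in>Pow M. \<phi> S) + (\<Sum>S\<in>Pow M. \<phi> (insert i S))"
proof -
  have inj: "inj_on (insert i) (Pow M)"
    using assms(2) by (auto simp: inj_on_def)
  have "(\<Sum>S\<in>Pow (insert i M). \<phi> S) = (\<Sum>S\<in>Pow M. \<phi> S) + (\<Sum>S\<in>insert i ` Pow M. \<phi> S)"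
    unfolding Pow_insert by (rule sum.union_disjoint) (use assms in auto)
  then show ?thesis
    by (simp add: sum.reindex[OF inj])
qed

lemma mlin_rot_flip:
  assumes "j \<notin> M"
  shows "mlin M a (rot c s (sym_diff X {j}) Y) = mlin M a (rot c s X Y)"
    and "mlin M a (rot c s X (sym_diff Y {j})) = mlin M a (rot c s X Y)"
  by (rule mlin_cong; use assms in \<open>auto simp: rot_flip1 rot_flip2 simp del: Un_insert_right\<close>)+

text \<open>The hypercontractive bound of a fourth moment by second moments, by induction on the
  variables. Odd moments of a rotated sign vanish, its second moment is 1 and its fourth moment at
  most 2; since the induction tolerates 9, rotated signs obey the same bound as signs.\<close>

lemma bonami:
  assumes "finite K" "M \<subseteq> K" and cs: "\<And>i. (c i)\<^sup>2 + (s i)\<^sup>2 = 1"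
  shows "avg2 K (\<lambda>X Y. mlin M a (rot c s X Y) ^ 4) \<le> (\<Sum>S\<in>Pow M. 3 ^ card S * (a S)\<^sup>2)\<^sup>2"
proof -
  have "finite M" using assms(1,2) finite_subset by blast
  then show ?thesis using assms(2)
  proof (induction M arbitrary: a)
    case empty
    then show ?case using assms(1) by (simp add: mlin_def avg2_const power_mult[symmetric])
  next
    case (insert j M)
    define R where "R = (\<lambda>X Y. mlin M a (rot c s X Y))"
    define b where "b = (\<lambda>S. a (insert j S))"
    define D where "D = (\<lambda>X Y. mlin M b (rot c s X Y))"
    define r where "r = (\<Sum>S\<in>Pow M. 3 ^ card S * (a S)\<^sup>2)"
    define d where "d = (\<Sum>S\<in>Pow M. 3 ^ card S * (b S)\<^sup>2)"
    have r0: "r \<ge> 0" and d0: "d \<ge> 0"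
      by (auto simp: r_def d_def intro!: sum_nonneg)
    have j: "j \<in> K" using insert by auto
    have IH: "avg2 K (\<lambda>X Y. R X Y ^ 4) \<le> r\<^sup>2" "avg2 K (\<lambda>X Y. D X Y ^ 4) \<le> d\<^sup>2"
      using insert unfolding R_def D_def r_def d_def by auto
    \<comment> \<open>Cauchy-Schwarz reduces the mixed term to the fourth moments of
      \<open>R\<close> and \<open>D\<close>, which the induction hypothesis covers.\<close>
    have "(avg2 K (\<lambda>X Y. (R X Y)\<^sup>2 * (D X Y)\<^sup>2))\<^sup>2
        \<le> avg2 K (\<lambda>X Y. R X Y ^ 4) * avg2 K (\<lambda>X Y. D X Y ^ 4)"
      using avg2_Cauchy_Schwarz[of K "\<lambda>X Y. (R X Y)\<^sup>2" "\<lambda>X Y. (D X Y)\<^sup>2"] by simp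
    also have "\<dots> \<le> r\<^sup>2 * d\<^sup>2"
    proof (rule mult_mono[OF IH])
      show "0 \<le> avg2 K (\<lambda>X Y. D X Y ^ 4)"
        by (auto simp: avg2_def intro!: divide_nonneg_nonneg sum_nonneg)
    qed simp
    finally have RD: "avg2 K (\<lambda>X Y. (R X Y)\<^sup>2 * (D X Y)\<^sup>2) \<le> r * d"
      using r0 d0 power2_le_imp_le[of "avg2 K (\<lambda>X Y. (R X Y)\<^sup>2 * (D X Y)\<^sup>2)" "r * d"]
      by (simp add: power_mult_distrib)
    let ?F = "\<lambda>w R D. (R + w * D) ^ 4"
    have "avg2 K (\<lambda>X Y. mlin (insert j M) a (rot c s X Y) ^ 4)
        = avg2 K (\<lambda>X Y. ?F (rot c s X Y j) (R X Y) (D X Y))"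
      using insert by (simp add: mlin_insert R_def D_def b_def)
    also have "\<dots> = avg2 K (\<lambda>X Y. (?F (c j + s j) (R X Y) (D X Y) + ?F (c j - s j) (R X Y) (D X Y)
         + ?F (- c j + s j) (R X Y) (D X Y) + ?F (- c j - s j) (R X Y) (D X Y)) / 4)"
      using avg2_rot_average[OF j, of R D ?F c s] insert.hyps
      unfolding R_def D_def by (simp only: mlin_rot_flip not_False_eq_True)
    also have "\<dots> \<le> avg2 K (\<lambda>X Y. R X Y ^ 4 + 6 * ((R X Y)\<^sup>2 * (D X Y)\<^sup>2) + 2 * D X Y ^ 4)"
    proof (rule avg2_mono)
      fix X Y
      let ?c = "c j" and ?s = "s j" and ?R = "R X Y" and ?D = "D X Y"
      have "(?F (?c + ?s) ?R ?D + ?F (?c - ?s) ?R ?D + ?F (- ?c + ?s) ?R ?D + ?F (- ?c - ?s) ?R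
          ?D) / 4
        = ?R ^ 4 + 6 * (?R\<^sup>2 * ?D\<^sup>2) * (?c\<^sup>2 + ?s\<^sup>2) + ((?c\<^sup>2 + ?s\<^sup>2)\<^sup>2 + 4 * (?c\<^sup>2 * ?s\<^sup>2)) * ?D
            ^ 4"
        by algebra
      moreover have "4 * (?c\<^sup>2 * ?s\<^sup>2) \<le> 1"
      proof -
        have "(?c\<^sup>2 + ?s\<^sup>2)\<^sup>2 - 4 * (?c\<^sup>2 * ?s\<^sup>2) = (?c\<^sup>2 - ?s\<^sup>2)\<^sup>2"
          by algebra
        then show ?thesis
          using cs[of j] by (smt (verit) one_power2 zero_le_power2)
      qed
      moreover have "?D ^ 4 \<ge> 0" by simp
      ultimately show "(?F (?c + ?s) ?R ?D + ?F (?c - ?s) ?R ?D + ?F (- ?c + ?s) ?R ?D + ?F (- ?c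
          - ?s) ?R ?D) / 4
        \<le> ?R ^ 4 + 6 * (?R\<^sup>2 * ?D\<^sup>2) + 2 * ?D ^ 4"
        using mult_right_mono[of "4 * (?c\<^sup>2 * ?s\<^sup>2)" 1 "?D ^ 4"]
        unfolding cs by (simp add: distrib_right)
    qed
    also have "\<dots> = avg2 K (\<lambda>X Y. R X Y ^ 4) + 6 * avg2 K (\<lambda>X Y. (R X Y)\<^sup>2 * (D X Y)\<^sup>2)
        + 2 * avg2 K (\<lambda>X Y. D X Y ^ 4)"
      by (simp add: avg2_add avg2_cmult)
    also have "\<dots> \<le> r\<^sup>2 + 6 * (r * d) + 2 * d\<^sup>2"
      using IH RD by linarith
    also have "\<dots> \<le> (r + 3 * d)\<^sup>2"
      by (simp add: power2_eq_square algebra_simps)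
    also have "r + 3 * d = (\<Sum>S\<in>Pow (insert j M). 3 ^ card S * (a S)\<^sup>2)"
    proof -
      have "(\<Sum>S\<in>Pow M. 3 ^ card (insert j S) * (a (insert j S))\<^sup>2) = 3 * d"
        unfolding d_def sum_distrib_left b_def
      proof (intro sum.cong refl)
        fix S assume "S \<in> Pow M"
        then have "finite S" "j \<notin> S" using insert.hyps finite_subset by auto
        then show "3 ^ card (insert j S) * (a (insert j S))\<^sup>2 = 3 * (3 ^ card S * (a (insert j
            S))\<^sup>2)"
          by simp
      qed
      then show ?thesis
        using insert.hyps by (simp add: sum_Pow_insert r_def)
    qed
    finally show ?case .
  qed
qed

section \<open>Replacing signs by rotated signs\<close>

lemma cos_quartic: "\<bar>cos x - (1 - x\<^sup>2 / 2)\<bar> \<le> x ^ 4 / 24" for x :: real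
proof -
  obtain t where "cos x = (\<Sum>m<4. cos_coeff m * x ^ m) + cos (t + 1/2 * real 4 * pi) / fact 4 * x ^
      4"
    using Maclaurin_cos_expansion[of x 4] by blast
  moreover have "(\<Sum>m<4. cos_coeff m * x ^ m) = 1 - x\<^sup>2 / 2"
  proof -
    have "{..<4::nat} = {0, 1, 2, 3}" by auto
    then show ?thesis by (simp add: cos_coeff_def)
  qed
  moreover have "\<bar>cos (t + 1/2 * real 4 * pi) / fact 4 * x ^ 4\<bar> \<le> x ^ 4 / 24"
    using mult_right_mono[OF abs_cos_le_one[of "t + 1/2 * real 4 * pi"], of "x ^ 4"]
    by (simp add: abs_mult fact_numeral)
  ultimately show ?thesis by linarith
qed

text \<open>The values c + s and c - s have mean square 1, like a sign, so the quadratic terms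
  cancel. The quartic errors add up to 2/24 + 1/24.\<close>

lemma cos_rot_quartic:
  fixes c s u :: real
  assumes "c\<^sup>2 + s\<^sup>2 = 1"
  shows "\<bar>(cos ((c + s) * u) + cos ((c - s) * u)) / 2 - cos u\<bar> \<le> u ^ 4 / 8"
proof -
  have "((c + s) * u)\<^sup>2 + ((c - s) * u)\<^sup>2 = 2 * (c\<^sup>2 + s\<^sup>2) * u\<^sup>2"
    by algebra
  then have 2: "((c + s) * u)\<^sup>2 + ((c - s) * u)\<^sup>2 = 2 * u\<^sup>2"
    using assms by simp
  have "((c + s) * u) ^ 4 + ((c - s) * u) ^ 4 = 2 * ((c\<^sup>2 + s\<^sup>2)\<^sup>2 * 2 - (c\<^sup>2 - s\<^sup>2)\<^sup>2) * u ^ 4"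
    by algebra
  also have "\<dots> \<le> 4 * u ^ 4"
    using assms by (intro mult_right_mono) auto
  finally have "((c + s) * u) ^ 4 + ((c - s) * u) ^ 4 \<le> 4 * u ^ 4" .
  with 2 show ?thesis
    using cos_quartic[of "(c + s) * u"] cos_quartic[of "(c - s) * u"] cos_quartic[of u]
    unfolding abs_le_iff by argo
qed

text \<open>The error is of fourth order because the first three moments of a sign and of a rotated sign
  agree.\<close>

lemma lindeberg_step:
  fixes B :: real
  assumes K: "finite K" "j \<in> K"
    and cs: "\<And>i. (c i)\<^sup>2 + (s i)\<^sup>2 = 1" "\<And>i. (c' i)\<^sup>2 + (s' i)\<^sup>2 = 1"
    and eq: "\<And>i. i \<noteq> j \<Longrightarrow> c i = c' i \<and> s i = s' i" and j: "c j = 1" "s j = 0"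
    and small: "(\<Sum>S | S \<subseteq> K \<and> j \<in> S. 3 ^ card S * (a S)\<^sup>2) \<le> B"
  shows "\<bar>avg2 K (\<lambda>X Y. cos (pi * mlin K a (rot c' s' X Y))) - avg2 K (\<lambda>X Y. cos (pi * mlin K a
      (rot c s X Y)))\<bar>
      \<le> 32 * B\<^sup>2"
proof -
  define M where "M = K - {j}"
  have M: "K = insert j M" "j \<notin> M" "finite M" "M \<subseteq> K" using K by (auto simp: M_def)
  define R where "R = (\<lambda>X Y. mlin M a (rot c s X Y))"
  define b where "b = (\<lambda>S. a (insert j S))"
  define D where "D = (\<lambda>X Y. mlin M b (rot c s X Y))"
  have R': "mlin M a (rot c' s' X Y) = R X Y" and D': "mlin M b (rot c' s' X Y) = D X Y" for X Y
    unfolding R_def D_def by (rule mlin_cong; use eq M(2) in \<open>force simp: rot_def\<close>)+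
  let ?F = "\<lambda>w R D. cos (pi * (R + w * D))"
  have avg: "avg2 K (\<lambda>X Y. ?F (rot c s X Y j) (R X Y) (D X Y))
     = avg2 K (\<lambda>X Y. (?F (c j + s j) (R X Y) (D X Y) + ?F (c j - s j) (R X Y) (D X Y)
         + ?F (- c j + s j) (R X Y) (D X Y) + ?F (- c j - s j) (R X Y) (D X Y)) / 4)" for c s
    using avg2_rot_average[OF K(2), of R D ?F c s] M(2)
    unfolding R_def D_def by (simp only: mlin_rot_flip not_False_eq_True)
  \<comment> \<open>The four values are symmetric about 0, so the sine terms cancel and
    \<open>R\<close> enters only through the bounded factor \<open>cos (pi * R)\<close>.\<close>
  have four_cos: "(?F (c + s) R D + ?F (c - s) R D + ?F (- c + s) R D + ?F (- c - s) R D) / 4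
      = cos (pi * R) * ((cos ((c + s) * (pi * D)) + cos ((c - s) * (pi * D))) / 2)"
    for c s R D :: real
  proof -
    have 1: "?F w R D + ?F (- w) R D = 2 * (cos (pi * R) * cos (w * (pi * D)))" for w
    proof -
      have "pi * (R + w * D) = pi * R + w * (pi * D)" "pi * (R + - w * D) = pi * R - w * (pi * D)"
        by (simp_all add: algebra_simps)
      then show ?thesis by (simp add: cos_add cos_diff)
    qed
    show ?thesis
      using 1[of "c + s"] 1[of "c - s"] by (simp add: algebra_simps)
  qed
  have ins: "mlin K a w = mlin M a w + w j * mlin M b w" for w
    using mlin_insert[OF M(3,2)] M(1) by (simp add: b_def)
  have E: "avg2 K (\<lambda>X Y. cos (pi * mlin K a (rot c s X Y)))
      = avg2 K (\<lambda>X Y. cos (pi * R X Y) * ((cos ((c j + s j) * (pi * D X Y)) + cos ((c j - s j) *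
          (pi * D X Y))) / 2))"
    using avg[of c s] by (simp only: ins four_cos R_def D_def)
  have E': "avg2 K (\<lambda>X Y. cos (pi * mlin K a (rot c' s' X Y)))
      = avg2 K (\<lambda>X Y. cos (pi * R X Y) * ((cos ((c' j + s' j) * (pi * D X Y)) + cos ((c' j - s' j)
          * (pi * D X Y))) / 2))"
    using avg[of c' s'] by (simp only: ins four_cos R' D')
  \<comment> \<open>\<open>D\<close> is the derivative in the variable \<open>j\<close>; its
    coefficients are those of the sets containing \<open>j\<close>, so its fourth moment is at most
    the square of the weighted influence.\<close>
  have D4: "avg2 K (\<lambda>X Y. D X Y ^ 4) \<le> B\<^sup>2"
  proof -
    have "(\<Sum>S\<in>Pow M. 3 ^ card S * (b S)\<^sup>2) \<le> (\<Sum>S\<in>Pow M. 3 ^ card (insert j S) * (b S)\<^sup>2)"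
    proof (intro sum_mono mult_right_mono power_increasing)
      fix S assume "S \<in> Pow M"
      then have "finite S" using M finite_subset by auto
      then show "card S \<le> card (insert j S)"
        by (simp add: card_insert_le)
    qed auto
    also have "\<dots> = (\<Sum>S\<in>insert j ` Pow M. 3 ^ card S * (a S)\<^sup>2)"
      by (subst sum.reindex) (use M in \<open>auto simp: b_def inj_on_def\<close>)
    also have "insert j ` Pow M = {S. S \<subseteq> K \<and> j \<in> S}"
    proof (intro equalityI subsetI)
      fix S assume "S \<in> {S. S \<subseteq> K \<and> j \<in> S}"
      then have "S = insert j (S - {j})" "S - {j} \<in> Pow M" by (auto simp: M_def)
      then show "S \<in> insert j ` Pow M" by blast
    qed (use M in auto)
    also note small
    finally have "(\<Sum>S\<in>Pow M. 3 ^ card S * (b S)\<^sup>2) \<le> B" .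
    moreover have "(\<Sum>S\<in>Pow M. 3 ^ card S * (b S)\<^sup>2) \<ge> 0"
      by (auto intro!: sum_nonneg)
    ultimately have "(\<Sum>S\<in>Pow M. 3 ^ card S * (b S)\<^sup>2)\<^sup>2 \<le> B\<^sup>2"
      by (rule power_mono)
    moreover have "avg2 K (\<lambda>X Y. D X Y ^ 4) \<le> (\<Sum>S\<in>Pow M. 3 ^ card S * (b S)\<^sup>2)\<^sup>2"
      unfolding D_def by (rule bonami) (use K(1) M(4) cs(1) in auto)
    ultimately show ?thesis by linarith
  qed
  have "\<bar>avg2 K (\<lambda>X Y. cos (pi * mlin K a (rot c' s' X Y))) - avg2 K (\<lambda>X Y. cos (pi * mlin K a
      (rot c s X Y)))\<bar>
    = \<bar>avg2 K (\<lambda>X Y. cos (pi * R X Y) * ((cos ((c' j + s' j) * (pi * D X Y)) + cos ((c' j - s' j)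
        * (pi * D X Y))) / 2
         - cos (pi * D X Y)))\<bar>"
    unfolding E E' avg2_diff[symmetric] j by (simp add: algebra_simps)
  also have "\<dots> \<le> avg2 K (\<lambda>X Y. 32 * D X Y ^ 4)"
  proof (rule order_trans[OF avg2_abs], rule avg2_mono)
    fix X Y
    let ?q = "(cos ((c' j + s' j) * (pi * D X Y)) + cos ((c' j - s' j) * (pi * D X Y))) / 2 - cos
        (pi * D X Y)"
    have "\<bar>cos (pi * R X Y) * ?q\<bar> \<le> 1 * \<bar>?q\<bar>"
      unfolding abs_mult by (intro mult_right_mono) auto
    also have "\<dots> \<le> (pi * D X Y) ^ 4 / 8"
      using cos_rot_quartic[OF cs(2)] by simp
    also have "\<dots> = pi ^ 4 / 8 * D X Y ^ 4"
      by (simp add: power_mult_distrib)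
    \<comment> \<open>32 is \<open>4 ^ 4 / 8\<close>, from \<open>pi < 4\<close>.\<close>
    also have "\<dots> \<le> 32 * D X Y ^ 4"
      using power_mono[of pi 4 4] pi_less_4 by (intro mult_right_mono) auto
    finally show "\<bar>cos (pi * R X Y) * ?q\<bar> \<le> 32 * D X Y ^ 4" .
  qed
  also have "\<dots> \<le> 32 * B\<^sup>2"
    using D4 by (simp add: avg2_cmult)
  finally show ?thesis .
qed

text \<open>A hybrid argument over the coordinates of \<open>I\<close>: every intermediate point
  mixes rotated and plain signs and is itself a rotation, so each replacement is an instance of
  \<open>lindeberg_step\<close>.\<close>

lemma lindeberg:
  fixes B :: real
  assumes K: "finite K" "I \<subseteq> K"
    and cs: "\<And>i. i \<in> I \<Longrightarrow> (c i)\<^sup>2 + (s i)\<^sup>2 = 1"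
    and small: "\<And>j. j \<in> I \<Longrightarrow> (\<Sum>S | S \<subseteq> K \<and> j \<in> S. 3 ^ card S * (a S)\<^sup>2) \<le> B"
  shows "\<bar>avg2 K (\<lambda>X Y. cos (pi * mlin K a (rot (\<lambda>i. if i \<in> I then c i else 1) (\<lambda>i. if i \<in> I then
      s i else 0) X Y)))
      - avg2 K (\<lambda>X Y. cos (pi * mlin K a (sg X)))\<bar> \<le> card I * (32 * B\<^sup>2)"
proof -
  have "finite I" using K finite_subset by blast
  then show ?thesis using K(2) cs small
  proof (induction I)
    case empty
    have "rot (\<lambda>i. 1) (\<lambda>i. 0) X Y = sg X" for X Y :: "'a set"
      by (simp add: rot_def fun_eq_iff)
    then show ?case by simp
  next
    case (insert j I)
    let ?c = "\<lambda>I i. if i \<in> I then c i else 1" and ?s = "\<lambda>I i. if i \<in> I then s i else 0"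
    have "\<bar>avg2 K (\<lambda>X Y. cos (pi * mlin K a (rot (?c (insert j I)) (?s (insert j I)) X Y)))
       - avg2 K (\<lambda>X Y. cos (pi * mlin K a (rot (?c I) (?s I) X Y)))\<bar> \<le> 32 * B\<^sup>2"
      by (rule lindeberg_step[where j=j]) (use K insert in auto)
    moreover have "\<bar>avg2 K (\<lambda>X Y. cos (pi * mlin K a (rot (?c I) (?s I) X Y)))
      - avg2 K (\<lambda>X Y. cos (pi * mlin K a (sg X)))\<bar> \<le> card I * (32 * B\<^sup>2)"
      by (rule insert.IH) (use insert in auto)
    ultimately show ?case
      using insert.hyps by (simp add: distrib_right)
  qed
qed

section \<open>Noise sensitivity of functions with small influences\<close>

lemma of_bool_chain:
  "(of_bool (P 0 \<noteq> P m) :: real) \<le> (\<Sum>j<m. of_bool (P j \<noteq> P (Suc j)))"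
proof (induction m)
  case (Suc m)
  have "(of_bool (P 0 \<noteq> P (Suc m)) :: real) \<le> of_bool (P 0 \<noteq> P m) + of_bool (P m \<noteq> P (Suc m))"
    by auto
  with Suc show ?case by simp
qed simp

lemma one_minus_cos_le: "1 - cos x \<le> x\<^sup>2 / 2" for x :: real
proof -
  have "1 - cos x = 2 * (sin (x / 2))\<^sup>2"
    using cos_double_sin[of "x / 2"] by simp
  also have "(sin (x / 2))\<^sup>2 \<le> (x / 2)\<^sup>2"
    using abs_sin_x_le_abs_x[of "x / 2"] unfolding abs_le_square_iff .
  finally show ?thesis by (simp add: power_divide)
qed

text \<open>Shifting by \<open>A\<close> turns the left side into
  \<open>1 - cos (pi * (A - u))\<close>, which is quadratically small; 8 bounds
  \<open>pi\<^sup>2 / 2\<close>.\<close>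

lemma one_plus_cos_pi_le:
  fixes A u :: real
  assumes "A = 1 \<or> A = -1"
  shows "1 + cos (pi * u) \<le> 8 * (A - u)\<^sup>2"
proof -
  have "cos (pi * (A - u)) = - cos (pi * u)"
    using assms by (auto simp: right_diff_distrib cos_diff cos_add)
  then have "1 + cos (pi * u) \<le> (pi * (A - u))\<^sup>2 / 2"
    using one_minus_cos_le[of "pi * (A - u)"] by simp
  also have "\<dots> = pi\<^sup>2 / 2 * (A - u)\<^sup>2"
    by (simp add: power_mult_distrib)
  also have "\<dots> \<le> 8 * (A - u)\<^sup>2"
    using power_mono[of pi 4 2] pi_less_4 by (intro mult_right_mono) auto
  finally show ?thesis .
qed

text \<open>For \<bar>u\<bar> \<le> 1/2 the cosine is nonnegative and the test function alone is at
  least 1; otherwise a sign change forces \<open>u\<close> and \<open>v\<close> to be at least 1/2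
  apart.\<close>

lemma sign_change_le:
  fixes u v :: real
  shows "of_bool ((u > 0) \<noteq> (v > 0)) \<le> 4 * (u - v)\<^sup>2 + (1 + cos (pi * u))"
proof (cases "(u > 0) \<noteq> (v > 0)")
  case True
  show ?thesis
  proof (cases "\<bar>u\<bar> \<le> 1 / 2")
    case True
    then have "\<bar>pi * u\<bar> \<le> pi / 2"
      using mult_left_mono[of "\<bar>u\<bar>" "1 / 2" pi] by (simp add: abs_mult)
    then have "cos (pi * u) \<ge> 0"
      by (intro cos_ge_zero) linarith+
    then show ?thesis by (simp add: of_bool_def)
  next
    case False
    then have "\<bar>u - v\<bar> \<ge> 1 / 2" using True by auto
    then have "(u - v)\<^sup>2 \<ge> (1 / 2)\<^sup>2"
      by (metis abs_le_square_iff abs_of_nonneg zero_le_divide_1_iff zero_le_numeral)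
    then have "1 \<le> 4 * (u - v)\<^sup>2" by (simp add: power_divide)
    moreover have "of_bool ((u > 0) \<noteq> (v > 0)) \<le> (1 :: real)" by simp
    ultimately show ?thesis
      using cos_ge_minus_one[of "pi * u"] by linarith
  qed
next
  case False
  then show ?thesis
    using cos_ge_minus_one[of "pi * u"] zero_le_power2[of "u - v"] by (simp only: of_bool_eq)
qed

lemma sign_error_le:
  fixes A u :: real
  assumes "A = 1 \<or> A = -1"
  shows "of_bool ((A > 0) \<noteq> (u > 0)) \<le> (A - u)\<^sup>2"
proof (cases "(A > 0) \<noteq> (u > 0)")
  case True
  then have "\<bar>A - u\<bar> \<ge> 1" using assms by auto
  then have "(A - u)\<^sup>2 \<ge> 1\<^sup>2"
    by (metis abs_le_square_iff abs_one)
  then show ?thesis by simp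
qed simp

text \<open>Rotating \<open>X\<close> into the independent \<open>Y\<close> on the coordinates in \<open>I\<close> takes \<open>m\<close> steps, each of which
  changes the sign of the low-degree part of \<open>A\<close> no more often than noise does, up to the
  invariance error: by the invariance principle that part is close to \<open>\<plusminus>1\<close> along the
  whole path.\<close>

lemma noise_sensitivity_lower_bound:
  fixes A :: "'i set \<Rightarrow> real" and \<rho> \<tau> \<eta> :: real
  assumes K: "finite K" "K = J \<union> I" "J \<inter> I = {}"
    and A: "\<And>X. X \<subseteq> K \<Longrightarrow> A X = 1 \<or> A X = -1"
    and corr: "avg2 K (\<lambda>X Y. A X * A (X \<inter> J \<union> Y \<inter> I)) \<le> 5 / 6"
    and infl: "\<And>j. j \<in> I \<Longrightarrow> (\<Sum>S | S \<subseteq> K \<and> j \<in> S \<and> card S \<le> k. (four K A S)\<^sup>2) \<le> \<tau>"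
    and \<rho>: "0 \<le> \<rho>" "\<rho> \<le> cos (pi / (2 * real m))" "\<rho> ^ k \<le> 1 / 2" and m: "m \<ge> 1"
    and \<eta>: "(\<Sum>S\<in>Pow K. (1 - \<rho> ^ card S) * (four K A S)\<^sup>2) \<le> 2 * \<eta>"
  shows "1 / 12 \<le> 8 * \<eta> + real m * (48 * \<eta> + real (card I) * (32 * (3 ^ k * \<tau>)\<^sup>2))"
proof -
  define a where "a = four K A"
  define low where "low = (\<lambda>S. if card S \<le> k then a S else 0)"
  define high where "high = (\<lambda>S. if card S \<le> k then 0 else a S)"
  \<comment> \<open>\<open>m\<close> steps of this angle add up to a quarter turn, which carries
    \<open>X\<close> to \<open>Y\<close> on \<open>I\<close>.\<close>
  define \<theta> where "\<theta> = pi / (2 * real m)"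
  define c where "c = (\<lambda>j i. if i \<in> I then cos (real j * \<theta>) else 1)"
  define s where "s = (\<lambda>j i. if i \<in> I then sin (real j * \<theta>) else 0)"
  define G where "G = (\<lambda>j X Y. mlin K low (rot (c j) (s j) X Y))"
  define Z where "Z = (\<lambda>X Y. X \<inter> J \<union> Y \<inter> I)"
  define err where "err = real (card I) * (32 * (3 ^ k * \<tau>)\<^sup>2)"
  have \<rho>1: "\<rho> \<le> 1" using \<rho>(2) cos_le_one order_trans by blast
  have cs: "(c j i)\<^sup>2 + (s j i)\<^sup>2 = 1" for j i
    by (simp add: c_def s_def)
  have split: "mlin K a w = mlin K low w + mlin K high w" for w
    unfolding mlin_def sum.distrib[symmetric]
    by (intro sum.cong refl) (auto simp: low_def high_def)
  \<comment> \<open>Above degree \<open>k\<close> the factor \<open>1 - \<rho> ^ card S\<close> is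
    at least 1/2, so the discarded mass is at most twice the noise energy 2\<eta>.\<close>
  have high: "(\<Sum>S\<in>Pow K. (high S)\<^sup>2) \<le> 4 * \<eta>"
  proof -
    have "(\<Sum>S\<in>Pow K. (high S)\<^sup>2) \<le> (\<Sum>S\<in>Pow K. 2 * ((1 - \<rho> ^ card S) * (a S)\<^sup>2))"
    proof (rule sum_mono)
      fix S
      show "(high S)\<^sup>2 \<le> 2 * ((1 - \<rho> ^ card S) * (a S)\<^sup>2)"
      proof (cases "card S \<le> k")
        case True
        then show ?thesis
          using \<rho> \<rho>1 by (simp add: high_def power_le_one)
      next
        case False
        then have "\<rho> ^ card S \<le> \<rho> ^ k"
          using \<rho> \<rho>1 by (intro power_decreasing) auto
        then have "\<rho> ^ card S \<le> 1 / 2" using \<rho>(3) by (rule order_trans)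
        then have "1 \<le> 2 * (1 - \<rho> ^ card S)" by simp
        then have "1 * (a S)\<^sup>2 \<le> 2 * (1 - \<rho> ^ card S) * (a S)\<^sup>2"
          by (rule mult_right_mono) simp
        then show ?thesis using False by (simp only: high_def mult.assoc if_False mult_1)
      qed
    qed
    also have "\<dots> \<le> 4 * \<eta>"
      using \<eta> by (simp add: a_def sum_distrib_left[symmetric])
    finally show ?thesis .
  qed
  have high2: "avg2 K (\<lambda>X Y. (mlin K high (rot (c j) (s j) X Y))\<^sup>2) \<le> 4 * \<eta>" for j
    using high avg2_mlin_mlin[OF K(1), of high "c j" "s j" high "c j" "s j"] cs
    by (simp add: power2_eq_square)
  have rot0: "rot (c 0) (s 0) X Y = sg X" for X Y
    by (simp add: rot_def fun_eq_iff c_def s_def)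
  have m\<theta>: "real m * \<theta> = pi / 2" using m by (simp add: \<theta>_def)
  have rotm: "mlin K b (rot (c m) (s m) X Y) = mlin K b (sg (Z X Y))" for b X Y
    by (rule mlin_cong) (use K in \<open>auto simp: rot_def c_def s_def m\<theta> sg_def Z_def\<close>)
  have A0: "A X = G 0 X Y + mlin K high (rot (c 0) (s 0) X Y)" if "X \<subseteq> K" for X Y
    using fourier_inversion[OF K(1) that, of A] split[of "sg X"] by (simp add: G_def rot0 a_def)
  have ZK: "Z X Y \<subseteq> K" for X Y using K by (auto simp: Z_def)
  have Am: "A (Z X Y) = G m X Y + mlin K high (rot (c m) (s m) X Y)" for X Y
    using fourier_inversion[OF K(1) ZK, of A] split[of "sg (Z X Y)"] by (simp add: G_def rotm a_def)
  have E0: "avg2 K (\<lambda>X Y. (A X - G 0 X Y)\<^sup>2) \<le> 4 * \<eta>"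
  proof -
    have "avg2 K (\<lambda>X Y. (A X - G 0 X Y)\<^sup>2) = avg2 K (\<lambda>X Y. (mlin K high (rot (c 0) (s 0) X Y))\<^sup>2)"
    proof (rule avg2_cong)
      fix X Y assume "X \<subseteq> K"
      then show "(A X - G 0 X Y)\<^sup>2 = (mlin K high (rot (c 0) (s 0) X Y))\<^sup>2"
        using A0[of X Y] by simp
    qed
    then show ?thesis using high2[of 0] by simp
  qed
  have Em: "avg2 K (\<lambda>X Y. (A (Z X Y) - G m X Y)\<^sup>2) \<le> 4 * \<eta>"
    using high2[of m] by (simp add: Am)
  have step: "avg2 K (\<lambda>X Y. (G j X Y - G (Suc j) X Y)\<^sup>2) \<le> 4 * \<eta>" for j
  proof -
    have inner: "c j i * c (Suc j) i + s j i * s (Suc j) i = (if i \<in> I then cos \<theta> else 1)" for i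
    proof -
      have "cos (real j * \<theta>) * cos (real (Suc j) * \<theta>) + sin (real j * \<theta>) * sin (real (Suc j) * \<theta>)
        = cos (real (Suc j) * \<theta> - real j * \<theta>)"
        by (simp add: cos_diff)
      also have "real (Suc j) * \<theta> - real j * \<theta> = \<theta>"
        by (simp add: algebra_simps)
      finally show ?thesis by (simp add: c_def s_def)
    qed
    \<comment> \<open>Noise damps every coordinate of \<open>S\<close> by \<rho>; a step damps only
      those in \<open>I\<close>, and by no more, since \<rho> \<le> cos \<theta>. Hence the mean
      square change in a step is bounded by the noise energy.\<close>
    have pw: "\<rho> ^ card S \<le> (\<Prod>i\<in>S. if i \<in> I then cos \<theta> else 1)" for S :: "'i set"
      unfolding prod_constant[symmetric]
      by (rule prod_mono) (use \<rho> \<rho>1 in \<open>auto simp: \<theta>_def\<close>)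
    have "avg2 K (\<lambda>X Y. (G j X Y - G (Suc j) X Y)\<^sup>2)
      = avg2 K (\<lambda>X Y. G j X Y * G j X Y - 2 * (G j X Y * G (Suc j) X Y) + G (Suc j) X Y * G (Suc
          j) X Y)"
      by (rule avg2_cong) algebra
    also have "\<dots> = avg2 K (\<lambda>X Y. G j X Y * G j X Y) - 2 * avg2 K (\<lambda>X Y. G j X Y * G (Suc j) X Y)
        + avg2 K (\<lambda>X Y. G (Suc j) X Y * G (Suc j) X Y)"
      by (simp only: avg2_add avg2_diff avg2_cmult)
    also have "\<dots> = (\<Sum>S\<in>Pow K. low S * low S) - 2 * (\<Sum>S\<in>Pow K. low S * low S * (\<Prod>i\<in>S. if i \<in> I then
        cos \<theta> else 1))
        + (\<Sum>S\<in>Pow K. low S * low S)"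
    proof -
      have one: "c j i * c j i + s j i * s j i = 1" for j i
        using cs[of j i] by (simp add: power2_eq_square)
      show ?thesis
        unfolding G_def avg2_mlin_mlin[OF K(1)] inner one by simp
    qed
    also have "\<dots> = (\<Sum>S\<in>Pow K. 2 * (1 - (\<Prod>i\<in>S. if i \<in> I then cos \<theta> else 1)) * (low S)\<^sup>2)"
      unfolding sum_distrib_left sum_subtractf[symmetric] sum.distrib[symmetric]
      by (simp add: power2_eq_square algebra_simps)
    also have "\<dots> \<le> (\<Sum>S\<in>Pow K. 2 * ((1 - \<rho> ^ card S) * (a S)\<^sup>2))"
    proof (rule sum_mono)
      fix S
      have "2 * (1 - (\<Prod>i\<in>S. if i \<in> I then cos \<theta> else 1)) * (low S)\<^sup>2 \<le> 2 * (1 - \<rho> ^ card S) * (low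
          S)\<^sup>2"
        using pw[of S] by (intro mult_right_mono) auto
      also have "\<dots> \<le> 2 * (1 - \<rho> ^ card S) * (a S)\<^sup>2"
        using \<rho> \<rho>1 by (intro mult_left_mono) (auto simp: low_def power_le_one)
      finally show "2 * (1 - (\<Prod>i\<in>S. if i \<in> I then cos \<theta> else 1)) * (low S)\<^sup>2
          \<le> 2 * ((1 - \<rho> ^ card S) * (a S)\<^sup>2)" by (simp only: mult.assoc)
    qed
    also have "\<dots> \<le> 4 * \<eta>"
      using \<eta> by (simp add: a_def sum_distrib_left[symmetric])
    finally show ?thesis .
  qed
  have small: "(\<Sum>S | S \<subseteq> K \<and> j \<in> S. 3 ^ card S * (low S)\<^sup>2) \<le> 3 ^ k * \<tau>" if "j \<in> I" for j
  proof -
    have "(\<Sum>S | S \<subseteq> K \<and> j \<in> S. 3 ^ card S * (low S)\<^sup>2)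
      = (\<Sum>S | S \<subseteq> K \<and> j \<in> S \<and> card S \<le> k. 3 ^ card S * (a S)\<^sup>2)"
      by (rule sum.mono_neutral_cong_right) (use K(1) in \<open>auto simp: low_def\<close>)
    also have "\<dots> \<le> (\<Sum>S | S \<subseteq> K \<and> j \<in> S \<and> card S \<le> k. 3 ^ k * (a S)\<^sup>2)"
      by (intro sum_mono mult_right_mono power_increasing) auto
    also have "\<dots> = 3 ^ k * (\<Sum>S | S \<subseteq> K \<and> j \<in> S \<and> card S \<le> k. (a S)\<^sup>2)"
      by (simp add: sum_distrib_left)
    also have "\<dots> \<le> 3 ^ k * \<tau>"
      using infl[OF that] by (intro mult_left_mono) (auto simp: a_def)
    finally show ?thesis .
  qed
  \<comment> \<open>Every point of the path is compared directly with its start, where the low part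
    is close to \<open>A\<close>; so the bound does not deteriorate with \<open>j\<close>.\<close>
  have psi: "avg2 K (\<lambda>X Y. 1 + cos (pi * G j X Y)) \<le> 32 * \<eta> + err" for j
  proof -
    have "\<bar>avg2 K (\<lambda>X Y. cos (pi * G j X Y)) - avg2 K (\<lambda>X Y. cos (pi * G 0 X Y))\<bar> \<le> err"
    proof -
      have G0: "G 0 X Y = mlin K low (sg X)" for X Y
        by (simp add: G_def rot0)
      show ?thesis
        unfolding G0 unfolding G_def err_def c_def s_def
        by (rule lindeberg) (use K small in auto)
    qed
    moreover have "avg2 K (\<lambda>X Y. 1 + cos (pi * G 0 X Y)) \<le> avg2 K (\<lambda>X Y. 8 * (A X - G 0 X Y)\<^sup>2)"
      by (rule avg2_mono, rule one_plus_cos_pi_le, rule A)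
    ultimately show ?thesis
      using E0 unfolding avg2_add avg2_cmult by linarith
  qed
  \<comment> \<open>For values 1 and -1, correlation at most 5/6 means a change with probability at
    least (1 - 5/6)/2 = 1/12.\<close>
  have "1 / 12 \<le> (1 - avg2 K (\<lambda>X Y. A X * A (Z X Y))) / 2"
    using corr by (simp add: Z_def)
  also have "\<dots> = avg2 K (\<lambda>X Y. (1/2) * (1 - A X * A (Z X Y)))"
    unfolding avg2_cmult avg2_diff by (simp add: avg2_const[OF K(1)])
  also have "\<dots> \<le> avg2 K (\<lambda>X Y. (A X - G 0 X Y)\<^sup>2 + (A (Z X Y) - G m X Y)\<^sup>2
      + (\<Sum>j<m. 4 * (G j X Y - G (Suc j) X Y)\<^sup>2 + (1 + cos (pi * G j X Y))))"
  proof (rule avg2_mono)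
    fix X Y assume X: "X \<subseteq> K"
    let ?P = "\<lambda>j. G j X Y > 0"
    have "(1/2) * (1 - A X * A (Z X Y)) = of_bool ((A X > 0) \<noteq> (A (Z X Y) > 0))"
      using A[OF X] A[OF ZK, of X Y] by auto
    also have "\<dots> \<le> of_bool ((A X > 0) \<noteq> ?P 0) + of_bool ((A (Z X Y) > 0) \<noteq> ?P m) + of_bool (?P 0 \<noteq>
        ?P m)"
      by auto
    also have "\<dots> \<le> (A X - G 0 X Y)\<^sup>2 + (A (Z X Y) - G m X Y)\<^sup>2
      + (\<Sum>j<m. 4 * (G j X Y - G (Suc j) X Y)\<^sup>2 + (1 + cos (pi * G j X Y)))"
    proof (intro add_mono sign_error_le A X ZK)
      have "(of_bool (?P 0 \<noteq> ?P m) :: real) \<le> (\<Sum>j<m. of_bool (?P j \<noteq> ?P (Suc j)))"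
        by (rule of_bool_chain)
      also have "\<dots> \<le> (\<Sum>j<m. 4 * (G j X Y - G (Suc j) X Y)\<^sup>2 + (1 + cos (pi * G j X Y)))"
        by (intro sum_mono sign_change_le)
      finally show "(of_bool (?P 0 \<noteq> ?P m) :: real) \<le> \<dots>" .
    qed
    finally show "(1/2) * (1 - A X * A (Z X Y)) \<le> (A X - G 0 X Y)\<^sup>2 + (A (Z X Y) - G m X Y)\<^sup>2
      + (\<Sum>j<m. 4 * (G j X Y - G (Suc j) X Y)\<^sup>2 + (1 + cos (pi * G j X Y)))" .
  qed
  also have "\<dots> = avg2 K (\<lambda>X Y. (A X - G 0 X Y)\<^sup>2) + avg2 K (\<lambda>X Y. (A (Z X Y) - G m X Y)\<^sup>2)
      + (\<Sum>j<m. 4 * avg2 K (\<lambda>X Y. (G j X Y - G (Suc j) X Y)\<^sup>2) + avg2 K (\<lambda>X Y. 1 + cos (pi * G j X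
          Y)))"
    by (simp only: avg2_add avg2_sum avg2_cmult)
  \<comment> \<open>4\<eta> at each end, where the low part replaces \<open>A\<close>; in each step
    16\<eta> for the displacement and 32\<eta> + \<open>err\<close> for values away from 1 and
    -1.\<close>
  also have "\<dots> \<le> 4 * \<eta> + 4 * \<eta> + (\<Sum>j<m. 4 * (4 * \<eta>) + (32 * \<eta> + err))"
    by (intro add_mono E0 Em sum_mono psi mult_left_mono step) auto
  also have "\<dots> = 8 * \<eta> + real m * (48 * \<eta> + err)"
    by simp
  finally show ?thesis by (simp add: err_def)
qed

section \<open>The squared distances and their triangle inequality\<close>

lemma chi_eq_card: "finite S \<Longrightarrow> chi S X = (-1) ^ card (S \<inter> X)"
proof (induction S rule: finite_induct)
  case (insert i S)
  then have "card (insert i S \<inter> X) = (if i \<in> X then Suc (card (S \<inter> X)) else card (S \<inter> X))"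
    by (auto simp: Int_insert_left)
  with insert show ?case by (simp add: chi_def sg_def)
qed (simp add: chi_def)

lemma chi_commute: "finite S \<Longrightarrow> finite X \<Longrightarrow> chi S X = chi X S"
  by (simp add: chi_eq_card Int_commute)

lemma abs_chi [simp]: "\<bar>chi S X\<bar> = 1"
  by (simp add: chi_def abs_prod)

lemma chi_square [simp]: "chi S X * chi S X = 1"
  by (simp add: chi_def flip: prod.distrib)

lemma chi_sym_diff:
  assumes "finite S" "finite T"
  shows "chi (sym_diff S T) X = chi S X * chi T X"
proof -
  have 1: "chi S X = chi (S - T) X * chi (S \<inter> T) X" "chi T X = chi (T - S) X * chi (S \<inter> T) X"
    unfolding chi_def using assms
    by (simp_all add: prod.Int_Diff[of S _ T] prod.Int_Diff[of T _ S] Int_commute mult.commute)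
  have "chi (sym_diff S T) X = chi (S - T) X * chi (T - S) X"
    unfolding chi_def by (rule prod.union_disjoint) (use assms in auto)
  moreover have "chi S X * chi T X = chi (S - T) X * chi (T - S) X * (chi (S \<inter> T) X * chi (S \<inter> T)
      X)"
    unfolding 1 by (simp only: ac_simps)
  ultimately show ?thesis by simp
qed

lemma sum_Pow_sym_diff:
  assumes "S \<subseteq> L"
  shows "(\<Sum>T\<in>Pow L. \<phi> (sym_diff S T)) = (\<Sum>T\<in>Pow L. \<phi> T)"
  by (rule sum.reindex_bij_witness[where i="sym_diff S" and j="sym_diff S"])
     (use assms in \<open>auto intro: arg_cong[where f=\<phi>]\<close>)

text \<open>The Gram kernel of the orbit vectors: the normalised inner product of
  \<open>f * chi S\<close> and \<open>g * chi T\<close> is the Fourier coefficient of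
  \<open>f * g\<close> at \<open>sym_diff S T\<close>, and the tensor power raises it to the
  eighth.\<close>

definition kern :: "'i set \<Rightarrow> ('i set \<Rightarrow> real) \<Rightarrow> ('i set \<Rightarrow> real) \<Rightarrow> ('i set \<Rightarrow> real) \<Rightarrow> ('i set \<Rightarrow> real)
    \<Rightarrow> real" where
  "kern L f x g y = (\<Sum>S\<in>Pow L. \<Sum>T\<in>Pow L. x S * y T * four L (\<lambda>t. f t * g t) (sym_diff S T) ^ 8) /
      2 ^ card L"

lemma kern_commute: "kern L f x g y = kern L g y f x"
proof -
  have "(\<lambda>t. f t * g t) = (\<lambda>t. g t * f t)" by (simp add: mult.commute)
  then show ?thesis
    unfolding kern_def by (subst sum.swap) (simp add: ac_simps Un_commute)
qed

lemma four_parseval_unit: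
  assumes "finite L" "\<And>t. \<bar>f t\<bar> = 1" "\<And>t. \<bar>g t\<bar> = 1"
  shows "(\<Sum>S\<in>Pow L. (four L (\<lambda>t. f t * g t) S)\<^sup>2) = 1"
proof -
  have "f t * f t = 1" "g t * g t = 1" for t
    using assms by (metis abs_mult_self_eq mult_1)+
  then have "f t * g t * (f t * g t) = 1" for t
    by (simp add: algebra_simps)
  then show ?thesis
    using parseval[OF assms(1), of "\<lambda>t. f t * g t" "\<lambda>t. f t * g t"] assms(1)
    by (simp add: avg2_const power2_eq_square)
qed

text \<open>The quotient by \<open>p - q\<close> has eight monomials of degree 7, and each symmetric
  pair is at most \<open>p ^ 7 + q ^ 7\<close>. The constant 4 makes the first-order terms at m = 1
  cancel in the triangle inequality below; a larger one would leave a negative bound near 1.\<close>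

lemma power8_diff_le:
  fixes p q :: real
  assumes "p \<ge> 0" "q \<ge> 0"
  shows "\<bar>p ^ 8 - q ^ 8\<bar> \<le> 4 * \<bar>p - q\<bar> * (p ^ 7 + q ^ 7)"
proof -
  have *: "p ^ i * q ^ j + p ^ j * q ^ i \<le> p ^ (i + j) + q ^ (i + j)" for i j
  proof -
    have "(p ^ i - q ^ i) * (p ^ j - q ^ j) \<ge> 0"
      using assms power_mono[of p q] power_mono[of q p]
      by (cases "p \<le> q") (simp_all add: mult_nonpos_nonpos)
    then show ?thesis by (simp add: algebra_simps power_add)
  qed
  have "p ^ 8 - q ^ 8 = (p - q) * ((p ^ 7 + q ^ 7) + (p ^ 6 * q ^ 1 + p ^ 1 * q ^ 6)
      + (p ^ 5 * q ^ 2 + p ^ 2 * q ^ 5) + (p ^ 4 * q ^ 3 + p ^ 3 * q ^ 4))"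
    by algebra
  then have "\<bar>p ^ 8 - q ^ 8\<bar> = \<bar>p - q\<bar> * \<bar>(p ^ 7 + q ^ 7) + (p ^ 6 * q ^ 1 + p ^ 1 * q ^ 6)
      + (p ^ 5 * q ^ 2 + p ^ 2 * q ^ 5) + (p ^ 4 * q ^ 3 + p ^ 3 * q ^ 4)\<bar>"
    by (simp only: abs_mult)
  also have "\<dots> = \<bar>p - q\<bar> * ((p ^ 7 + q ^ 7) + (p ^ 6 * q ^ 1 + p ^ 1 * q ^ 6)
      + (p ^ 5 * q ^ 2 + p ^ 2 * q ^ 5) + (p ^ 4 * q ^ 3 + p ^ 3 * q ^ 4))"
    by (subst abs_of_nonneg) (use assms in auto)
  also have "\<dots> \<le> \<bar>p - q\<bar> * (4 * (p ^ 7 + q ^ 7))"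
    using *[of 6 1] *[of 5 2] *[of 4 3] by (intro mult_left_mono) auto
  finally show ?thesis
    by (simp only: mult.assoc mult.left_commute[of "\<bar>p - q\<bar>" 4])
qed

lemma sum_abs_power_le:
  fixes a :: "'s \<Rightarrow> real"
  assumes "\<And>s. s \<in> A \<Longrightarrow> \<bar>a s\<bar> \<le> m" "(\<Sum>s\<in>A. (a s)\<^sup>2) \<le> c" "m \<ge> 0"
  shows "(\<Sum>s\<in>A. \<bar>a s\<bar> ^ (k + 2)) \<le> m ^ k * c"
proof -
  have "(\<Sum>s\<in>A. \<bar>a s\<bar> ^ (k + 2)) \<le> (\<Sum>s\<in>A. m ^ k * (a s)\<^sup>2)"
  proof (rule sum_mono)
    fix s assume "s \<in> A"
    have "\<bar>a s\<bar> ^ (k + 2) = \<bar>a s\<bar> ^ k * (a s)\<^sup>2"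
      by (simp only: power_add power2_abs)
    also have "\<dots> \<le> m ^ k * (a s)\<^sup>2"
      using assms(1)[OF \<open>s \<in> A\<close>] by (intro mult_right_mono power_mono) auto
    finally show "\<bar>a s\<bar> ^ (k + 2) \<le> m ^ k * (a s)\<^sup>2" .
  qed
  also have "\<dots> \<le> m ^ k * c"
    using assms(2,3) by (simp add: sum_distrib_left[symmetric] mult_left_mono)
  finally show ?thesis .
qed

lemma sum_power4_le:
  fixes a :: "'s \<Rightarrow> real"
  assumes "finite A" "\<And>s. s \<in> A \<Longrightarrow> 0 \<le> a s"
  shows "(\<Sum>s\<in>A. a s ^ 4) \<le> (\<Sum>s\<in>A. a s) ^ 4"
  using assms
proof (induction A rule: finite_induct)
  case (insert s A)
  have "a s ^ 4 + r ^ 4 \<le> (a s + r) ^ 4" if "r \<ge> 0" for r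
  proof -
    have "(a s + r) ^ 4 = a s ^ 4 + r ^ 4 + (4 * a s ^ 3 * r + 6 * (a s)\<^sup>2 * r\<^sup>2 + 4 * a s * r ^ 3)"
      by algebra
    then show ?thesis using that insert.prems by simp
  qed
  from this[of "sum a A"] insert show ?case by (simp add: sum_nonneg)
qed simp

text \<open>The largest Fourier coefficient \<open>m\<close> in absolute value, attained at \<open>U\<close>, matches \<open>x\<close> with the
  translate of \<open>y\<close> by \<open>U\<close>; the claim already holds for each position \<open>S\<close> separately.\<close>

lemma kern_triangle_aux:
  fixes f g h x y z :: "'i set \<Rightarrow> real"
  assumes L: "finite L" and U: "U \<subseteq> L"
    and unit: "\<And>t. \<bar>f t\<bar> = 1" "\<And>t. \<bar>g t\<bar> = 1" "\<And>t. \<bar>h t\<bar> = 1"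
       "\<And>t. \<bar>x t\<bar> = 1" "\<And>t. \<bar>y t\<bar> = 1" "\<And>t. \<bar>z t\<bar> = 1"
    and max: "\<And>V. V \<subseteq> L \<Longrightarrow> \<bar>four L (\<lambda>t. f t * g t) V\<bar> \<le> \<bar>four L (\<lambda>t. f t * g t) U\<bar>"
       "\<And>V. V \<subseteq> L \<Longrightarrow> \<bar>four L (\<lambda>t. g t * h t) V\<bar> \<le> \<bar>four L (\<lambda>t. f t * g t) U\<bar>"
       "\<And>V. V \<subseteq> L \<Longrightarrow> \<bar>four L (\<lambda>t. f t * h t) V\<bar> \<le> \<bar>four L (\<lambda>t. f t * g t) U\<bar>"
  shows "0 \<le> 1 + kern L f x g y + kern L g y h z + kern L f x h z"
proof -
  define \<alpha> where "\<alpha> = four L (\<lambda>t. f t * g t)"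
  define \<beta> where "\<beta> = four L (\<lambda>t. g t * h t)"
  define \<gamma> where "\<gamma> = four L (\<lambda>t. f t * h t)"
  define m where "m = \<bar>\<alpha> U\<bar>"
  define \<sigma> :: real where "\<sigma> = (if \<alpha> U \<ge> 0 then 1 else -1)"
  have \<sigma>: "\<bar>\<sigma>\<bar> = 1" "\<sigma> * \<alpha> U = m" by (auto simp: \<sigma>_def m_def)
  have m0: "m \<ge> 0" by (simp add: m_def)
  have fin: "finite (Pow L)" using L by simp
  have sq: "(\<Sum>V\<in>Pow L. (\<alpha> V)\<^sup>2) = 1" "(\<Sum>V\<in>Pow L. (\<beta> V)\<^sup>2) = 1" "(\<Sum>V\<in>Pow L. (\<gamma> V)\<^sup>2) = 1"
    unfolding \<alpha>_def \<beta>_def \<gamma>_def by (rule four_parseval_unit; use L unit in simp)+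
  have mle: "\<bar>\<alpha> V\<bar> \<le> m" "\<bar>\<beta> V\<bar> \<le> m" "\<bar>\<gamma> V\<bar> \<le> m" if "V \<in> Pow L" for V
    using max that by (auto simp: \<alpha>_def \<beta>_def \<gamma>_def m_def)
  have sqU: "(\<Sum>V\<in>Pow L - {U}. (\<alpha> V)\<^sup>2) = 1 - m\<^sup>2"
    using sq(1) sum.remove[OF fin, of U "\<lambda>V. (\<alpha> V)\<^sup>2"] U by (simp add: m_def)
  then have "m\<^sup>2 \<le> 1" using sum_nonneg[of "Pow L - {U}" "\<lambda>V. (\<alpha> V)\<^sup>2"] by simp
  then have m1: "m \<le> 1" using m0 by (simp add: power2_le_iff_abs_le abs_square_le_1)
  \<comment> \<open>All coefficients off \<open>U\<close> share the mass
    \<open>1 - m\<^sup>2\<close>; this bounds what can oppose the main term.\<close>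
  have \<alpha>8: "(\<Sum>V\<in>Pow L - {U}. \<alpha> V ^ 8) \<le> (1 - m\<^sup>2) ^ 4"
    using sum_power4_le[of "Pow L - {U}" "\<lambda>V. (\<alpha> V)\<^sup>2"] fin sqU by simp
  have \<beta>8: "(\<Sum>V\<in>Pow L. \<beta> V ^ 8) \<le> m ^ 6" and \<gamma>8: "(\<Sum>V\<in>Pow L. \<gamma> V ^ 8) \<le> m ^ 6"
    using sum_abs_power_le[of "Pow L" \<beta> m 1 6] sum_abs_power_le[of "Pow L" \<gamma> m 1 6] mle sq m0 by
        auto
  have \<beta>7: "(\<Sum>V\<in>Pow L. \<bar>\<beta> V\<bar> ^ 7) \<le> m ^ 5" and \<gamma>7: "(\<Sum>V\<in>Pow L. \<bar>\<gamma> V\<bar> ^ 7) \<le> m ^ 5"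
    using sum_abs_power_le[of "Pow L" \<beta> m 1 5] sum_abs_power_le[of "Pow L" \<gamma> m 1 5] mle sq m0 by
        auto
  have shift: "(\<Sum>V\<in>Pow L. \<phi> (sym_diff U V)) = (\<Sum>V\<in>Pow L. \<phi> V)" for \<phi> :: "'i set \<Rightarrow> real"
    by (rule sum_Pow_sym_diff[OF U])
  \<comment> \<open>\<open>f\<close> and \<open>\<sigma> * g * chi U\<close> differ on a set of
    density (1 - m)/2. As \<gamma> and, up to sign, the shifted \<beta> are coefficients of these
    two functions times \<open>h\<close>, they differ by at most 1 - m.\<close>
  have close: "\<bar>\<bar>\<beta> (sym_diff U V)\<bar> - \<bar>\<gamma> V\<bar>\<bar> \<le> 1 - m" if V: "V \<in> Pow L" for V
  proof -
    have finUV: "finite U" "finite V" using U V L finite_subset by auto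
    have gg: "g t * g t = 1" for t
      using unit(2) by (metis abs_mult_self_eq mult_1)
    have "\<gamma> V - \<sigma> * \<beta> (sym_diff U V)
      = (\<Sum>t\<in>Pow L. f t * h t * chi V t - \<sigma> * (g t * h t * (chi U t * chi V t))) / 2 ^ card L"
      unfolding \<gamma>_def \<beta>_def four_def chi_sym_diff[OF finUV]
      by (simp add: sum_subtractf sum_distrib_left diff_divide_distrib)
    then have "\<bar>\<gamma> V - \<sigma> * \<beta> (sym_diff U V)\<bar>
      \<le> (\<Sum>t\<in>Pow L. \<bar>f t * h t * chi V t - \<sigma> * (g t * h t * (chi U t * chi V t))\<bar>) / 2 ^ card L"
      by (simp add: divide_right_mono)
    also have "\<dots> = (\<Sum>t\<in>Pow L. 1 - \<sigma> * (f t * g t * chi U t)) / 2 ^ card L"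
    proof (intro arg_cong2[where f="(/)"] sum.cong refl)
      fix t
      have pm: "r = 1 \<or> r = -1" if "\<bar>r\<bar> = 1" for r :: real
        using that by linarith
      show "\<bar>f t * h t * chi V t - \<sigma> * (g t * h t * (chi U t * chi V t))\<bar> = 1 - \<sigma> * (f t * g t *
          chi U t)"
        using pm[OF unit(1), of t] pm[OF unit(2), of t] pm[OF unit(3), of t] pm[OF \<sigma>(1)]
          pm[OF abs_chi, of U t] pm[OF abs_chi, of V t]
        by (elim disjE) simp_all
    qed
    also have "\<dots> = 1 - \<sigma> * \<alpha> U"
      using L by (simp add: \<alpha>_def four_def sum_subtractf sum_distrib_left diff_divide_distrib
          card_Pow)
    finally have "\<bar>\<gamma> V - \<sigma> * \<beta> (sym_diff U V)\<bar> \<le> 1 - m"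
      using \<sigma> by simp
    moreover have "\<bar>\<sigma> * \<beta> (sym_diff U V)\<bar> = \<bar>\<beta> (sym_diff U V)\<bar>"
      using \<sigma> by (simp add: abs_mult)
    ultimately show ?thesis by linarith
  qed
  have diff: "(\<Sum>V\<in>Pow L. \<bar>\<beta> (sym_diff U V) ^ 8 - \<gamma> V ^ 8\<bar>) \<le> 8 * (1 - m) * m ^ 5"
  proof -
    have "(\<Sum>V\<in>Pow L. \<bar>\<beta> (sym_diff U V) ^ 8 - \<gamma> V ^ 8\<bar>)
      \<le> (\<Sum>V\<in>Pow L. 4 * (1 - m) * (\<bar>\<beta> (sym_diff U V)\<bar> ^ 7 + \<bar>\<gamma> V\<bar> ^ 7))"
    proof (rule sum_mono)
      fix V assume V: "V \<in> Pow L"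
      have "\<bar>\<beta> (sym_diff U V) ^ 8 - \<gamma> V ^ 8\<bar>
        \<le> 4 * \<bar>\<bar>\<beta> (sym_diff U V)\<bar> - \<bar>\<gamma> V\<bar>\<bar> * (\<bar>\<beta> (sym_diff U V)\<bar> ^ 7 + \<bar>\<gamma> V\<bar> ^ 7)"
        using power8_diff_le[of "\<bar>\<beta> (sym_diff U V)\<bar>" "\<bar>\<gamma> V\<bar>"] by simp
      also have "\<dots> \<le> 4 * (1 - m) * (\<bar>\<beta> (sym_diff U V)\<bar> ^ 7 + \<bar>\<gamma> V\<bar> ^ 7)"
        using close[OF V] by (intro mult_right_mono) auto
      finally show "\<bar>\<beta> (sym_diff U V) ^ 8 - \<gamma> V ^ 8\<bar> \<le> 4 * (1 - m) * (\<bar>\<beta> (sym_diff U V)\<bar> ^ 7 + \<bar>\<gamma>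
          V\<bar> ^ 7)" .
    qed
    also have "\<dots> = 4 * (1 - m) * ((\<Sum>V\<in>Pow L. \<bar>\<beta> V\<bar> ^ 7) + (\<Sum>V\<in>Pow L. \<bar>\<gamma> V\<bar> ^ 7))"
      using shift[of "\<lambda>V. \<bar>\<beta> V\<bar> ^ 7"] by (simp add: sum_distrib_left[symmetric] sum.distrib)
    also have "\<dots> \<le> 4 * (1 - m) * (m ^ 5 + m ^ 5)"
      using \<beta>7 \<gamma>7 m1 by (intro mult_left_mono add_mono) auto
    finally show ?thesis by (simp add: algebra_simps)
  qed
  \<comment> \<open>Everything is organised by a position \<open>S\<close> of \<open>x\<close>. In
    the kernel of \<open>g\<close> and \<open>h\<close> the position of \<open>y\<close> is shifted
    by \<open>U\<close> so that it faces \<open>S\<close>, and both terms of \<open>B\<close> then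
    read \<open>z\<close> at the same place.\<close>
  define A where "A = (\<lambda>S. \<Sum>V\<in>Pow L. x S * y (sym_diff S V) * \<alpha> V ^ 8)"
  define B where "B = (\<lambda>S. \<Sum>V\<in>Pow L. z (sym_diff S V) * (y (sym_diff U S) * \<beta> (sym_diff U V) ^ 8 +
      x S * \<gamma> V ^ 8))"
  have kA: "kern L f x g y = (\<Sum>S\<in>Pow L. A S) / 2 ^ card L"
  proof -
    have *: "(\<Sum>T\<in>Pow L. x S * y T * \<alpha> (sym_diff S T) ^ 8) = A S" if "S \<in> Pow L" for S
    proof -
    from that have "(\<Sum>T\<in>Pow L. x S * y T * \<alpha> (sym_diff S T) ^ 8)
      = (\<Sum>T\<in>Pow L. x S * y (sym_diff S T) * \<alpha> (sym_diff S (sym_diff S T)) ^ 8)"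
      by (intro sum_Pow_sym_diff[symmetric]) simp
    also have "\<dots> = (\<Sum>T\<in>Pow L. x S * y (sym_diff S T) * \<alpha> T ^ 8)"
    proof -
      have "sym_diff S (sym_diff S T) = T" for T by blast
      then show ?thesis by (simp only:)
    qed
    finally show ?thesis by (simp only: A_def)
    qed
    show ?thesis
      unfolding kern_def \<alpha>_def[symmetric] by (simp only: * cong: sum.cong)
  qed
  have kB: "kern L g y h z + kern L f x h z = (\<Sum>S\<in>Pow L. B S) / 2 ^ card L"
  proof -
    have 1: "(\<Sum>T\<in>Pow L. y (sym_diff U S) * z T * \<beta> (sym_diff (sym_diff U S) T) ^ 8)
        = (\<Sum>V\<in>Pow L. y (sym_diff U S) * z (sym_diff S V) * \<beta> (sym_diff U V) ^ 8)"
      and 2: "(\<Sum>T\<in>Pow L. x S * z T * \<gamma> (sym_diff S T) ^ 8) = (\<Sum>V\<in>Pow L. x S * z (sym_diff S V) * \<gamma>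
          V ^ 8)"
      if "S \<in> Pow L" for S
    proof -
      have e: "sym_diff (sym_diff U S) (sym_diff S T) = sym_diff U T" "sym_diff S (sym_diff S T) =
          T" for T
        by blast+
      show "(\<Sum>T\<in>Pow L. y (sym_diff U S) * z T * \<beta> (sym_diff (sym_diff U S) T) ^ 8)
        = (\<Sum>V\<in>Pow L. y (sym_diff U S) * z (sym_diff S V) * \<beta> (sym_diff U V) ^ 8)"
        using sum_Pow_sym_diff[of S L "\<lambda>T. y (sym_diff U S) * z T * \<beta> (sym_diff (sym_diff U S) T)
            ^ 8"] that
        unfolding e by simp
      show "(\<Sum>T\<in>Pow L. x S * z T * \<gamma> (sym_diff S T) ^ 8) = (\<Sum>V\<in>Pow L. x S * z (sym_diff S V) * \<gamma> V
          ^ 8)"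
        using sum_Pow_sym_diff[of S L "\<lambda>T. x S * z T * \<gamma> (sym_diff S T) ^ 8"] that
        unfolding e by simp
    qed
    have "kern L g y h z = (\<Sum>S\<in>Pow L. \<Sum>T\<in>Pow L. y (sym_diff U S) * z T * \<beta> (sym_diff (sym_diff U
        S) T) ^ 8) / 2 ^ card L"
      unfolding kern_def \<beta>_def[symmetric]
      using shift[of "\<lambda>S. \<Sum>T\<in>Pow L. y S * z T * \<beta> (sym_diff S T) ^ 8"] by simp
    moreover have "kern L f x h z = (\<Sum>S\<in>Pow L. \<Sum>T\<in>Pow L. x S * z T * \<gamma> (sym_diff S T) ^ 8) / 2 ^
        card L"
      unfolding kern_def \<gamma>_def[symmetric] ..
    ultimately have "kern L g y h z + kern L f x h z
        = (\<Sum>S\<in>Pow L. (\<Sum>T\<in>Pow L. y (sym_diff U S) * z T * \<beta> (sym_diff (sym_diff U S) T) ^ 8)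
            + (\<Sum>T\<in>Pow L. x S * z T * \<gamma> (sym_diff S T) ^ 8)) / 2 ^ card L"
      by (simp only: sum.distrib add_divide_distrib)
    also have "\<dots> = (\<Sum>S\<in>Pow L. B S) / 2 ^ card L"
    proof (intro arg_cong2[where f="(/)"] sum.cong refl)
      fix S assume S: "S \<in> Pow L"
      show "(\<Sum>T\<in>Pow L. y (sym_diff U S) * z T * \<beta> (sym_diff (sym_diff U S) T) ^ 8)
          + (\<Sum>T\<in>Pow L. x S * z T * \<gamma> (sym_diff S T) ^ 8) = B S"
        unfolding 1[OF S] 2[OF S] B_def sum.distrib[symmetric]
        by (intro sum.cong refl) (simp only: distrib_left mult.left_commute mult.commute mult.assoc)
    qed
    finally show ?thesis .
  qed
  have pos: "0 \<le> 1 + A S + B S" if S: "S \<in> Pow L" for S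
  proof -
    have pm: "r = 1 \<or> r = -1" if "\<bar>r\<bar> = 1" for r :: real
      using that by linarith
    \<comment> \<open>If \<open>q = 1\<close>, the main term is positive and pays for the trivial
      bound \<open>2 * m ^ 6\<close> on \<open>B\<close>. If \<open>q = -1\<close>, the main term is
      negative, but the two terms of \<open>B\<close> nearly cancel, as quantified by
      \<open>diff\<close>.\<close>
    define q where "q = x S * y (sym_diff U S)"
    have A: "A S \<ge> q * m ^ 8 - (1 - m\<^sup>2) ^ 4"
    proof -
      have "A S = x S * y (sym_diff S U) * \<alpha> U ^ 8 + (\<Sum>V\<in>Pow L - {U}. x S * y (sym_diff S V) * \<alpha> V
          ^ 8)"
        unfolding A_def using U by (subst sum.remove[OF fin, of U]) auto
      moreover have "\<bar>\<Sum>V\<in>Pow L - {U}. x S * y (sym_diff S V) * \<alpha> V ^ 8\<bar> \<le> (\<Sum>V\<in>Pow L - {U}. \<alpha> V ^ 8)"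
        by (rule order_trans[OF sum_abs]) (simp add: abs_mult unit power_abs[symmetric])
      moreover have "sym_diff S U = sym_diff U S" by blast
      ultimately show ?thesis
        using \<alpha>8 by (simp add: q_def m_def)
    qed
    have "q = 1 \<or> q = -1"
      by (rule pm) (simp add: q_def abs_mult unit)
    then show ?thesis
    proof
      assume q: "q = 1"
      have "\<bar>B S\<bar> \<le> (\<Sum>V\<in>Pow L. \<beta> (sym_diff U V) ^ 8 + \<gamma> V ^ 8)"
        unfolding B_def
      proof (rule order_trans[OF sum_abs], rule sum_mono)
        fix V
        have "\<bar>z (sym_diff S V) * (y (sym_diff U S) * \<beta> (sym_diff U V) ^ 8 + x S * \<gamma> V ^ 8)\<bar>
          \<le> \<bar>y (sym_diff U S) * \<beta> (sym_diff U V) ^ 8\<bar> + \<bar>x S * \<gamma> V ^ 8\<bar>"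
          unfolding abs_mult[of "z _"] unit by simp
        then show "\<bar>z (sym_diff S V) * (y (sym_diff U S) * \<beta> (sym_diff U V) ^ 8 + x S * \<gamma> V ^ 8)\<bar>
          \<le> \<beta> (sym_diff U V) ^ 8 + \<gamma> V ^ 8"
          by (simp add: abs_mult unit)
      qed
      also have "\<dots> \<le> 2 * m ^ 6"
        using \<beta>8 \<gamma>8 shift[of "\<lambda>V. \<beta> V ^ 8"] by (simp add: sum.distrib)
      finally have "1 + A S + B S \<ge> 1 + m ^ 8 - (1 - m\<^sup>2) ^ 4 - 2 * m ^ 6"
        using A q by simp
      moreover have "1 + m ^ 8 - (1 - m\<^sup>2) ^ 4 - 2 * m ^ 6 = 2 * m\<^sup>2 * ((1 - m\<^sup>2) * (2 - m\<^sup>2))"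
        by algebra
      moreover have "2 * m\<^sup>2 * ((1 - m\<^sup>2) * (2 - m\<^sup>2)) \<ge> 0"
        using \<open>m\<^sup>2 \<le> 1\<close> by simp
      ultimately show ?thesis by linarith
    next
      assume q: "q = -1"
      then have yx: "y (sym_diff U S) = - x S"
        using pm[OF unit(4), of S] pm[OF unit(5), of "sym_diff U S"] unfolding q_def
        by (elim disjE) simp_all
      have "\<bar>B S\<bar> \<le> (\<Sum>V\<in>Pow L. \<bar>\<beta> (sym_diff U V) ^ 8 - \<gamma> V ^ 8\<bar>)"
        unfolding B_def
      proof (rule order_trans[OF sum_abs], rule sum_mono)
        fix V
        have "\<bar>z (sym_diff S V) * (y (sym_diff U S) * \<beta> (sym_diff U V) ^ 8 + x S * \<gamma> V ^ 8)\<bar>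
          = \<bar>z (sym_diff S V)\<bar> * \<bar>x S\<bar> * \<bar>\<beta> (sym_diff U V) ^ 8 - \<gamma> V ^ 8\<bar>"
          unfolding yx abs_mult[symmetric] by (simp add: algebra_simps abs_minus_commute)
        then show "\<bar>z (sym_diff S V) * (y (sym_diff U S) * \<beta> (sym_diff U V) ^ 8 + x S * \<gamma> V ^ 8)\<bar>
          \<le> \<bar>\<beta> (sym_diff U V) ^ 8 - \<gamma> V ^ 8\<bar>"
          by (simp add: unit)
      qed
      also note diff
      finally have "1 + A S + B S \<ge> 1 - m ^ 8 - (1 - m\<^sup>2) ^ 4 - 8 * (1 - m) * m ^ 5"
        using A q by simp
      moreover have "1 - m ^ 8 - (1 - m\<^sup>2) ^ 4 - 8 * (1 - m) * m ^ 5
          = (1 - m)\<^sup>2 * m\<^sup>2 * (4 + 8 * m + 6 * m\<^sup>2 - 4 * m ^ 3 - 2 * m ^ 4)"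
        by algebra
      moreover have "4 + 8 * m + 6 * m\<^sup>2 - 4 * m ^ 3 - 2 * m ^ 4 \<ge> 0"
        using power_le_one[OF m0 m1, of 3] power_le_one[OF m0 m1, of 4] m0 zero_le_power2[of m]
          power_decreasing[of 2 3 m] by linarith
      then have "(1 - m)\<^sup>2 * m\<^sup>2 * (4 + 8 * m + 6 * m\<^sup>2 - 4 * m ^ 3 - 2 * m ^ 4) \<ge> 0"
        by (intro mult_nonneg_nonneg) auto
      ultimately show ?thesis by linarith
    qed
  qed
  have "0 \<le> (\<Sum>S\<in>Pow L. 1 + A S + B S) / 2 ^ card L"
    by (intro divide_nonneg_nonneg sum_nonneg pos) auto
  also have "\<dots> = 1 + (\<Sum>S\<in>Pow L. A S) / 2 ^ card L + (\<Sum>S\<in>Pow L. B S) / 2 ^ card L"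
    using L by (simp add: sum.distrib add_divide_distrib card_Pow)
  finally show ?thesis
    using kA kB by simp
qed

text \<open>With plus signs the statement is symmetric in the three points, so the pair with the
  largest coefficient may be taken to be that of \<open>f\<close> and \<open>g\<close>.\<close>

lemma kern_triangle_plus:
  fixes f g h x y z :: "'i set \<Rightarrow> real"
  assumes L: "finite L"
    and unit: "\<And>t. \<bar>f t\<bar> = 1" "\<And>t. \<bar>g t\<bar> = 1" "\<And>t. \<bar>h t\<bar> = 1"
       "\<And>t. \<bar>x t\<bar> = 1" "\<And>t. \<bar>y t\<bar> = 1" "\<And>t. \<bar>z t\<bar> = 1"
  shows "0 \<le> 1 + kern L f x g y + kern L g y h z + kern L f x h z"
proof -
  have ex: "\<exists>U. U \<subseteq> L \<and> (\<forall>V. V \<subseteq> L \<longrightarrow> \<bar>a V\<bar> \<le> \<bar>a U\<bar>)" for a :: "'i set \<Rightarrow> real"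
  proof -
    have "finite ((\<lambda>V. \<bar>a V\<bar>) ` Pow L)" "(\<lambda>V. \<bar>a V\<bar>) ` Pow L \<noteq> {}" using L by auto
    from Max_in[OF this] obtain U where U: "U \<in> Pow L" "Max ((\<lambda>V. \<bar>a V\<bar>) ` Pow L) = \<bar>a U\<bar>"
      by blast
    have "\<bar>a V\<bar> \<le> \<bar>a U\<bar>" if "V \<subseteq> L" for V
      unfolding U(2)[symmetric] by (rule Max_ge) (use that L in auto)
    with U(1) show ?thesis by blast
  qed
  define a where "a = four L (\<lambda>t. f t * g t)"
  define b where "b = four L (\<lambda>t. g t * h t)"
  define c where "c = four L (\<lambda>t. f t * h t)"
  have comm: "(\<lambda>t. g t * f t) = (\<lambda>t. f t * g t)" "(\<lambda>t. h t * g t) = (\<lambda>t. g t * h t)"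
    "(\<lambda>t. h t * f t) = (\<lambda>t. f t * h t)" by (simp_all add: mult.commute)
  obtain U where U: "U \<subseteq> L" "\<And>T. T \<subseteq> L \<Longrightarrow> \<bar>a T\<bar> \<le> \<bar>a U\<bar>"
    using ex[of a] by blast
  obtain V where V: "V \<subseteq> L" "\<And>T. T \<subseteq> L \<Longrightarrow> \<bar>b T\<bar> \<le> \<bar>b V\<bar>"
    using ex[of b] by blast
  obtain W where W: "W \<subseteq> L" "\<And>T. T \<subseteq> L \<Longrightarrow> \<bar>c T\<bar> \<le> \<bar>c W\<bar>"
    using ex[of c] by blast
  note trans = U(2)[THEN order_trans] V(2)[THEN order_trans] W(2)[THEN order_trans]
  consider "\<bar>b V\<bar> \<le> \<bar>a U\<bar>" "\<bar>c W\<bar> \<le> \<bar>a U\<bar>" | "\<bar>a U\<bar> \<le> \<bar>b V\<bar>" "\<bar>c W\<bar> \<le> \<bar>b V\<bar>" | "\<bar>a U\<bar> \<le> \<bar>c W\<bar>" "\<bar>b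
      V\<bar> \<le> \<bar>c W\<bar>"
    by linarith
  then show ?thesis
  proof cases
    case 1
    show ?thesis
      by (rule kern_triangle_aux[OF L U(1)])
        (use unit U V W trans 1 in \<open>simp_all only: comm flip: a_def b_def c_def\<close>)
  next
    case 2
    have "0 \<le> 1 + kern L g y h z + kern L h z f x + kern L g y f x"
      by (rule kern_triangle_aux[OF L V(1)])
        (use unit U V W trans 2 in \<open>simp_all only: comm flip: a_def b_def c_def\<close>)
    then show ?thesis
      by (simp add: kern_commute[of L h z f x] kern_commute[of L g y f x])
  next
    case 3
    have "0 \<le> 1 + kern L f x h z + kern L h z g y + kern L f x g y"
      by (rule kern_triangle_aux[OF L W(1)])
        (use unit U V W trans 3 in \<open>simp_all only: comm flip: a_def b_def c_def\<close>)
    then show ?thesis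
      by (simp add: kern_commute[of L h z g y])
  qed
qed

lemma kern_uminus: "kern L f x g (\<lambda>t. - y t) = - kern L f x g y" "kern L f (\<lambda>t. - x t) g y = -
    kern L f x g y"
  by (simp_all add: kern_def sum_negf)

text \<open>For unit vectors this is the squared triangle inequality in terms of inner products. It
  follows from the symmetric form by negating \<open>y\<close>, since the two kernels that contain
  \<open>y\<close> change sign.\<close>

lemma kern_triangle:
  fixes f g h x y z :: "'i set \<Rightarrow> real"
  assumes L: "finite L"
    and unit: "\<And>t. \<bar>f t\<bar> = 1" "\<And>t. \<bar>g t\<bar> = 1" "\<And>t. \<bar>h t\<bar> = 1"
       "\<And>t. \<bar>x t\<bar> = 1" "\<And>t. \<bar>y t\<bar> = 1" "\<And>t. \<bar>z t\<bar> = 1"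
  shows "kern L f x g y + kern L g y h z \<le> 1 + kern L f x h z"
proof -
  have "0 \<le> 1 + kern L f x g (\<lambda>t. - y t) + kern L g (\<lambda>t. - y t) h z + kern L f x h z"
    by (rule kern_triangle_plus) (use L unit in simp_all)
  then show ?thesis by (simp add: kern_uminus)
qed

section \<open>Values and symmetries of the kernel\<close>

lemma sum_chi:
  assumes "finite L" "U \<subseteq> L"
  shows "(\<Sum>t\<in>Pow L. chi U t) = (if U = {} then 2 ^ card L else 0)"
proof -
  have "finite U" using assms finite_subset by blast
  then have "(\<Sum>t\<in>Pow L. chi U t) = (\<Sum>t\<in>Pow L. chi t U * chi t {})"
    using assms(1) by (intro sum.cong) (auto simp: chi_commute[of U] finite_subset chi_eq_card[of
        _ "{}"])
  then show ?thesis
    using sum_chi_chi[OF assms(1), of U "{}"] assms by simp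
qed

text \<open>The product of \<open>f\<close> with itself is 1, whose only nonzero coefficient is at
  the empty set, so only S = T survives. This yields unit length and the length of the edge that
  receives the loop mass.\<close>

lemma kern_same:
  assumes L: "finite L" and f: "\<And>t. \<bar>f t\<bar> = 1"
  shows "kern L f x f y = (\<Sum>S\<in>Pow L. x S * y S) / 2 ^ card L"
proof -
  have "f t * f t = 1" for t
    using f by (metis abs_mult_self_eq mult_1)
  then have "four L (\<lambda>t. f t * f t) (sym_diff S T) = (if S = T then 1 else 0)"
    if "S \<in> Pow L" "T \<in> Pow L" for S T
  proof -
    have "sym_diff S T \<subseteq> L" "sym_diff S T = {} \<longleftrightarrow> S = T"
      using that by blast+
    then show ?thesis
      using sum_chi[OF L, of "sym_diff S T"] \<open>\<And>t. f t * f t = 1\<close>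
      by (simp add: four_def del: Un_empty)
  qed
  then have "kern L f x f y = (\<Sum>S\<in>Pow L. \<Sum>T\<in>Pow L. if S = T then x S * y T else 0) / 2 ^ card L"
    unfolding kern_def by (intro arg_cong2[where f="(/)"] sum.cong refl) auto
  then show ?thesis using L by simp
qed

lemma kern_cong:
  assumes "\<And>t. t \<subseteq> L \<Longrightarrow> f t = f' t" "\<And>t. t \<subseteq> L \<Longrightarrow> x t = x' t"
    "\<And>t. t \<subseteq> L \<Longrightarrow> g t = g' t" "\<And>t. t \<subseteq> L \<Longrightarrow> y t = y' t"
  shows "kern L f x g y = kern L f' x' g' y'"
  unfolding kern_def four_def using assms by simp

lemma kern_translate:
  assumes L: "finite L" and U: "U \<subseteq> L"
  shows "kern L (\<lambda>t. chi U t * f t) (\<lambda>S. x (sym_diff U S)) g y = kern L f x g y"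
proof -
  have "four L (\<lambda>t. chi U t * f t * g t) (sym_diff S T) = four L (\<lambda>t. f t * g t) (sym_diff
      (sym_diff U S) T)"
    if "S \<in> Pow L" "T \<in> Pow L" for S T
  proof -
    have fin: "finite U" "finite (sym_diff S T)"
      using that U L finite_subset[of _ L] by auto
    have "sym_diff (sym_diff U S) T = sym_diff U (sym_diff S T)" by blast
    then show ?thesis
      unfolding four_def by (simp add: chi_sym_diff[OF fin] ac_simps del: Un_assoc)
  qed
  then have "kern L (\<lambda>t. chi U t * f t) (\<lambda>S. x (sym_diff U S)) g y
    = (\<Sum>S\<in>Pow L. \<Sum>T\<in>Pow L. x (sym_diff U S) * y T * four L (\<lambda>t. f t * g t) (sym_diff (sym_diff U
        S) T) ^ 8) / 2 ^ card L"
    unfolding kern_def by (intro arg_cong2[where f="(/)"] sum.cong refl) simp_all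
  also have "\<dots> = kern L f x g y"
    unfolding kern_def
    using sum_Pow_sym_diff[OF U, of "\<lambda>S. \<Sum>T\<in>Pow L. x S * y T * four L (\<lambda>t. f t * g t) (sym_diff S
        T) ^ 8"]
    by simp
  finally show ?thesis .
qed

text \<open>The coordinates of the eighth tensor power are indexed by 8-tuples \<open>\<tau>\<close>.\<close>

definition kvec :: "'i set \<Rightarrow> ('i set \<Rightarrow> real) \<Rightarrow> ('i set \<Rightarrow> real) \<Rightarrow> (nat \<Rightarrow> 'i set) \<Rightarrow> real" where
  "kvec L f x \<tau> = (\<Prod>j<8. f (\<tau> j)) * (\<Sum>S\<in>Pow L. x S * (\<Prod>j<8. chi S (\<tau> j)))
     / (sqrt (2 ^ card L) * (2 ^ card L) ^ 4)"

text \<open>The eighth power of an average over \<open>Pow L\<close> is an average over 8-tuples. Of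
  the divisor \<open>N ^ 9\<close>, the part \<open>N ^ 8\<close> belongs to these averages and one
  \<open>N\<close> to the squared length of the orbit sum.\<close>

lemma kvec_gram:
  assumes L: "finite L"
  shows "(\<Sum>\<tau>\<in>PiE {..<8} (\<lambda>_. Pow L). kvec L f x \<tau> * kvec L g y \<tau>) = kern L f x g y"
proof -
  define N :: real where "N = 2 ^ card L"
  have N: "sqrt N * sqrt N = N" "N > 0" by (simp_all add: N_def)
  let ?E = "PiE {..<8::nat} (\<lambda>_. Pow L)"
  have prod8: "(\<Sum>\<tau>\<in>?E. \<Prod>j<8. \<phi> (\<tau> j)) = (\<Sum>t\<in>Pow L. \<phi> t) ^ 8" for \<phi> :: "'a set \<Rightarrow> real"
    using prod_sum_PiE[of "{..<8::nat}" "\<lambda>_. Pow L" "\<lambda>_. \<phi>"] L by simp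
  have 1: "kvec L f x \<tau> * kvec L g y \<tau> = (\<Sum>S\<in>Pow L. \<Sum>T\<in>Pow L. x S * y T *
      (\<Prod>j<8. f (\<tau> j) * g (\<tau> j) * (chi S (\<tau> j) * chi T (\<tau> j)))) / N ^ 9" for \<tau>
  proof -
    have "(sqrt N * N ^ 4) * (sqrt N * N ^ 4) = (sqrt N * sqrt N) * N ^ 8"
      by (simp add: algebra_simps flip: power_add)
    then have "(sqrt N * N ^ 4) * (sqrt N * N ^ 4) = N ^ 9"
      unfolding N(1) by (simp flip: power_Suc)
    then have "kvec L f x \<tau> * kvec L g y \<tau> = ((\<Prod>j<8. f (\<tau> j)) * (\<Prod>j<8. g (\<tau> j))) *
       ((\<Sum>S\<in>Pow L. x S * (\<Prod>j<8. chi S (\<tau> j))) * (\<Sum>T\<in>Pow L. y T * (\<Prod>j<8. chi T (\<tau> j)))) / N ^ 9"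
      unfolding kvec_def N_def[symmetric] by (simp only: times_divide_times_eq ac_simps)
    also have "\<dots> = (\<Sum>S\<in>Pow L. \<Sum>T\<in>Pow L. x S * y T *
      (\<Prod>j<8. f (\<tau> j) * g (\<tau> j) * (chi S (\<tau> j) * chi T (\<tau> j)))) / N ^ 9"
      unfolding sum_product unfolding sum_distrib_left prod.distrib by (simp only: ac_simps)
    finally show ?thesis .
  qed
  have 2: "(\<Sum>\<tau>\<in>?E. \<Prod>j<8. f (\<tau> j) * g (\<tau> j) * (chi S (\<tau> j) * chi T (\<tau> j)))
      = N ^ 8 * four L (\<lambda>t. f t * g t) (sym_diff S T) ^ 8" if "S \<in> Pow L" "T \<in> Pow L" for S T
  proof -
    have fin: "finite S" "finite T" using that L finite_subset by auto
    have "(\<Sum>t\<in>Pow L. f t * g t * (chi S t * chi T t)) = N * four L (\<lambda>t. f t * g t) (sym_diff S T)"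
      using N(2) by (simp add: four_def chi_sym_diff[OF fin] N_def[symmetric])
    then show ?thesis
      using prod8[of "\<lambda>t. f t * g t * (chi S t * chi T t)"] by (simp add: power_mult_distrib)
  qed
  have "(\<Sum>\<tau>\<in>?E. kvec L f x \<tau> * kvec L g y \<tau>) = (\<Sum>S\<in>Pow L. \<Sum>T\<in>Pow L. x S * y T *
      (\<Sum>\<tau>\<in>?E. \<Prod>j<8. f (\<tau> j) * g (\<tau> j) * (chi S (\<tau> j) * chi T (\<tau> j)))) / N ^ 9"
    unfolding 1 sum_divide_distrib[symmetric] sum_distrib_left
    by (subst sum.swap, subst (2) sum.swap) (rule refl)
  also have "\<dots> = (\<Sum>S\<in>Pow L. \<Sum>T\<in>Pow L. N ^ 8 * (x S * y T * four L (\<lambda>t. f t * g t) (sym_diff S T) ^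
      8)) / N ^ 9"
    by (intro arg_cong2[where f="(/)"] sum.cong refl) (simp add: 2)
  also have "\<dots> = kern L f x g y"
    using N(2) by (simp add: kern_def N_def[symmetric] sum_distrib_left[symmetric] power_Suc[of N
        8, simplified])
  finally show ?thesis .
qed

section \<open>The group action on the vertices of the cube\<close>

text \<open>The group is \<open>Pow L\<close> under symmetric difference, with characters \<open>chi U\<close>. A subset \<open>X\<close> of
  \<open>cube L\<close> encodes the pair \<open>(f, x)\<close> with \<open>f t = sg X (Inl t)\<close> and \<open>x S = sg X (Inr S)\<close>.\<close>

abbreviation cube :: "'i set \<Rightarrow> ('i set + 'i set) set" where
  "cube L \<equiv> Pow L <+> Pow L"

definition act :: "'i set \<Rightarrow> 'i set \<Rightarrow> ('i set + 'i set) set \<Rightarrow> ('i set + 'i set) set" where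
  "act L U X = Inl ` {t \<in> Pow L. (Inl t \<in> X) \<noteq> (chi U t = -1)} \<union> Inr ` {S \<in> Pow L. Inr (sym_diff U
      S) \<in> X}"

text \<open>The values of \<open>f\<close> at the singletons determine the group element that makes all of them \<open>1\<close>,
  which singles out one representative in each orbit.\<close>

definition label :: "'i set \<Rightarrow> ('i set + 'i set) set \<Rightarrow> 'i set" where
  "label L X = {i \<in> L. Inl {i} \<in> X}"

definition canon :: "'i set \<Rightarrow> ('i set + 'i set) set \<Rightarrow> ('i set + 'i set) set" where
  "canon L X = act L (label L X) X"

definition kernel :: "'i set \<Rightarrow> ('i set + 'i set) set \<Rightarrow> ('i set + 'i set) set \<Rightarrow> real" where
  "kernel L X Y = kern L (\<lambda>t. sg X (Inl t)) (\<lambda>S. sg X (Inr S)) (\<lambda>t. sg Y (Inl t)) (\<lambda>S. sg Y (Inr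
      S))"

lemma chi_cases: "chi S X = 1 \<or> chi S X = -1"
  using abs_chi[of S X] by linarith

lemma chi_singleton: "finite U \<Longrightarrow> chi U {i} = -1 \<longleftrightarrow> i \<in> U"
  by (auto simp: chi_eq_card Int_insert_right)

lemma sg_act_Inl: "t \<subseteq> L \<Longrightarrow> sg (act L U X) (Inl t) = chi U t * sg X (Inl t)"
  using chi_cases[of U t] by (auto simp: sg_def act_def)

lemma sg_act_Inr: "S \<subseteq> L \<Longrightarrow> sg (act L U X) (Inr S) = sg X (Inr (sym_diff U S))"
  by (auto simp: sg_def act_def)

lemma act_subset: "act L U X \<subseteq> cube L"
  by (auto simp: act_def)

lemma act_empty: "X \<subseteq> cube L \<Longrightarrow> act L {} X = X"
  by (auto simp: act_def chi_def)

lemma sg_eqI: "\<lbrakk>X \<subseteq> K; Y \<subseteq> K; \<And>i. i \<in> K \<Longrightarrow> sg X i = sg Y i\<rbrakk> \<Longrightarrow> X = Y"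
  by (fastforce simp: sg_def split: if_splits)

lemma act_act:
  assumes "finite L" "U \<subseteq> L" "W \<subseteq> L"
  shows "act L U (act L W X) = act L (sym_diff U W) X"
proof (rule sg_eqI[OF act_subset act_subset])
  fix i assume "i \<in> cube L"
  have fin: "finite U" "finite W" using assms finite_subset by auto
  from \<open>i \<in> cube L\<close> show "sg (act L U (act L W X)) i = sg (act L (sym_diff U W) X) i"
  proof (elim PlusE)
    fix t assume "i = Inl t" "t \<in> Pow L"
    then show ?thesis by (simp add: sg_act_Inl chi_sym_diff[OF fin])
  next
    fix S assume S: "i = Inr S" "S \<in> Pow L"
    then have "sym_diff U S \<subseteq> L" using assms by auto
    moreover have "sym_diff W (sym_diff U S) = sym_diff (sym_diff U W) S" by blast
    ultimately show ?thesis using S by (simp add: sg_act_Inr)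
  qed
qed

lemma act_involution: "finite L \<Longrightarrow> U \<subseteq> L \<Longrightarrow> X \<subseteq> cube L \<Longrightarrow> act L U (act L U X) = X"
  by (simp add: act_act act_empty)

lemma label_subset: "label L X \<subseteq> L"
  by (auto simp: label_def)

text \<open>At a singleton a character detects membership of its element, so the action shifts the
  label by \<open>U\<close>; in particular the action is free.\<close>

lemma label_act:
  assumes "finite L" "U \<subseteq> L"
  shows "label L (act L U X) = sym_diff U (label L X)"
proof -
  have "finite U" using assms finite_subset by blast
  then show ?thesis
    using assms(2) by (auto simp: label_def act_def chi_singleton)
qed

lemma label_canon: "finite L \<Longrightarrow> label L (canon L X) = {}"
  by (simp add: canon_def label_act label_subset)

lemma canon_subset: "canon L X \<subseteq> cube L"
  by (simp add: canon_def act_subset)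

text \<open>The shift of the label cancels the extra \<open>U\<close>. Composition with
  \<open>canon\<close> therefore turns a cut of the orbits into an invariant function on the whole
  cube.\<close>

lemma canon_act:
  assumes "finite L" "U \<subseteq> L"
  shows "canon L (act L U X) = canon L X"
proof -
  have "sym_diff (sym_diff U (label L X)) U = label L X" by blast
  then show ?thesis
    using assms label_subset[of L X]
    by (simp add: canon_def label_act act_act Un_subset_iff Diff_subset_conv le_supI2)
qed

lemma canon_id: "X \<subseteq> cube L \<Longrightarrow> label L X = {} \<Longrightarrow> canon L X = X"
  by (simp add: canon_def act_empty)

lemma kernel_commute: "kernel L X Y = kernel L Y X"
  unfolding kernel_def by (rule kern_commute)

lemma kernel_act:
  assumes "finite L" "U \<subseteq> L"
  shows "kernel L (act L U X) Y = kernel L X Y"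
proof -
  have "kernel L (act L U X) Y = kern L (\<lambda>t. chi U t * sg X (Inl t)) (\<lambda>S. sg X (Inr (sym_diff U S)))
      (\<lambda>t. sg Y (Inl t)) (\<lambda>S. sg Y (Inr S))"
    unfolding kernel_def by (rule kern_cong) (simp_all add: sg_act_Inl sg_act_Inr)
  then show ?thesis
    unfolding kernel_def using kern_translate[OF assms, of "\<lambda>t. sg X (Inl t)" "\<lambda>S. sg X (Inr S)"]
        by simp
qed

lemma kernel_canon: "finite L \<Longrightarrow> kernel L (canon L X) (canon L Y) = kernel L X Y"
  by (metis canon_def kernel_act kernel_commute label_subset)

lemma sum_Pow_act:
  assumes "finite L" "U \<subseteq> L"
  shows "(\<Sum>X\<in>Pow (cube L). \<phi> (act L U X)) = (\<Sum>X\<in>Pow (cube L). \<phi> X)"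
  by (rule sum.reindex_bij_witness[where i="act L U" and j="act L U"])
     (use assms act_subset[of L U] in \<open>auto simp: act_involution\<close>)

lemma kernel_self: "finite L \<Longrightarrow> kernel L X X = 1"
  by (simp add: kernel_def kern_same card_Pow)

lemma kernel_triangle:
  "finite L \<Longrightarrow> kernel L X Y + kernel L Y Z \<le> 1 + kernel L X Z"
  unfolding kernel_def by (rule kern_triangle) simp_all

section \<open>Expectations under the noise operator\<close>

lemma four_const: "finite K \<Longrightarrow> S \<subseteq> K \<Longrightarrow> four K (\<lambda>X. 1) S = (if S = {} then 1 else 0)"
  using sum_chi[of K S] by (simp add: four_def)

lemma avg2_noise:
  assumes "finite K"
  shows "avg2 K (noise K \<rho>) = 1"
proof -
  have "avg2 K (noise K \<rho>) = (\<Sum>S\<in>Pow K. \<rho> ^ card S * (four K (\<lambda>X. 1) S * four K (\<lambda>X. 1) S))"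
    using noise_fourier[OF assms, of \<rho> "\<lambda>X. 1" "\<lambda>X. 1"] by simp
  also have "\<dots> = (\<Sum>S\<in>Pow K. if S = {} then 1 else 0)"
    by (intro sum.cong refl) (use assms in \<open>simp add: four_const\<close>)
  finally show ?thesis using assms by simp
qed

lemma four_sg:
  assumes "finite K" "S \<subseteq> K" "i \<in> K"
  shows "four K (\<lambda>X. sg X i) S = (if S = {i} then 1 else 0)"
proof -
  have fin: "finite S" using assms finite_subset by blast
  have "four K (\<lambda>X. sg X i) S = (\<Sum>X\<in>Pow K. chi {i} X * chi S X) / 2 ^ card K"
    by (simp add: four_def chi_def)
  also have "\<dots> = (\<Sum>X\<in>Pow K. chi (sym_diff {i} S) X) / 2 ^ card K"
    using fin by (simp add: chi_sym_diff)
  also have "\<dots> = (if sym_diff {i} S = {} then 1 else 0)"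
  proof -
    have "sym_diff {i} S \<subseteq> K" using assms by blast
    from sum_chi[OF assms(1) this] show ?thesis by (simp del: Un_empty)
  qed
  also have "sym_diff {i} S = {} \<longleftrightarrow> S = {i}" by blast
  finally show ?thesis .
qed

lemma avg2_noise_sg:
  assumes "finite K" "i \<in> K"
  shows "avg2 K (\<lambda>X Y. noise K \<rho> X Y * (sg X i * sg Y i)) = \<rho>"
proof -
  have "avg2 K (\<lambda>X Y. noise K \<rho> X Y * (sg X i * sg Y i)) = (\<Sum>S\<in>Pow K. if S = {i} then \<rho> else 0)"
    unfolding noise_fourier[OF assms(1), of \<rho> "\<lambda>X. sg X i" "\<lambda>X. sg X i"]
    by (intro sum.cong refl) (use assms in \<open>simp add: four_sg\<close>)
  then show ?thesis using assms by simp
qed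

lemma noise_nonneg: "\<bar>\<rho>\<bar> \<le> 1 \<Longrightarrow> noise K \<rho> X Y \<ge> 0"
proof -
  assume "\<bar>\<rho>\<bar> \<le> 1"
  then have "1 + \<rho> * (sg X i * sg Y i) \<ge> 0" for i
    using sg_cases[of X i] sg_cases[of Y i] by (elim disjE) auto
  then show ?thesis by (auto simp: noise_def intro: prod_nonneg)
qed

lemma noise_flip: "noise K \<rho> (sym_diff X {i}) (sym_diff Y {i}) = noise K \<rho> X Y"
  unfolding noise_def by (intro prod.cong refl) (simp only: sg_flip, auto)

lemma avg2_flip_both:
  assumes "i \<in> K"
  shows "avg2 K (\<lambda>X Y. \<phi> (sym_diff X {i}) (sym_diff Y {i})) = avg2 K \<phi>"
  using avg2_flip1[OF assms, of \<phi>] avg2_flip2[OF assms, of "\<lambda>X Y. \<phi> (sym_diff X {i}) Y"] by simp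

lemma card_cube: "finite L \<Longrightarrow> card (cube L) = 2 * 2 ^ card L"
  by (simp add: card_Plus card_Pow)

text \<open>Only the terms with \<open>S = T\<close> of the kernel survive, since flipping \<open>x\<^sub>S\<close> and \<open>y\<^sub>S\<close> together
  preserves the noise.\<close>

lemma noise_kernel_cost:
  assumes L: "finite L" and \<rho>: "\<bar>\<rho>\<bar> \<le> 1"
  shows "avg2 (cube L) (\<lambda>X Y. noise (cube L) \<rho> X Y * (1 - kernel L X Y)) \<le> 9 * (1 - \<rho>)"
proof -
  define K where "K = cube L"
  have K: "finite K" using L by (simp add: K_def)
  define N :: real where "N = 2 ^ card L"
  have N: "N > 0" "real (card (Pow L)) = N" using L by (simp_all add: N_def card_Pow)
  define p where "p = (\<lambda>X Y. \<Sum>t\<in>Pow L. sg X (Inl t :: 'a set + 'a set) * sg Y (Inl t :: 'a set +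
      'a set))"
  define q where "q = (\<lambda>X Y. \<Sum>S\<in>Pow L. sg X (Inr S :: 'a set + 'a set) * sg Y (Inr S :: 'a set +
      'a set))"
  let ?nu = "noise K \<rho>"
  let ?h = "\<lambda>X Y. four L (\<lambda>t. sg X (Inl t :: 'a set + 'a set) * sg Y (Inl t :: 'a set + 'a set))"
  have h0: "?h X Y {} = p X Y / N" for X Y
    by (simp add: four_def chi_def p_def N_def)
  have off: "avg2 K (\<lambda>X Y. ?nu X Y * (sg X (Inr S) * sg Y (Inr T) * ?h X Y U ^ 8)) = 0"
    if "S \<in> Pow L" "S \<noteq> T" for S T U
  proof -
    let ?\<phi> = "\<lambda>X Y. ?nu X Y * (sg X (Inr S) * sg Y (Inr T) * ?h X Y U ^ 8)"
    have "avg2 K ?\<phi> = avg2 K (\<lambda>X Y. ?\<phi> (sym_diff X {Inr S}) (sym_diff Y {Inr S}))"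
      using that by (intro avg2_flip_both[symmetric]) (auto simp: K_def)
    also have "\<dots> = avg2 K (\<lambda>X Y. (-1) * ?\<phi> X Y)"
      unfolding noise_flip sg_flip using that(2) by simp
    finally show ?thesis unfolding avg2_cmult by simp
  qed
  have "avg2 K (\<lambda>X Y. ?nu X Y * kernel L X Y)
    = avg2 K (\<lambda>X Y. (1 / N) * (\<Sum>S\<in>Pow L. \<Sum>T\<in>Pow L. ?nu X Y * (sg X (Inr S) * sg Y (Inr T) * ?h X Y
        (sym_diff S T) ^ 8)))"
    by (simp add: kernel_def kern_def sum_distrib_left sum_divide_distrib N_def)
  also have "\<dots> = (1 / N) * (\<Sum>S\<in>Pow L. \<Sum>T\<in>Pow L. avg2 K (\<lambda>X Y. ?nu X Y * (sg X (Inr S) * sg Y (Inr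
      T) * ?h X Y (sym_diff S T) ^ 8)))"
    by (simp only: avg2_cmult avg2_sum)
  also have "\<dots> = (1 / N) * (\<Sum>S\<in>Pow L. \<Sum>T\<in>Pow L. if S = T then avg2 K (\<lambda>X Y. ?nu X Y * (sg X (Inr
      S) * sg Y (Inr S) * ?h X Y {} ^ 8)) else 0)"
    using off by (intro arg_cong2[where f="(*)"] sum.cong refl) auto
  also have "\<dots> = (1 / N) * (\<Sum>S\<in>Pow L. avg2 K (\<lambda>X Y. ?nu X Y * (sg X (Inr S) * sg Y (Inr S) * ?h X
      Y {} ^ 8)))"
    using L by simp
  also have "\<dots> = avg2 K (\<lambda>X Y. (1 / N) * (\<Sum>S\<in>Pow L. ?nu X Y * (sg X (Inr S) * sg Y (Inr S) * ?h X
      Y {} ^ 8)))"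
    by (simp only: avg2_cmult avg2_sum)
  also have "\<dots> = avg2 K (\<lambda>X Y. ?nu X Y * (q X Y / N * (p X Y / N) ^ 8))"
    unfolding h0 by (simp add: q_def sum_distrib_left sum_distrib_right sum_divide_distrib ac_simps)
  finally have E: "avg2 K (\<lambda>X Y. ?nu X Y * kernel L X Y) = avg2 K (\<lambda>X Y. ?nu X Y * (q X Y / N * (p
      X Y / N) ^ 8))" .
  have "avg2 K (\<lambda>X Y. ?nu X Y * (1 - kernel L X Y)) = avg2 K ?nu - avg2 K (\<lambda>X Y. ?nu X Y * kernel
      L X Y)"
    unfolding avg2_diff[symmetric] by (simp add: right_diff_distrib)
  also have "\<dots> = avg2 K (\<lambda>X Y. ?nu X Y * (1 - q X Y / N * (p X Y / N) ^ 8))"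
    unfolding E avg2_diff[symmetric] by (simp add: right_diff_distrib)
  \<comment> \<open>\<open>p / N\<close> and \<open>q / N\<close> are the mean agreements on the
    \<open>f\<close>- and \<open>x\<close>-coordinates. Bernoulli's inequality, which for even
    exponents also covers a negative base, turns the exponent 8 into a factor 8; hence 9 = 8 +
    1.\<close>
  also have "\<dots> \<le> avg2 K (\<lambda>X Y. ?nu X Y * (8 * (1 - p X Y / N) + (1 - q X Y / N)))"
  proof (intro avg2_mono mult_left_mono noise_nonneg \<rho>)
    fix X Y
    have "\<bar>p X Y\<bar> \<le> N" "\<bar>q X Y\<bar> \<le> N"
      unfolding p_def q_def N(2)[symmetric] using L
      by (auto intro!: order_trans[OF sum_abs] simp: abs_mult)
    then have P: "\<bar>p X Y / N\<bar> \<le> 1" and Q: "\<bar>q X Y / N\<bar> \<le> 1"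
      using N(1) by (auto simp: field_simps)
    have "1 + real 8 * (p X Y / N - 1) \<le> (1 + (p X Y / N - 1)) ^ 8"
      by (rule Bernoulli_inequality_even) simp
    then have "1 - (p X Y / N) ^ 8 \<le> 8 * (1 - p X Y / N)" by simp
    moreover have "r ^ 8 \<le> 1" if "\<bar>r\<bar> \<le> 1" for r :: real
      using power_mono[of "\<bar>r\<bar>" 1 8] that by simp
    from this[OF P] have "(p X Y / N) ^ 8 \<le> 1" .
    then have "(1 - q X Y / N) * (1 - (p X Y / N) ^ 8) \<ge> 0"
      using Q by (intro mult_nonneg_nonneg) linarith+
    then have "1 - q X Y / N * (p X Y / N) ^ 8 \<le> (1 - (p X Y / N) ^ 8) + (1 - q X Y / N)"
      by (simp add: algebra_simps)
    ultimately show "1 - q X Y / N * (p X Y / N) ^ 8 \<le> 8 * (1 - p X Y / N) + (1 - q X Y / N)"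
      by linarith
  qed
  also have "\<dots> = avg2 K (\<lambda>X Y. 9 * ?nu X Y - (8 / N * (?nu X Y * p X Y) + 1 / N * (?nu X Y * q X
      Y)))"
    by (rule avg2_cong) (simp add: algebra_simps)
  also have "\<dots> = avg2 K (\<lambda>X Y. 9 * ?nu X Y - (8 / N * (\<Sum>t\<in>Pow L. ?nu X Y * (sg X (Inl t) * sg Y
      (Inl t)))
      + 1 / N * (\<Sum>S\<in>Pow L. ?nu X Y * (sg X (Inr S) * sg Y (Inr S)))))"
    unfolding p_def q_def sum_distrib_left[of "?nu _ _"] ..
  also have "\<dots> = 9 * avg2 K ?nu - (8 / N * (\<Sum>t\<in>Pow L. avg2 K (\<lambda>X Y. ?nu X Y * (sg X (Inl t) * sg Y
      (Inl t))))
      + 1 / N * (\<Sum>S\<in>Pow L. avg2 K (\<lambda>X Y. ?nu X Y * (sg X (Inr S) * sg Y (Inr S)))))"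
    by (simp only: avg2_cmult avg2_sum avg2_diff avg2_add)
  also have "\<dots> = 9 * (1 - \<rho>)"
  proof -
    have "(\<Sum>t\<in>Pow L. avg2 K (\<lambda>X Y. ?nu X Y * (sg X (Inl t) * sg Y (Inl t)))) = N * \<rho>"
      "(\<Sum>S\<in>Pow L. avg2 K (\<lambda>X Y. ?nu X Y * (sg X (Inr S) * sg Y (Inr S)))) = N * \<rho>"
    proof -
      have "(\<Sum>t\<in>Pow L. avg2 K (\<lambda>X Y. ?nu X Y * (sg X (Inl t) * sg Y (Inl t)))) = (\<Sum>t\<in>Pow L. \<rho>)"
        "(\<Sum>S\<in>Pow L. avg2 K (\<lambda>X Y. ?nu X Y * (sg X (Inr S) * sg Y (Inr S)))) = (\<Sum>S\<in>Pow L. \<rho>)"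
        by (intro sum.cong refl avg2_noise_sg[OF K]; auto simp: K_def)+
      then show "(\<Sum>t\<in>Pow L. avg2 K (\<lambda>X Y. ?nu X Y * (sg X (Inl t) * sg Y (Inl t)))) = N * \<rho>"
        "(\<Sum>S\<in>Pow L. avg2 K (\<lambda>X Y. ?nu X Y * (sg X (Inr S) * sg Y (Inr S)))) = N * \<rho>"
        by (simp_all add: N(2))
    qed
    then show ?thesis using N(1) by (simp add: avg2_noise[OF K])
  qed
  finally show ?thesis by (simp only: K_def)
qed

section \<open>Invariant functions have small influences\<close>

definition perm :: "'i set \<Rightarrow> 'i set + 'i set \<Rightarrow> 'i set + 'i set" where
  "perm U i = (case i of Inl t \<Rightarrow> Inl t | Inr S \<Rightarrow> Inr (sym_diff U S))"

lemma perm_perm [simp]: "perm U (perm U i) = i"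
proof -
  have "sym_diff U (sym_diff U S) = S" for S by blast
  then show ?thesis by (simp add: perm_def split: sum.split)
qed

lemma inj_perm: "inj_on (perm U) S"
  by (metis inj_onI perm_perm)

lemma perm_cube: "U \<subseteq> L \<Longrightarrow> i \<in> cube L \<Longrightarrow> perm U i \<in> cube L"
  by (auto simp: perm_def)

text \<open>The action carries a character to that of the permuted set, up to a sign collected in
  \<open>c\<close>, which disappears in the square.\<close>

lemma four_perm:
  assumes L: "finite L" and U: "U \<subseteq> L" and S: "S \<subseteq> cube L"
    and inv: "\<And>X. X \<subseteq> cube L \<Longrightarrow> A (act L U X) = A X"
  shows "(four (cube L) A (perm U ` S))\<^sup>2 = (four (cube L) A S)\<^sup>2"
proof -
  define c where "c = (\<Prod>i\<in>S. case i of Inl t \<Rightarrow> chi U t | Inr _ \<Rightarrow> 1)"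
  have c: "c\<^sup>2 = 1"
    unfolding c_def power2_eq_square prod.distrib[symmetric]
    by (rule prod.neutral) (auto split: sum.split)
  have "sg (act L U X) i = (case i of Inl t \<Rightarrow> chi U t | Inr _ \<Rightarrow> 1) * sg X (perm U i)" if "i \<in> S"
      for i X
    using S that by (auto simp: perm_def sg_act_Inl sg_act_Inr split: sum.split)
  then have chi: "chi S (act L U X) = c * chi (perm U ` S) X" for X
    unfolding chi_def c_def prod.distrib[symmetric]
    by (subst prod.reindex[OF inj_perm]) (simp add: prod.distrib)
  have "(\<Sum>X\<in>Pow (cube L). A X * chi S X) = (\<Sum>X\<in>Pow (cube L). A (act L U X) * chi S (act L U X))"
    by (rule sum_Pow_act[OF L U, symmetric])
  also have "\<dots> = c * (\<Sum>X\<in>Pow (cube L). A X * chi (perm U ` S) X)"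
    unfolding sum_distrib_left by (intro sum.cong refl) (simp add: inv chi)
  finally have "four (cube L) A S = c * four (cube L) A (perm U ` S)"
    by (simp add: four_def)
  then show ?thesis by (simp add: power_mult_distrib c)
qed

text \<open>Translation carries \<open>j\<close> to each of the \<open>2 ^ card L\<close>
  coordinates of \<open>x\<close>, so these all have the same influence. Summed over them, a set of
  size at most \<open>k\<close> is counted at most \<open>k\<close> times, and the squared
  coefficients add up to 1.\<close>

lemma influence_bound:
  assumes L: "finite L" and j: "j \<in> Inr ` Pow L"
    and inv: "\<And>U X. U \<subseteq> L \<Longrightarrow> X \<subseteq> cube L \<Longrightarrow> A (act L U X) = A X"
    and A: "\<And>X. X \<subseteq> cube L \<Longrightarrow> A X = 1 \<or> A X = -1"
  shows "(\<Sum>S | S \<subseteq> cube L \<and> j \<in> S \<and> card S \<le> k. (four (cube L) A S)\<^sup>2) \<le> real k / 2 ^ card L"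
proof -
  define K where "K = cube L"
  have K: "finite K" using L by (simp add: K_def)
  define a where "a = (\<lambda>S. (four K A S)\<^sup>2)"
  define inf where "inf = (\<lambda>j. \<Sum>S | S \<subseteq> K \<and> j \<in> S \<and> card S \<le> k. a S)"
  obtain T where T: "j = Inr T" "T \<subseteq> L" using j by auto
  have eq: "inf (Inr (sym_diff U T)) = inf j" if U: "U \<subseteq> L" for U
  proof -
    define F where "F = (\<lambda>i. {S. S \<subseteq> K \<and> i \<in> S \<and> card S \<le> k})"
    have pp: "perm U ` perm U ` S = S" for S
      by (simp add: image_image)
    have F: "perm U ` S \<in> F (perm U i)" if "S \<in> F i" for S i
      using that perm_cube[OF U] by (auto simp: F_def K_def card_image[OF inj_perm])
    have pj: "perm U j = Inr (sym_diff U T)"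
      by (simp add: T perm_def)
    have pj': "perm U (Inr (sym_diff U T)) = j"
      unfolding pj[symmetric] by (rule perm_perm)
    have "sum a (F (Inr (sym_diff U T))) = sum a (F j)"
    proof (rule sum.reindex_bij_witness[where i="image (perm U)" and j="image (perm U)"])
      fix S assume S: "S \<in> F (Inr (sym_diff U T))"
      show "perm U ` perm U ` S = S" by (rule pp)
      show "perm U ` S \<in> F j"
        using F[OF S] unfolding pj' .
      show "a (perm U ` S) = a S"
        unfolding a_def K_def by (rule four_perm[OF L U]) (use S inv U in \<open>auto simp: F_def K_def\<close>)
    next
      fix S assume S: "S \<in> F j"
      show "perm U ` perm U ` S = S" by (rule pp)
      show "perm U ` S \<in> F (Inr (sym_diff U T))"
        using F[OF S] unfolding pj .
    qed
    then show ?thesis by (simp add: inf_def F_def)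
  qed
  have "2 ^ card L * inf j = (\<Sum>U\<in>Pow L. inf (Inr (sym_diff U T)))"
    using L by (simp add: eq card_Pow)
  also have "\<dots> = (\<Sum>U\<in>Pow L. inf (Inr U))"
    using sum_Pow_sym_diff[OF T(2), of "\<lambda>U. inf (Inr U)"] by (simp add: Un_commute)
  also have "\<dots> = (\<Sum>U\<in>Pow L. \<Sum>S | S \<in> {S. S \<subseteq> K \<and> card S \<le> k} \<and> Inr U \<in> S. a S)"
    unfolding inf_def by (intro sum.cong) auto
  also have "\<dots> = (\<Sum>S | S \<subseteq> K \<and> card S \<le> k. \<Sum>U | U \<in> Pow L \<and> Inr U \<in> S. a S)"
    by (rule sum.swap_restrict) (use L K in auto)
  also have "\<dots> \<le> (\<Sum>S | S \<subseteq> K \<and> card S \<le> k. real k * a S)"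
  proof (rule sum_mono)
    fix S assume S: "S \<in> {S. S \<subseteq> K \<and> card S \<le> k}"
    then have "finite S" using K finite_subset by auto
    then have "card (Inr ` {U \<in> Pow L. Inr U \<in> S} :: ('a set + 'a set) set) \<le> card S"
      by (intro card_mono) auto
    then have "card {U \<in> Pow L. Inr U \<in> S} \<le> k"
      using S by (simp add: card_image)
    then show "(\<Sum>U | U \<in> Pow L \<and> Inr U \<in> S. a S) \<le> real k * a S"
      by (simp add: a_def mult_right_mono)
  qed
  also have "\<dots> \<le> real k * (\<Sum>S\<in>Pow K. a S)"
    unfolding sum_distrib_left by (rule sum_mono2) (use K in \<open>auto simp: a_def\<close>)
  also have "(\<Sum>S\<in>Pow K. a S) = 1"
  proof -
    have "(\<Sum>S\<in>Pow K. a S) = avg2 K (\<lambda>X Y. A X * A X)"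
      using parseval[OF K, of A A] by (simp add: a_def power2_eq_square)
    also have "\<dots> = avg2 K (\<lambda>X Y. 1)"
    proof (rule avg2_cong)
      fix X Y assume "X \<subseteq> K"
      then show "A X * A X = 1" using A[of X] unfolding K_def by auto
    qed
    finally show ?thesis by (simp add: avg2_const[OF K])
  qed
  finally have "2 ^ card L * inf j \<le> real k" by simp
  then show ?thesis
    by (simp add: inf_def a_def K_def field_simps)
qed

section \<open>Realisation on the natural numbers\<close>

lemma pair_pmf_of_set:
  assumes "finite A" "A \<noteq> {}" "finite B" "B \<noteq> {}"
  shows "pair_pmf (pmf_of_set A) (pmf_of_set B) = pmf_of_set (A \<times> B)"
proof (rule pmf_eqI)
  fix p
  show "pmf (pair_pmf (pmf_of_set A) (pmf_of_set B)) p = pmf (pmf_of_set (A \<times> B)) p"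
    using assms by (cases p) (simp add: pmf_pair indicator_def card_cartesian_product)
qed

lemma vdist_sq: "(vdist d u w)\<^sup>2 = (\<Sum>j<d. (u j - w j)\<^sup>2)"
  by (simp add: vdist_def vnorm_def L2_set_def sum_nonneg)

text \<open>Weights are given on ordered pairs, and an edge collects both orders. The diagonal must
  vanish, as a loop corresponds to no edge.\<close>

lemma sum_over_edges:
  fixes w :: "'v \<Rightarrow> 'v \<Rightarrow> real" and \<Phi> :: "'a set \<Rightarrow> real"
  assumes V: "finite V" and e: "inj_on e V" and w: "\<And>u. u \<in> V \<Longrightarrow> w u u = 0"
  shows "(\<Sum>E\<in>nsets (e ` V) 2. (\<Sum>u\<in>V. \<Sum>v\<in>V. if {e u, e v} = E then w u v else 0) * \<Phi> E)
    = (\<Sum>u\<in>V. \<Sum>v\<in>V. w u v * \<Phi> {e u, e v})"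
proof -
  have fin: "finite (nsets (e ` V) 2)"
    using V by (intro finite_imp_finite_nsets) auto
  have "(\<Sum>E\<in>nsets (e ` V) 2. (\<Sum>u\<in>V. \<Sum>v\<in>V. if {e u, e v} = E then w u v else 0) * \<Phi> E)
    = (\<Sum>E\<in>nsets (e ` V) 2. \<Sum>u\<in>V. \<Sum>v\<in>V. if {e u, e v} = E then w u v * \<Phi> {e u, e v} else 0)"
    unfolding sum_distrib_right by (intro sum.cong refl) auto
  also have "\<dots> = (\<Sum>u\<in>V. \<Sum>E\<in>nsets (e ` V) 2. \<Sum>v\<in>V. if {e u, e v} = E then w u v * \<Phi> {e u, e v} else
      0)"
    by (rule sum.swap)
  also have "\<dots> = (\<Sum>u\<in>V. \<Sum>v\<in>V. \<Sum>E\<in>nsets (e ` V) 2. if {e u, e v} = E then w u v * \<Phi> {e u, e v} else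
      0)"
    by (intro sum.cong refl sum.swap)
  also have "\<dots> = (\<Sum>u\<in>V. \<Sum>v\<in>V. w u v * \<Phi> {e u, e v})"
  proof (intro sum.cong refl)
    fix u v assume uv: "u \<in> V" "v \<in> V"
    show "(\<Sum>E\<in>nsets (e ` V) 2. if {e u, e v} = E then w u v * \<Phi> {e u, e v} else 0) = w u v * \<Phi> {e
        u, e v}"
    proof (cases "u = v")
      case True
      then show ?thesis using w uv by (simp cong: if_cong)
    next
      case False
      then have "e u \<noteq> e v" using uv e by (auto simp: inj_on_def)
      then have "{e u, e v} \<in> nsets (e ` V) 2"
        using uv by (simp add: nsets_def)
      then show ?thesis using fin by simp
    qed
  qed
  finally show ?thesis .
qed

text \<open>Vertices, classes and tensor coordinates are numbered, and all conditions on vectors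
  become conditions on the Gram kernel through the squared distance \<open>2 * (1 - k u v)\<close>.
  Hence the kernel must sum to 0 over a part, and the cost bound is 2\<epsilon>, because 2/4 =
  1/2.\<close>

lemma realize_on_nat:
  fixes V :: "'v set" and R :: "'r set" and Q :: "'r \<Rightarrow> 'v set" and T :: "'c set"
    and vec :: "'v \<Rightarrow> 'c \<Rightarrow> real" and k w :: "'v \<Rightarrow> 'v \<Rightarrow> real"
  assumes fin: "finite V" "finite R" "R \<noteq> {}" "finite T"
    and parts: "V = (\<Union>f\<in>R. Q f)" "disjoint_family_on Q R" "\<And>f. f \<in> R \<Longrightarrow> card (Q f) = c" "c > 0"
    and gram: "\<And>u v. u \<in> V \<Longrightarrow> v \<in> V \<Longrightarrow> (\<Sum>\<tau>\<in>T. vec u \<tau> * vec v \<tau>) = k u v"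
    and unit: "\<And>u. u \<in> V \<Longrightarrow> k u u = 1"
    and triangle: "\<And>u v z. u \<in> V \<Longrightarrow> v \<in> V \<Longrightarrow> z \<in> V \<Longrightarrow> k u v + k v z \<le> 1 + k u z"
    and mean: "\<And>f. f \<in> R \<Longrightarrow> (\<Sum>u\<in>Q f. \<Sum>v\<in>Q f. k u v) = 0"
    and w: "\<And>u v. u \<in> V \<Longrightarrow> v \<in> V \<Longrightarrow> w u v \<ge> 0" "\<And>u. u \<in> V \<Longrightarrow> w u u = 0"
      "(\<Sum>u\<in>V. \<Sum>v\<in>V. w u v) = 1"
    and card: "real (card V) \<le> B"
    and cut: "\<And>A :: 'v \<Rightarrow> real. (\<And>u. u \<in> V \<Longrightarrow> A u = 1 \<or> A u = -1) \<Longrightarrow>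
        (\<Sum>f\<in>R. \<bar>\<Sum>u\<in>Q f. A u\<bar>) \<le> 5 / 6 * real (card R * c) \<Longrightarrow>
        \<kappa> \<le> (\<Sum>u\<in>V. \<Sum>v\<in>V. w u v * of_bool (A u \<noteq> A v))"
    and cost: "(\<Sum>u\<in>V. \<Sum>v\<in>V. w u v * (1 - k u v)) \<le> 2 * \<epsilon>"
  shows "\<exists>(V :: nat set) (wt :: nat set \<Rightarrow> real) (r :: nat) (P :: nat \<Rightarrow> nat set)
      (d :: nat) (v :: nat \<Rightarrow> nat \<Rightarrow> real).
      finite V \<and>
      (\<forall>e\<in>nsets V 2. wt e \<ge> 0) \<and> (\<Sum>e\<in>nsets V 2. wt e) = 1 \<and>
      equipartition V r P \<and>
      (\<forall>x\<in>V. vnorm d (v x) = 1) \<and>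
      real (card V) \<le> B \<and>
      (\<forall>A \<in> V \<rightarrow> {-1, 1}. piecewise_balanced (5 / 6) r P A \<longrightarrow>
         (\<Sum>e\<in>cut_edges V A. wt e) \<ge> \<kappa>) \<and>
      (\<forall>x\<in>V. \<forall>y\<in>V. \<forall>z\<in>V.
         (vdist d (v x) (v y))\<^sup>2 + (vdist d (v y) (v z))\<^sup>2 \<ge> (vdist d (v x) (v z))\<^sup>2) \<and>
      (\<forall>i\<in>{1..r}.
         1 / 2 * measure_pmf.expectation (pair_pmf (pmf_of_set (P i)) (pmf_of_set (P i)))
                   (\<lambda>(x, y). (vdist d (v x) (v y))\<^sup>2) = 1) \<and>
      sdp_value d V wt v \<le> \<epsilon>"
proof -
  obtain e :: "'v \<Rightarrow> nat" where e: "bij_betw e V {0..<card V}"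
    using ex_bij_betw_finite_nat[OF fin(1)] by blast
  obtain \<rho> where \<rho>: "bij_betw \<rho> {1..card R} R"
    using ex_bij_betw_nat_finite_1[OF fin(2)] by blast
  obtain h where h: "bij_betw h {0..<card T} T"
    using ex_bij_betw_nat_finite[OF fin(4)] by blast
  define r where "r = card R"
  define P where "P = (\<lambda>i. e ` Q (\<rho> i))"
  define g where "g = the_inv_into V e"
  define d where "d = card T"
  define v where "v = (\<lambda>x j. vec (g x) (h j))"
  define wt where "wt = (\<lambda>E. \<Sum>u\<in>V. \<Sum>v\<in>V. if {e u, e v} = E then w u v else 0)"
  have inj: "inj_on e V" using e by (simp add: bij_betw_def)
  have ge: "g (e u) = u" if "u \<in> V" for u
    unfolding g_def by (rule the_inv_into_f_f[OF inj that])
  have QV: "Q f \<subseteq> V" if "f \<in> R" for f using parts(1) that by blast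
  have finQ: "finite (Q f)" if "f \<in> R" for f using QV[OF that] fin(1) finite_subset by blast
  have injQ: "inj_on e (Q f)" if "f \<in> R" for f using QV[OF that] inj inj_on_subset by blast
  have \<rho>R: "\<rho> i \<in> R" if "i \<in> {1..r}" for i using \<rho> that by (auto simp: bij_betw_def r_def)
  have r: "r \<ge> 1" using fin by (simp add: r_def Suc_le_eq card_gt_0_iff)
  have cardV: "card V = card R * c"
    unfolding parts(1) using card_UN_disjoint'[OF parts(2) finQ fin(2)] parts(3) by simp
  have inner: "(\<Sum>j<d. v (e x) j * v (e y) j) = k x y" if "x \<in> V" "y \<in> V" for x y
  proof -
    have "(\<Sum>j<d. v (e x) j * v (e y) j) = (\<Sum>j\<in>{0..<card T}. vec x (h j) * vec y (h j))"
      using that by (simp add: v_def ge d_def lessThan_atLeast0)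
    also have "\<dots> = (\<Sum>\<tau>\<in>T. vec x \<tau> * vec y \<tau>)"
      by (rule sum.reindex_bij_betw[OF h])
    finally show ?thesis using gram that by simp
  qed
  have dist: "(vdist d (v (e x)) (v (e y)))\<^sup>2 = 2 * (1 - k x y)" if "x \<in> V" "y \<in> V" for x y
  proof -
    have "(vdist d (v (e x)) (v (e y)))\<^sup>2 = (\<Sum>j<d. v (e x) j * v (e x) j + v (e y) j * v (e y) j -
        2 * (v (e x) j * v (e y) j))"
      unfolding vdist_sq by (intro sum.cong refl) algebra
    also have "\<dots> = k x x + k y y - 2 * k x y"
      using that by (simp add: sum.distrib sum_subtractf inner flip: sum_distrib_left)
    finally show ?thesis using that unit by simp
  qed
  have sym: "k x y = k y x" if "x \<in> V" "y \<in> V" for x y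
    using gram[OF that] gram[OF that(2,1)] by (simp add: mult.commute)
  have wsum: "(\<Sum>E\<in>nsets (e ` V) 2. wt E * \<Phi> E) = (\<Sum>u\<in>V. \<Sum>v\<in>V. w u v * \<Phi> {e u, e v})"
    for \<Phi> :: "nat set \<Rightarrow> real"
    unfolding wt_def by (rule sum_over_edges[OF fin(1) inj]) (rule w(2))
  have finE: "finite (nsets (e ` V) 2)"
    using fin(1) by (intro finite_imp_finite_nsets) auto
  have equi: "equipartition (e ` V) r P"
    unfolding equipartition_def
  proof (intro conjI ballI)
    have "(\<Union>i\<in>{1..r}. P i) = e ` (\<Union>i\<in>{1..r}. Q (\<rho> i))" by (auto simp: P_def)
    also have "(\<Union>i\<in>{1..r}. Q (\<rho> i)) = (\<Union>f\<in>\<rho> ` {1..r}. Q f)" by auto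
    also have "\<dots> = V"
      using \<rho> parts(1) by (simp add: bij_betw_def r_def)
    finally show "e ` V = (\<Union>i\<in>{1..r}. P i)" ..
    show "disjoint_family_on P {1..r}"
      unfolding disjoint_family_on_def
    proof (intro ballI impI)
      fix i j assume ij: "i \<in> {1..r}" "j \<in> {1..r}" "i \<noteq> j"
      then have "\<rho> i \<noteq> \<rho> j"
        using inj_on_eq_iff[OF bij_betw_imp_inj_on[OF \<rho>], of i j] by (simp add: r_def)
      then have "Q (\<rho> i) \<inter> Q (\<rho> j) = {}"
        using parts(2) \<rho>R[OF ij(1)] \<rho>R[OF ij(2)] by (simp add: disjoint_family_on_def)
      then show "P i \<inter> P j = {}"
        unfolding P_def inj_on_image_Int[OF inj QV[OF \<rho>R[OF ij(1)]] QV[OF \<rho>R[OF ij(2)]], symmetric]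
        by simp
    qed
    fix i assume i: "i \<in> {1..r}"
    show "real (card (P i)) = real (card (e ` V)) / real r"
      using r i \<rho>R[OF i] parts(3)
      by (simp add: P_def card_image inj injQ cardV r_def)
  qed (rule r)
  have cutw: "\<kappa> \<le> (\<Sum>E\<in>cut_edges (e ` V) A. wt E)"
    if A: "A \<in> e ` V \<rightarrow> {-1, 1}" and bal: "piecewise_balanced (5 / 6) r P A" for A
  proof -
    have "measure_pmf.expectation (pmf_of_set (P i)) A = (\<Sum>u\<in>Q (\<rho> i). A (e u)) / c" if "i \<in>
        {1..r}" for i
      using \<rho>R[OF that] parts(3,4) finQ injQ card_gt_0_iff[of "Q (\<rho> i)"]
      by (simp add: P_def integral_pmf_of_set sum.reindex card_image)
    then have "measure_pmf.expectation (pmf_of_set {1..r}) (\<lambda>i. \<bar>measure_pmf.expectation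
        (pmf_of_set (P i)) A\<bar>)
      = (\<Sum>i\<in>{1..r}. \<bar>(\<Sum>u\<in>Q (\<rho> i). A (e u)) / c\<bar>) / r"
      using r by (simp add: integral_pmf_of_set)
    also have "\<dots> = (\<Sum>i\<in>{1..r}. \<bar>\<Sum>u\<in>Q (\<rho> i). A (e u)\<bar>) / (r * c)"
      by (simp add: abs_divide mult.commute flip: sum_divide_distrib)
    also have "(\<Sum>i\<in>{1..r}. \<bar>\<Sum>u\<in>Q (\<rho> i). A (e u)\<bar>) = (\<Sum>f\<in>R. \<bar>\<Sum>u\<in>Q f. A (e u)\<bar>)"
      unfolding r_def by (rule sum.reindex_bij_betw[OF \<rho>])
    finally have "(\<Sum>f\<in>R. \<bar>\<Sum>u\<in>Q f. A (e u)\<bar>) / (r * c) \<le> 5 / 6"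
      using bal by (simp add: piecewise_balanced_def)
    moreover have "real r * real c > 0" using r parts(4) by simp
    ultimately have "(\<Sum>f\<in>R. \<bar>\<Sum>u\<in>Q f. A (e u)\<bar>) \<le> 5 / 6 * real (card R * c)"
      by (simp add: field_simps r_def)
    then have "\<kappa> \<le> (\<Sum>u\<in>V. \<Sum>v\<in>V. w u v * of_bool (A (e u) \<noteq> A (e v)))"
      by (intro cut) (use A in auto)
    also have "\<dots> = (\<Sum>u\<in>V. \<Sum>v\<in>V. w u v * of_bool (\<exists>x\<in>{e u, e v}. \<exists>y\<in>{e u, e v}. A x \<noteq> A y))"
      by (intro sum.cong refl arg_cong2[where f="(*)"] arg_cong[where f=of_bool]) auto
    also have "\<dots> = (\<Sum>E\<in>nsets (e ` V) 2. wt E * of_bool (\<exists>x\<in>E. \<exists>y\<in>E. A x \<noteq> A y))"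
      by (rule wsum[symmetric])
    also have "\<dots> = (\<Sum>E\<in>cut_edges (e ` V) A. wt E)"
    proof -
      have "x * of_bool b = (if b then x else 0)" for x :: real and b by simp
      then show ?thesis
        unfolding cut_edges_def sum.inter_filter[OF finE] by (simp only:)
    qed
    finally show ?thesis .
  qed
  have meanw: "1 / 2 * measure_pmf.expectation (pair_pmf (pmf_of_set (P i)) (pmf_of_set (P i)))
                   (\<lambda>(x, y). (vdist d (v x) (v y))\<^sup>2) = 1" if i: "i \<in> {1..r}" for i
  proof -
    have f: "\<rho> i \<in> R" by (rule \<rho>R[OF i])
    have Pi: "finite (P i)" "P i \<noteq> {}" "card (P i) = c"
      using finQ[OF f] injQ[OF f] parts(3)[OF f] parts(4) by (auto simp: P_def card_image)
    have "measure_pmf.expectation (pair_pmf (pmf_of_set (P i)) (pmf_of_set (P i)))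
        (\<lambda>(x, y). (vdist d (v x) (v y))\<^sup>2) = (\<Sum>x\<in>P i. \<Sum>y\<in>P i. (vdist d (v x) (v y))\<^sup>2) / (real c *
            real c)"
      using Pi by (simp add: pair_pmf_of_set integral_pmf_of_set card_cartesian_product
          sum.cartesian_product)
    also have "(\<Sum>x\<in>P i. \<Sum>y\<in>P i. (vdist d (v x) (v y))\<^sup>2) = (\<Sum>x\<in>Q (\<rho> i). \<Sum>y\<in>Q (\<rho> i). 2 * (1 - k x
        y))"
      unfolding P_def sum.reindex[OF injQ[OF f]] o_def
      by (intro sum.cong refl dist) (use QV[OF f] in auto)
    also have "\<dots> = 2 * (real c * real c) - 2 * (\<Sum>x\<in>Q (\<rho> i). \<Sum>y\<in>Q (\<rho> i). k x y)"
      by (simp add: sum_subtractf right_diff_distrib parts(3)[OF f] flip: sum_distrib_left)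
    also have "\<dots> = 2 * (real c * real c)" using mean[OF f] by simp
    finally show ?thesis using parts(4) by simp
  qed
  have sdp: "sdp_value d (e ` V) wt v \<le> \<epsilon>"
  proof -
    \<comment> \<open>The numbering may reverse the order of the endpoints; the symmetry of the Gram
      kernel makes this harmless.\<close>
    have mm: "(vdist d (v (Min {e x, e y})) (v (Max {e x, e y})))\<^sup>2 = 2 * (1 - k x y)"
      if "x \<in> V" "y \<in> V" for x y
      using that dist[OF that] dist[OF that(2,1)] sym[OF that]
      by (cases "e x \<le> e y") (simp_all add: min_def max_def)
    have "sdp_value d (e ` V) wt v = 1 / 4 * (\<Sum>x\<in>V. \<Sum>y\<in>V. w x y * (vdist d (v (Min {e x, e y})) (v
        (Max {e x, e y})))\<^sup>2)"
      unfolding sdp_value_def wsum ..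
    also have "\<dots> = 1 / 4 * (\<Sum>x\<in>V. \<Sum>y\<in>V. 2 * (w x y * (1 - k x y)))"
    proof (rule arg_cong[where f="\<lambda>s. 1 / 4 * s"], intro sum.cong refl)
      fix x y assume "x \<in> V" "y \<in> V"
      then show "w x y * (vdist d (v (Min {e x, e y})) (v (Max {e x, e y})))\<^sup>2 = 2 * (w x y * (1 -
          k x y))"
        unfolding mm[OF \<open>x \<in> V\<close> \<open>y \<in> V\<close>] by simp
    qed
    also have "\<dots> = 1 / 2 * (\<Sum>x\<in>V. \<Sum>y\<in>V. w x y * (1 - k x y))"
      by (simp flip: sum_distrib_left)
    finally show ?thesis using cost by simp
  qed
  show ?thesis
  proof (rule exI[of _ "e ` V"], rule exI[of _ wt], rule exI[of _ r], rule exI[of _ P], rule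
      exI[of _ d],
      rule exI[of _ v], intro conjI)
    show "finite (e ` V)" using fin(1) by simp
    show "\<forall>E\<in>nsets (e ` V) 2. wt E \<ge> 0"
    using w(1) by (auto simp: wt_def intro!: sum_nonneg)
    show "(\<Sum>E\<in>nsets (e ` V) 2. wt E) = 1"
    using wsum[of "\<lambda>_. 1"] w(3) by simp
    show "\<forall>x\<in>e ` V. vnorm d (v x) = 1"
    using inner unit by (auto simp: vnorm_def L2_set_def power2_eq_square)
    show "real (card (e ` V)) \<le> B"
    using card inj by (simp add: card_image)
    show "\<forall>x\<in>e ` V. \<forall>y\<in>e ` V. \<forall>z\<in>e ` V.
         (vdist d (v x) (v y))\<^sup>2 + (vdist d (v y) (v z))\<^sup>2 \<ge> (vdist d (v x) (v z))\<^sup>2"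
  proof (intro ballI, elim imageE)
    fix x y z x' y' z'
    assume *: "x = e x'" "x' \<in> V" "y = e y'" "y' \<in> V" "z = e z'" "z' \<in> V"
    show "(vdist d (v x) (v y))\<^sup>2 + (vdist d (v y) (v z))\<^sup>2 \<ge> (vdist d (v x) (v z))\<^sup>2"
      unfolding * using triangle[OF *(2,4,6)] by (simp add: dist * )
  qed
    show "equipartition (e ` V) r P" by (rule equi)
    show "\<forall>A\<in>e ` V \<rightarrow> {- 1, 1}. piecewise_balanced (5 / 6) r P A \<longrightarrow> \<kappa> \<le> sum wt (cut_edges (e ` V) A)"
      using cutw by blast
    show "\<forall>i\<in>{1..r}. 1 / 2 * measure_pmf.expectation (pair_pmf (pmf_of_set (P i)) (pmf_of_set (P
        i)))
        (\<lambda>(x, y). (vdist d (v x) (v y))\<^sup>2) = 1"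
      using meanw by blast
    show "sdp_value d (e ` V) wt v \<le> \<epsilon>" by (rule sdp)
  qed
qed

section \<open>Balanced cuts\<close>

abbreviation base :: "'i set \<Rightarrow> ('i set + 'i set) set" where
  "base L \<equiv> Inl ` Pow L"

abbreviation fibre :: "'i set \<Rightarrow> ('i set + 'i set) set" where
  "fibre L \<equiv> Inr ` Pow L"

definition verts :: "'i set \<Rightarrow> ('i set + 'i set) set set" where
  "verts L = {X. X \<subseteq> cube L \<and> label L X = {}}"

definition reps :: "'i set \<Rightarrow> ('i set + 'i set) set set" where
  "reps L = {F. F \<subseteq> base L \<and> label L F = {}}"

text \<open>The label depends on \<open>f\<close> alone, so a representative of the class of
  \<open>f\<close> leaves \<open>x\<close> free: a part is a full cube, and all parts are equally
  large.\<close>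

definition part :: "'i set \<Rightarrow> ('i set + 'i set) set \<Rightarrow> ('i set + 'i set) set set" where
  "part L F = (\<lambda>x. F \<union> x) ` Pow (fibre L)"

lemma cube_split: "cube L = base L \<union> fibre L" "base L \<inter> fibre L = {}"
  by auto

lemma sum_Pow_Un:
  assumes "J \<inter> I = {}"
  shows "(\<Sum>X\<in>Pow (J \<union> I). \<phi> X) = (\<Sum>F\<in>Pow J. \<Sum>x\<in>Pow I. \<phi> (F \<union> x))"
  unfolding sum.cartesian_product
  by (rule sum.reindex_bij_witness[where i="\<lambda>(F, x). F \<union> x" and j="\<lambda>X. (X \<inter> J, X \<inter> I)"])
     (use assms in \<open>auto intro: arg_cong[where f=\<phi>]\<close>)

lemma label_Un: "x \<subseteq> fibre L \<Longrightarrow> label L (F \<union> x) = label L F"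
  by (auto simp: label_def)

lemma verts_parts: "verts L = (\<Union>F\<in>reps L. part L F)"
proof (intro equalityI subsetI)
  fix X assume X: "X \<in> verts L"
  then have "X = (X \<inter> base L) \<union> (X \<inter> fibre L)" by (auto simp: verts_def)
  moreover from this have "X \<inter> base L \<in> reps L"
    using X by (auto simp: verts_def reps_def label_def)
  ultimately show "X \<in> (\<Union>F\<in>reps L. part L F)"
    unfolding part_def by blast
next
  fix X assume "X \<in> (\<Union>F\<in>reps L. part L F)"
  then obtain F x where "F \<in> reps L" "x \<subseteq> fibre L" "X = F \<union> x" by (auto simp: part_def)
  then show "X \<in> verts L"
    by (auto simp: verts_def reps_def label_Un)
qed

lemma reps_base: "F \<in> reps L \<Longrightarrow> F \<subseteq> base L"
  by (simp add: reps_def)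

lemma inj_part: "F \<subseteq> base L \<Longrightarrow> inj_on (\<lambda>x. F \<union> x) (Pow (fibre L))"
  by (rule inj_onI) blast

lemma card_part: "finite L \<Longrightarrow> F \<in> reps L \<Longrightarrow> card (part L F) = 2 ^ 2 ^ card L"
  unfolding part_def by (subst card_image) (auto simp: inj_part reps_def card_Pow card_image)

lemma disjoint_parts: "disjoint_family_on (part L) (reps L)"
proof -
  have "F = G" if "F \<in> reps L" "G \<in> reps L" "X \<in> part L F" "X \<in> part L G" for F G X
  proof -
    have "F = X \<inter> base L" "G = X \<inter> base L"
      using that by (auto simp: reps_def part_def)
    then show ?thesis by simp
  qed
  then show ?thesis by (auto simp: disjoint_family_on_def)
qed

lemma act_base: "F \<subseteq> base L \<Longrightarrow> act L U F \<subseteq> base L"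
  by (auto simp: act_def)

text \<open>By freeness, every \<open>f\<close> comes from one representative under exactly one
  \<open>U\<close>, namely its label.\<close>

lemma sum_Pow_base:
  assumes L: "finite L"
  shows "(\<Sum>F\<in>Pow (base L). \<phi> F) = (\<Sum>U\<in>Pow L. \<Sum>F\<in>reps L. \<phi> (act L U F))"
proof -
  have base: "F \<subseteq> cube L" if "F \<subseteq> base L" for F using that by auto
  show ?thesis
    unfolding sum.cartesian_product
    by (rule sum.reindex_bij_witness[where i="\<lambda>(U, F). act L U F" and j="\<lambda>F. (label L F, act L
        (label L F) F)"])
       (use L in \<open>auto simp: reps_def act_involution label_act label_subset base act_base[THEN
           subsetD]
          dest: label_subset[THEN subsetD]\<close>)
qed

lemma card_reps:
  assumes "finite L"
  shows "2 ^ card L * card (reps L) = 2 ^ 2 ^ card L"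
  using sum_Pow_base[OF assms, of "\<lambda>_. 1 :: nat"] assms
  by (simp add: card_Pow card_image)

definition translate :: "'i set \<Rightarrow> 'i set \<Rightarrow> ('i set + 'i set) set \<Rightarrow> ('i set + 'i set) set" where
  "translate L U x = Inr ` {S \<in> Pow L. Inr (sym_diff U S) \<in> x}"

lemma translate_involution:
  assumes "U \<subseteq> L" "x \<subseteq> fibre L"
  shows "translate L U (translate L U x) = x"
proof -
  have "sym_diff U (sym_diff U S) = S" for S by blast
  moreover have "sym_diff U S \<subseteq> L" if "S \<subseteq> L" for S using that assms by blast
  ultimately show ?thesis
    using assms(2) by (auto simp: translate_def image_iff)
qed

lemma act_Un: "F \<subseteq> base L \<Longrightarrow> x \<subseteq> fibre L \<Longrightarrow> act L U (F \<union> x) = act L U F \<union> translate L U x"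
  by (auto simp: act_def translate_def)

text \<open>Invariance moves \<open>f\<close> and \<open>x\<close> together, and the sum over all
  \<open>x\<close> absorbs the translation. So the bias in a part may be computed at any
  \<open>f\<close> of its class.\<close>

lemma sum_fibre_act:
  assumes L: "finite L" and U: "U \<subseteq> L" and F: "F \<subseteq> base L"
    and inv: "\<And>X. X \<subseteq> cube L \<Longrightarrow> A (act L U X) = A X"
  shows "(\<Sum>x\<in>Pow (fibre L). A (act L U F \<union> x)) = (\<Sum>x\<in>Pow (fibre L). A (F \<union> x))"
proof (rule sum.reindex_bij_witness[where i="translate L U" and j="translate L U"])
  fix x assume x: "x \<in> Pow (fibre L)"
  show "translate L U (translate L U x) = x" "translate L U (translate L U x) = x"
    using translate_involution[OF U, of x] x by auto
  show T: "translate L U x \<in> Pow (fibre L)" "translate L U x \<in> Pow (fibre L)"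
    by (auto simp: translate_def)
  have "A (F \<union> translate L U x) = A (act L U (F \<union> translate L U x))"
    using F T by (intro inv[symmetric]) auto
  also have "act L U (F \<union> translate L U x) = act L U F \<union> x"
    using act_Un[OF F, of "translate L U x" U] T translate_involution[OF U, of x] x by auto
  finally show "A (F \<union> translate L U x) = A (act L U F \<union> x)" .
qed

text \<open>The two points share \<open>f\<close> and have independent \<open>x\<close>, so their
  correlation is the mean squared bias over the parts. A bias is at most 1 in absolute value, so its
  square is at most its absolute value, and the bound 5/6 carries over.\<close>

lemma balanced_correlation:
  fixes A :: "('i set + 'i set) set \<Rightarrow> real"
  assumes L: "finite L"
    and inv: "\<And>U X. U \<subseteq> L \<Longrightarrow> X \<subseteq> cube L \<Longrightarrow> A (act L U X) = A X"
    and A: "\<And>X. X \<subseteq> cube L \<Longrightarrow> A X = 1 \<or> A X = -1"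
    and bal: "(\<Sum>F\<in>reps L. \<bar>\<Sum>X\<in>part L F. A X\<bar>) \<le> 5 / 6 * real (card (reps L) * 2 ^ 2 ^ card L)"
  shows "avg2 (cube L) (\<lambda>X Y. A X * A (X \<inter> base L \<union> Y \<inter> fibre L)) \<le> 5 / 6"
proof -
  define N :: nat where "N = 2 ^ card L"
  define b where "b = (\<lambda>F. \<Sum>x\<in>Pow (fibre L). A (F \<union> x))"
  have cards: "card (Pow (fibre L)) = 2 ^ N" "card (Pow (base L)) = 2 ^ N" "card (cube L) = 2 * N"
    using L by (simp_all add: N_def card_Pow card_image card_cube)
  have split: "(\<Sum>X\<in>Pow (cube L). \<phi> X) = (\<Sum>F\<in>Pow (base L). \<Sum>x\<in>Pow (fibre L). \<phi> (F \<union> x))"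
    for \<phi> :: "('i set + 'i set) set \<Rightarrow> real"
    unfolding cube_split(1)[of L] by (rule sum_Pow_Un[OF cube_split(2)])
  have abs_b: "\<bar>b F\<bar> \<le> 2 ^ N" if "F \<in> Pow (base L)" for F
  proof -
    have "\<bar>b F\<bar> \<le> (\<Sum>x\<in>Pow (fibre L). \<bar>A (F \<union> x)\<bar>)"
      unfolding b_def by (rule sum_abs)
    also have "\<dots> \<le> (\<Sum>x\<in>Pow (fibre L). 1)"
    proof (rule sum_mono)
      fix x assume "x \<in> Pow (fibre L)"
      then have "F \<union> x \<subseteq> cube L" using that by auto
      from A[OF this] show "\<bar>A (F \<union> x)\<bar> \<le> 1" by auto
    qed
    finally show ?thesis using cards by simp
  qed
  have "(\<Sum>X\<in>Pow (cube L). \<Sum>Y\<in>Pow (cube L). A X * A (X \<inter> base L \<union> Y \<inter> fibre L))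
    = (\<Sum>F\<in>Pow (base L). \<Sum>x\<in>Pow (fibre L). \<Sum>G\<in>Pow (base L). \<Sum>y\<in>Pow (fibre L). A (F \<union> x) * A (F \<union> y))"
    unfolding split
  proof (intro sum.cong refl arg_cong2[where f="(*)"] arg_cong[where f=A])
    fix F x G y assume "F \<in> Pow (base L)" "x \<in> Pow (fibre L)" "G \<in> Pow (base L)" "y \<in> Pow (fibre L)"
    then show "(F \<union> x) \<inter> base L \<union> (G \<union> y) \<inter> fibre L = F \<union> y" by auto
  qed
  also have "\<dots> = (\<Sum>F\<in>Pow (base L). 2 ^ N * (b F)\<^sup>2)"
    unfolding b_def power2_eq_square sum_product
    by (simp add: cards sum_distrib_left)
  also have "\<dots> \<le> (\<Sum>F\<in>Pow (base L). 2 ^ N * (2 ^ N * \<bar>b F\<bar>))"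
  proof (intro sum_mono mult_left_mono)
    fix F assume "F \<in> Pow (base L)"
    then have "\<bar>b F\<bar> * \<bar>b F\<bar> \<le> 2 ^ N * \<bar>b F\<bar>"
      by (intro mult_right_mono abs_b) auto
    then show "(b F)\<^sup>2 \<le> 2 ^ N * \<bar>b F\<bar>" by (simp add: power2_eq_square)
  qed simp
  also have "\<dots> = 2 ^ N * (2 ^ N * (\<Sum>F\<in>Pow (base L). \<bar>b F\<bar>))"
    by (simp add: sum_distrib_left)
  also have "(\<Sum>F\<in>Pow (base L). \<bar>b F\<bar>) = (\<Sum>U\<in>Pow L. \<Sum>F\<in>reps L. \<bar>b F\<bar>)"
    unfolding sum_Pow_base[OF L]
  proof (intro sum.cong refl arg_cong[where f=abs])
    fix U F assume "U \<in> Pow L" "F \<in> reps L"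
    then show "b (act L U F) = b F"
      unfolding b_def using inv by (intro sum_fibre_act[OF L]) (auto dest: reps_base)
  qed
  also have "\<dots> = 2 ^ card L * (\<Sum>F\<in>reps L. \<bar>\<Sum>X\<in>part L F. A X\<bar>)"
    using L by (simp add: b_def part_def sum.reindex[OF inj_part[OF reps_base]] card_Pow)
  also have "2 ^ N * (2 ^ N * (2 ^ card L * (\<Sum>F\<in>reps L. \<bar>\<Sum>X\<in>part L F. A X\<bar>)))
      \<le> 2 ^ N * (2 ^ N * (2 ^ card L * (5 / 6 * real (card (reps L) * 2 ^ N))))"
    using bal by (intro mult_left_mono) (auto simp: N_def)
  also have "\<dots> = 5 / 6 * (2 ^ N * 2 ^ N * real (2 ^ card L * card (reps L)) * 2 ^ N)"
    by simp
  also have "\<dots> = 5 / 6 * 4 ^ (2 * N)"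
    unfolding card_reps[OF L] unfolding N_def[symmetric] power_mult
    by (simp add: power_mult_distrib[symmetric])
  finally show ?thesis
    unfolding avg2_def cards by (simp add: field_simps)
qed

lemma balanced_cut_bound:
  fixes A :: "('i set + 'i set) set \<Rightarrow> real"
  assumes L: "finite L"
    and A: "\<And>X. X \<in> verts L \<Longrightarrow> A X = 1 \<or> A X = -1"
    and bal: "(\<Sum>F\<in>reps L. \<bar>\<Sum>X\<in>part L F. A X\<bar>) \<le> 5 / 6 * real (card (reps L) * 2 ^ 2 ^ card L)"
    and \<rho>: "0 \<le> \<rho>" "\<rho> \<le> cos (pi / (2 * real m))" "\<rho> ^ k \<le> 1 / 2" and m: "m \<ge> 1"
    and \<eta>: "\<eta> = avg2 (cube L) (\<lambda>X Y. noise (cube L) \<rho> X Y * of_bool (A (canon L X) \<noteq> A (canon L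
        Y)))"
  shows "1 / 12 \<le> 8 * \<eta> + real m * (48 * \<eta> + 2 ^ card L * (32 * (3 ^ k * (real k / 2 ^ card L))\<^sup>2))"
proof -
  define B where "B = (\<lambda>X. A (canon L X))"
  have K: "finite (cube L)" using L by simp
  have canon: "canon L X \<in> verts L" for X
    by (simp add: verts_def canon_subset label_canon[OF L])
  have B: "B X = 1 \<or> B X = -1" for X
    unfolding B_def by (rule A[OF canon])
  have inv: "B (act L U X) = B X" if "U \<subseteq> L" for U X
    by (simp add: B_def canon_act[OF L that])
  have BA: "B X = A X" if "X \<in> verts L" for X
    using that by (simp add: B_def verts_def canon_id)
  have "(\<Sum>F\<in>reps L. \<bar>\<Sum>X\<in>part L F. B X\<bar>) = (\<Sum>F\<in>reps L. \<bar>\<Sum>X\<in>part L F. A X\<bar>)"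
    by (intro sum.cong refl arg_cong[where f=abs] BA) (auto simp: verts_parts)
  then have corr: "avg2 (cube L) (\<lambda>X Y. B X * B (X \<inter> base L \<union> Y \<inter> fibre L)) \<le> 5 / 6"
    using bal by (intro balanced_correlation[OF L]) (auto simp: inv B)
  \<comment> \<open>By Parseval the energy is 1 minus the noise correlation, which for values 1 and
    -1 is twice the probability of a change.\<close>
  have \<eta>2: "(\<Sum>S\<in>Pow (cube L). (1 - \<rho> ^ card S) * (four (cube L) B S)\<^sup>2) = 2 * \<eta>"
  proof -
    have "(\<Sum>S\<in>Pow (cube L). (1 - \<rho> ^ card S) * (four (cube L) B S)\<^sup>2)
      = avg2 (cube L) (\<lambda>X Y. B X * B X) - avg2 (cube L) (\<lambda>X Y. noise (cube L) \<rho> X Y * (B X * B Y))"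
      unfolding parseval[OF K] noise_fourier[OF K] sum_subtractf[symmetric]
      by (simp add: power2_eq_square left_diff_distrib)
    also have "avg2 (cube L) (\<lambda>X Y. B X * B X) = avg2 (cube L) (noise (cube L) \<rho>)"
    proof -
      have "B X * B X = 1" for X using B[of X] by auto
      then show ?thesis by (simp add: avg2_const[OF K] avg2_noise[OF K])
    qed
    also have "avg2 (cube L) (noise (cube L) \<rho>) - avg2 (cube L) (\<lambda>X Y. noise (cube L) \<rho> X Y * (B X
        * B Y))
      = avg2 (cube L) (\<lambda>X Y. 2 * (noise (cube L) \<rho> X Y * of_bool (B X \<noteq> B Y)))"
      unfolding avg2_diff[symmetric]
    proof (rule avg2_cong)
      fix X Y
      show "noise (cube L) \<rho> X Y - noise (cube L) \<rho> X Y * (B X * B Y) = 2 * (noise (cube L) \<rho> X Y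
          * of_bool (B X \<noteq> B Y))"
        using B[of X] B[of Y] by auto
    qed
    also have "\<dots> = 2 * \<eta>"
      unfolding avg2_cmult \<eta> B_def ..
    finally show ?thesis .
  qed
  have "1 / 12 \<le> 8 * \<eta> + real m * (48 * \<eta> + real (card (fibre L)) * (32 * (3 ^ k * (real k / 2 ^
      card L))\<^sup>2))"
  proof (rule noise_sensitivity_lower_bound[OF K cube_split _ corr _ \<rho> m])
    fix j assume "j \<in> fibre L"
    then show "(\<Sum>S | S \<subseteq> cube L \<and> j \<in> S \<and> card S \<le> k. (four (cube L) B S)\<^sup>2) \<le> real k / 2 ^ card L"
      by (rule influence_bound[OF L]) (auto simp: inv B)
  qed (use B \<eta>2 in auto)
  then show ?thesis
    using L by (simp add: card_image card_Pow)
qed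

section \<open>The graph\<close>

text \<open>The numerical requirements remain hypotheses, so that the parameters can be chosen
  separately; \<kappa> is any lower bound that the noise-sensitivity inequality forces on
  \<eta>.\<close>

lemma gap_graph_exists:
  fixes n k m :: nat and \<rho> \<kappa> \<epsilon> B :: real
  defines "N \<equiv> 2 ^ n"
  assumes \<rho>: "0 \<le> \<rho>" "\<rho> \<le> cos (pi / (2 * real m))" "\<rho> ^ k \<le> 1 / 2" and m: "m \<ge> 1"
    and \<kappa>: "\<And>\<eta>. 1 / 12 \<le> 8 * \<eta> + real m * (48 * \<eta> + N * (32 * (3 ^ k * (real k / N))\<^sup>2)) \<Longrightarrow> \<kappa> \<le> \<eta>"
    and \<epsilon>: "9 * (1 - \<rho>) + 2 / N \<le> 2 * \<epsilon>"
    and B: "2 ^ (2 * 2 ^ n) \<le> B"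
  shows "\<exists>(V :: nat set) (wt :: nat set \<Rightarrow> real) (r :: nat) (P :: nat \<Rightarrow> nat set)
      (d :: nat) (v :: nat \<Rightarrow> nat \<Rightarrow> real).
      finite V \<and>
      (\<forall>e\<in>nsets V 2. wt e \<ge> 0) \<and> (\<Sum>e\<in>nsets V 2. wt e) = 1 \<and>
      equipartition V r P \<and>
      (\<forall>x\<in>V. vnorm d (v x) = 1) \<and>
      real (card V) \<le> B \<and>
      (\<forall>A \<in> V \<rightarrow> {-1, 1}. piecewise_balanced (5 / 6) r P A \<longrightarrow>
         (\<Sum>e\<in>cut_edges V A. wt e) \<ge> \<kappa>) \<and>
      (\<forall>x\<in>V. \<forall>y\<in>V. \<forall>z\<in>V.
         (vdist d (v x) (v y))\<^sup>2 + (vdist d (v y) (v z))\<^sup>2 \<ge> (vdist d (v x) (v z))\<^sup>2) \<and>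
      (\<forall>i\<in>{1..r}.
         1 / 2 * measure_pmf.expectation (pair_pmf (pmf_of_set (P i)) (pmf_of_set (P i)))
                   (\<lambda>(x, y). (vdist d (v x) (v y))\<^sup>2) = 1) \<and>
      sdp_value d V wt v \<le> \<epsilon>"
proof -
  define L where "L = {..<n}"
  have L: "finite L" and cardL: "card L = n" by (simp_all add: L_def)
  define K where "K = cube L"
  have K: "finite K" using L by (simp add: K_def)
  have vertsK: "X \<subseteq> K" if "X \<in> verts L" for X using that by (simp add: verts_def K_def)
  have finV: "finite (verts L)"
    by (rule finite_subset[of _ "Pow K"]) (use K vertsK in auto)
  have \<rho>1: "\<bar>\<rho>\<bar> \<le> 1" using \<rho>(1) order_trans[OF \<rho>(2) cos_le_one] by simp
  have canon: "canon L X \<in> verts L" for X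
    by (simp add: verts_def canon_subset label_canon[OF L])
  \<comment> \<open>The noise on the cube pushed forward to the orbits; it may still charge
    loops.\<close>
  define W where "W = (\<lambda>u v. avg2 K (\<lambda>X Y. noise K \<rho> X Y * of_bool (canon L X = u \<and> canon L Y =
      v)))"
  have W0: "W u v \<ge> 0" for u v
  proof -
    have "avg2 K (\<lambda>X Y. 0) \<le> W u v"
      unfolding W_def by (rule avg2_mono) (simp add: noise_nonneg \<rho>1)
    then show ?thesis by (simp add: avg2_const[OF K])
  qed
  have Wsum: "(\<Sum>u\<in>verts L. \<Sum>v\<in>verts L. W u v * \<phi> u v)
      = avg2 K (\<lambda>X Y. noise K \<rho> X Y * \<phi> (canon L X) (canon L Y))" for \<phi>
  proof -
    have "(\<Sum>u\<in>verts L. \<Sum>v\<in>verts L. W u v * \<phi> u v)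
      = (\<Sum>u\<in>verts L. \<Sum>v\<in>verts L. avg2 K (\<lambda>X Y. \<phi> u v * (noise K \<rho> X Y * of_bool (canon L X = u \<and>
          canon L Y = v))))"
      unfolding W_def avg2_cmult by (simp add: mult.commute)
    also have "\<dots> = avg2 K (\<lambda>X Y. \<Sum>u\<in>verts L. \<Sum>v\<in>verts L. \<phi> u v * (noise K \<rho> X Y * of_bool (canon L
        X = u \<and> canon L Y = v)))"
      by (simp only: avg2_sum)
    also have "\<dots> = avg2 K (\<lambda>X Y. noise K \<rho> X Y * \<phi> (canon L X) (canon L Y))"
    proof (rule avg2_cong)
      fix X Y
      have "(\<Sum>u\<in>verts L. \<Sum>v\<in>verts L. \<phi> u v * (noise K \<rho> X Y * of_bool (canon L X = u \<and> canon L Y =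
          v)))
        = (\<Sum>u\<in>verts L. \<Sum>v\<in>verts L. if canon L Y = v then (if canon L X = u then \<phi> u v * noise K \<rho>
            X Y else 0) else 0)"
        by (intro sum.cong refl) auto
      also have "\<dots> = noise K \<rho> X Y * \<phi> (canon L X) (canon L Y)"
        using finV canon by (simp add: mult.commute)
      finally show "(\<Sum>u\<in>verts L. \<Sum>v\<in>verts L. \<phi> u v * (noise K \<rho> X Y * of_bool (canon L X = u \<and>
          canon L Y = v)))
        = noise K \<rho> X Y * \<phi> (canon L X) (canon L Y)" .
    qed
    finally show ?thesis .
  qed
  define p where "p = (\<Sum>u\<in>verts L. W u u)"
  \<comment> \<open>Both vertices have f = 1 and they differ in one of the \<open>N\<close>
    coordinates of \<open>x\<close>, so their inner product is 1 - 2/N.\<close>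
  define u0 :: "(nat set + nat set) set" where "u0 = {}"
  define v0 :: "(nat set + nat set) set" where "v0 = {Inr {}}"
  have uv0: "u0 \<in> verts L" "v0 \<in> verts L" "u0 \<noteq> v0"
    by (auto simp: u0_def v0_def verts_def label_def)
  have p0: "p \<ge> 0" unfolding p_def by (intro sum_nonneg W0)
  have Wone: "(\<Sum>u\<in>verts L. \<Sum>v\<in>verts L. W u v) = 1"
    using Wsum[of "\<lambda>_ _. 1"] by (simp add: avg2_noise[OF K])
  have p1: "p \<le> 1"
    unfolding p_def Wone[symmetric]
    by (intro sum_mono member_le_sum W0) (use finV in auto)
  \<comment> \<open>The mass of the loops moves to one edge, of negligible length.\<close>
  define w where "w = (\<lambda>u v. (if u = v then 0 else W u v) + p * of_bool (u = u0 \<and> v = v0))"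
  have wsum: "(\<Sum>u\<in>verts L. \<Sum>v\<in>verts L. w u v * \<phi> u v)
      = (\<Sum>u\<in>verts L. \<Sum>v\<in>verts L. W u v * \<phi> u v) - (\<Sum>u\<in>verts L. W u u * \<phi> u u) + p * \<phi> u0 v0" for \<phi>
  proof -
    have "(\<Sum>u\<in>verts L. \<Sum>v\<in>verts L. w u v * \<phi> u v)
      = (\<Sum>u\<in>verts L. \<Sum>v\<in>verts L. W u v * \<phi> u v - (if u = v then W u u * \<phi> u u else 0)
          + (if v = v0 then (if u = u0 then p * \<phi> u v else 0) else 0))"
      by (intro sum.cong refl) (auto simp: w_def algebra_simps)
    also have "\<dots> = (\<Sum>u\<in>verts L. \<Sum>v\<in>verts L. W u v * \<phi> u v) - (\<Sum>u\<in>verts L. W u u * \<phi> u u) + p * \<phi>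
        u0 v0"
      using finV uv0 by (simp add: sum.distrib sum_subtractf)
    finally show ?thesis .
  qed
  have cost0: "1 - kernel L u0 v0 = 2 / N"
  proof -
    have "kernel L u0 v0 = (\<Sum>S\<in>Pow L. if S = {} then - 1 else 1) / N"
    proof -
      have "kernel L u0 v0 = kern L (\<lambda>t. 1) (\<lambda>S. 1) (\<lambda>t. 1) (\<lambda>S. if S = {} then - 1 else 1)"
        unfolding kernel_def by (rule kern_cong) (auto simp: u0_def v0_def sg_def)
      then show ?thesis
        using kern_same[OF L, of "\<lambda>t. 1" "\<lambda>S. 1"] by (simp add: cardL N_def)
    qed
    also have "(\<Sum>S\<in>Pow L. if S = {} then - 1 else 1) = (\<Sum>S\<in>Pow L. 1 - (if S = {} then 2 else 0 ::
        real))"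
      by (intro sum.cong refl) auto
    also have "\<dots> = N - 2"
      using L by (simp add: sum_subtractf card_Pow cardL N_def)
    finally show ?thesis by (simp add: N_def field_simps)
  qed
  have fin_reps: "finite (reps L)"
    by (rule finite_subset[of _ "Pow K"]) (use K in \<open>auto simp: reps_def K_def\<close>)
  show ?thesis
  proof (rule realize_on_nat[where V="verts L" and R="reps L" and Q="part L" and c="2 ^ 2 ^ n" and
      k="kernel L" and w=w
        and T="PiE {..<8} (\<lambda>_. Pow L)" and vec="\<lambda>X. kvec L (\<lambda>t. sg X (Inl t)) (\<lambda>S. sg X (Inr S))"])
    show "finite (verts L)" by (rule finV)
    show "finite (reps L)" by (rule fin_reps)
    have "{} \<in> reps L" by (auto simp: reps_def label_def)
    then show "reps L \<noteq> {}" by blast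
    show "finite ({..<8::nat} \<rightarrow>\<^sub>E Pow L)" using L by (intro finite_PiE) auto
    show "verts L = \<Union> (part L ` reps L)" by (rule verts_parts)
    show "disjoint_family_on (part L) (reps L)" by (rule disjoint_parts)
    show "card (part L F) = 2 ^ 2 ^ n" if "F \<in> reps L" for F
      using card_part[OF L that] by (simp add: cardL)
    show "(0::nat) < 2 ^ 2 ^ n" by simp
    show "(\<Sum>\<tau>\<in>{..<8} \<rightarrow>\<^sub>E Pow L. kvec L (\<lambda>t. sg u (Inl t)) (\<lambda>S. sg u (Inr S)) \<tau> * kvec L (\<lambda>t. sg v
        (Inl t)) (\<lambda>S. sg v (Inr S)) \<tau>)
        = kernel L u v" for u v
      unfolding kernel_def by (rule kvec_gram[OF L])
    show "kernel L u u = 1" for u by (rule kernel_self[OF L])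
    show "kernel L u v + kernel L v z \<le> 1 + kernel L u z" for u v z by (rule kernel_triangle[OF L])
    show "(\<Sum>u\<in>part L F. \<Sum>v\<in>part L F. kernel L u v) = 0" if F: "F \<in> reps L" for F
    proof -
      have sum: "(\<Sum>u\<in>part L F. \<psi> u) = (\<Sum>x\<in>Pow (fibre L). \<psi> (F \<union> x))" for \<psi> :: "_ \<Rightarrow> real"
        unfolding part_def sum.reindex[OF inj_part[OF reps_base[OF F]]] by simp
      have FB: "F \<subseteq> base L" by (rule reps_base[OF F])
      \<comment> \<open>A part is closed under negation of \<open>x\<close>, which negates the
        vector, so the vectors of a part cancel.\<close>
      have neg: "kernel L (F \<union> (fibre L - x)) v = - kernel L (F \<union> x) v" if "x \<in> Pow (fibre L)" for
          x v
      proof -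
        have "kernel L (F \<union> (fibre L - x)) v
          = kern L (\<lambda>t. sg (F \<union> x) (Inl t)) (\<lambda>S. - sg (F \<union> x) (Inr S)) (\<lambda>t. sg v (Inl t)) (\<lambda>S. sg
              v (Inr S))"
          unfolding kernel_def by (rule kern_cong) (use that FB in \<open>auto simp: sg_def\<close>)
        then show ?thesis by (simp add: kern_uminus kernel_def)
      qed
      have "(\<Sum>u\<in>part L F. kernel L u v) = 0" for v
      proof -
        have "(\<Sum>x\<in>Pow (fibre L). kernel L (F \<union> x) v) = (\<Sum>x\<in>Pow (fibre L). kernel L (F \<union> (fibre L -
            x)) v)"
          by (rule sum.reindex_bij_witness[where i="\<lambda>x. fibre L - x" and j="\<lambda>x. fibre L - x"])
            (auto simp: double_diff)
        also have "\<dots> = - (\<Sum>x\<in>Pow (fibre L). kernel L (F \<union> x) v)"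
          by (simp add: neg sum_negf)
        finally show ?thesis by (simp add: sum)
      qed
      then show ?thesis by (subst sum.swap) simp
    qed
    show "w u v \<ge> 0" for u v using W0 p0 by (simp add: w_def)
    show "w u u = 0" for u using uv0 by (auto simp: w_def)
    show "(\<Sum>u\<in>verts L. \<Sum>v\<in>verts L. w u v) = 1"
      using wsum[of "\<lambda>_ _. 1"] Wone by (simp add: p_def)
    show "real (card (verts L)) \<le> B"
    proof -
      have "card (verts L) \<le> card (Pow K)"
        using K vertsK by (intro card_mono) auto
      also have "\<dots> = 2 ^ (2 * 2 ^ n)"
        using K by (simp add: card_Pow K_def card_cube[OF L] cardL)
      finally show ?thesis using B by (metis (mono_tags, lifting)
          numeral_power_le_of_nat_cancel_iff of_nat_le_iff of_nat_numeral of_nat_power order_trans)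
    qed
    show "\<kappa> \<le> (\<Sum>u\<in>verts L. \<Sum>v\<in>verts L. w u v * of_bool (A u \<noteq> A v))"
      if A: "\<And>u. u \<in> verts L \<Longrightarrow> A u = 1 \<or> A u = - 1"
        and bal: "(\<Sum>f\<in>reps L. \<bar>sum A (part L f)\<bar>) \<le> 5 / 6 * real (card (reps L) * 2 ^ 2 ^ n)"
      for A :: "(nat set + nat set) set \<Rightarrow> real"
    proof -
      define \<eta> where "\<eta> = avg2 K (\<lambda>X Y. noise K \<rho> X Y * of_bool (A (canon L X) \<noteq> A (canon L Y)))"
      have "1 / 12 \<le> 8 * \<eta> + real m * (48 * \<eta> + 2 ^ card L * (32 * (3 ^ k * (real k / 2 ^ card
          L))\<^sup>2))"
        by (rule balanced_cut_bound[OF L A _ \<rho> m]) (use bal in \<open>simp_all add: cardL \<eta>_def K_def\<close>)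
      then have "\<kappa> \<le> \<eta>"
        by (intro \<kappa>) (simp only: cardL N_def)
      also have "\<eta> = (\<Sum>u\<in>verts L. \<Sum>v\<in>verts L. W u v * of_bool (A u \<noteq> A v))"
        unfolding \<eta>_def by (rule Wsum[symmetric])
      \<comment> \<open>Loops are never cut, so moving their mass to an edge cannot decrease the cut
        weight.\<close>
      also have "\<dots> \<le> (\<Sum>u\<in>verts L. \<Sum>v\<in>verts L. w u v * of_bool (A u \<noteq> A v))"
        unfolding wsum using p0 by simp
      finally show ?thesis .
    qed
    show "(\<Sum>u\<in>verts L. \<Sum>v\<in>verts L. w u v * (1 - kernel L u v)) \<le> 2 * \<epsilon>"
    proof -
      have "(\<Sum>u\<in>verts L. \<Sum>v\<in>verts L. w u v * (1 - kernel L u v))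
        = avg2 K (\<lambda>X Y. noise K \<rho> X Y * (1 - kernel L X Y)) + p * (2 / N)"
        unfolding wsum Wsum cost0 by (simp add: kernel_self[OF L] kernel_canon[OF L])
      also have "\<dots> \<le> 9 * (1 - \<rho>) + 1 * (2 / N)"
        using noise_kernel_cost[OF L \<rho>1] p1
        by (intro add_mono mult_right_mono) (auto simp: K_def N_def)
      finally show ?thesis using \<epsilon> by simp
    qed
  qed
qed

section \<open>Choice of the parameters\<close>

theorem theorem2p8:
  fixes t :: real
  assumes "1 / 2 < t" and "t < 1"
  shows "\<exists>C>0. \<exists>\<epsilon>\<^sub>0>0. \<forall>\<epsilon>::real. 0 < \<epsilon> \<and> \<epsilon> < \<epsilon>\<^sub>0 \<longrightarrow>
    (\<exists>(V :: nat set) (wt :: nat set \<Rightarrow> real) (r :: nat) (P :: nat \<Rightarrow> nat set)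
      (d :: nat) (v :: nat \<Rightarrow> nat \<Rightarrow> real).
      finite V \<and>
      (\<forall>e\<in>nsets V 2. wt e \<ge> 0) \<and> (\<Sum>e\<in>nsets V 2. wt e) = 1 \<and>
      equipartition V r P \<and>
      (\<forall>x\<in>V. vnorm d (v x) = 1) \<and>
      real (card V) \<le> 2 powr (2 powr (C / \<epsilon> ^ 3)) \<and>
      (\<forall>A \<in> V \<rightarrow> {-1, 1}. piecewise_balanced (5 / 6) r P A \<longrightarrow>
         (\<Sum>e\<in>cut_edges V A. wt e) \<ge> \<epsilon> powr t) \<and>
      (\<forall>x\<in>V. \<forall>y\<in>V. \<forall>z\<in>V.
         (vdist d (v x) (v y))\<^sup>2 + (vdist d (v y) (v z))\<^sup>2 \<ge> (vdist d (v x) (v z))\<^sup>2) \<and>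
      (\<forall>i\<in>{1..r}.
         1 / 2 * measure_pmf.expectation (pair_pmf (pmf_of_set (P i)) (pmf_of_set (P i)))
                   (\<lambda>(x, y). (vdist d (v x) (v y))\<^sup>2) = 1) \<and>
      sdp_value d V wt v \<le> \<epsilon>)"
proof (rule exI[of _ 400], rule conjI[OF zero_less_numeral],
    rule exI[of _ "(1 / 12000) powr (1 / (t - 1/2))"], intro conjI allI impI)
  \<comment> \<open>The spare exponent t - 1/2 absorbs the constant that relates \<eta> to the
    square root of \<epsilon>; that constant is 4.4 * 2688 < 12000.\<close>
  let ?e0 = "(1 / 12000) powr (1 / (t - 1/2)) :: real"
  show "?e0 > 0" by simp
  fix \<epsilon> :: real assume \<epsilon>: "0 < \<epsilon> \<and> \<epsilon> < ?e0"
  then have \<epsilon>0: "\<epsilon> > 0" by simp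
  have gap: "\<epsilon> powr (t - 1/2) \<le> 1 / 12000"
  proof -
    have "\<epsilon> powr (t - 1/2) \<le> ?e0 powr (t - 1/2)"
      using \<epsilon> assms by (intro powr_mono2) auto
    also have "\<dots> = 1 / 12000" using assms by (simp add: powr_powr)
    finally show ?thesis .
  qed
  have "?e0 \<le> 1" using assms by (intro powr_le1) auto
  then have \<epsilon>1: "\<epsilon> < 1" using \<epsilon> by linarith
  \<comment> \<open>With \<rho> = 1 - 2\<delta> the noise costs 18\<delta> = \<epsilon>, half of the
    budget 2\<epsilon>; the edge carrying the loop mass gets the other half.\<close>
  define \<delta> where "\<delta> = \<epsilon> / 18"
  have \<delta>: "\<delta> > 0" "\<delta> < 1 / 18" using \<epsilon>0 \<epsilon>1 by (simp_all add: \<delta>_def)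
  \<comment> \<open>\<open>m\<close> makes the cosine of one step at least 1 - 2\<delta>, and
    \<open>k\<close> makes \<open>\<rho> ^ k\<close> at most \<open>exp (- 2)\<close>.\<close>
  define m where "m = nat \<lceil>1 / sqrt \<delta>\<rceil>"
  define k where "k = nat \<lceil>1 / \<delta>\<rceil>"
  have ceil: "x \<le> real (nat \<lceil>x\<rceil>)" "real (nat \<lceil>x\<rceil>) \<le> x + 1" if "x > 0" for x :: real
    using that ceiling_correct[of x] by auto
  define s where "s = sqrt \<delta>"
  have s: "s > 0" "s\<^sup>2 = \<delta>" using \<delta> by (simp_all add: s_def)
  have s2: "2 * s \<le> 1"
    using real_le_lsqrt[of "1 / 2" \<delta>] \<delta> by (simp add: s_def power2_eq_square)
  have m_lb: "1 / s \<le> real m" and m_ub: "real m \<le> 1 / s + 1"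
    using ceil[of "1 / s"] s by (simp_all add: m_def s_def)
  have k_lb: "1 / \<delta> \<le> real k" and k_ub: "real k \<le> 1 / \<delta> + 1"
    using ceil[of "1 / \<delta>"] \<delta> by (simp_all add: k_def)
  have "2 \<le> 1 / s" using s s2 by (simp add: field_simps)
  then have m1: "1 \<le> real m" using m_lb by linarith
  have m_ub2: "real m \<le> 2 / s" using m_ub \<open>2 \<le> 1 / s\<close> by simp
  have "2 / s \<le> 1 / s\<^sup>2" using s(1) s2 by (simp add: field_simps power2_eq_square)
  then have mk: "real m \<le> real k" using m_ub2 k_lb s by simp
  then have k1: "1 \<le> k" using m1 by simp
  \<comment> \<open>The invariance error grows at most like \<open>128 ^ k\<close>, which is
    \<open>2 ^ (7 * k)\<close>: three factors \<open>2 ^ k\<close> for \<open>m\<close> and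
    \<open>k * k\<close>, and \<open>16 ^ k\<close> for \<open>9 ^ k\<close>. The exponent 20 leaves
    a factor \<open>8192 ^ k\<close> to spare.\<close>
  define N :: real where "N = 2 ^ (20 * k)"
  have N: "N > 0" by (simp add: N_def)
  have kN: "real k \<le> N"
  proof -
    have "real k \<le> 2 ^ k" by (rule of_nat_less_two_power[THEN less_imp_le])
    also have "\<dots> \<le> N" unfolding N_def by (rule power_increasing) auto
    finally show ?thesis .
  qed
  show "\<exists>(V :: nat set) (wt :: nat set \<Rightarrow> real) (r :: nat) (P :: nat \<Rightarrow> nat set)
      (d :: nat) (v :: nat \<Rightarrow> nat \<Rightarrow> real).
      finite V \<and>
      (\<forall>e\<in>nsets V 2. wt e \<ge> 0) \<and> (\<Sum>e\<in>nsets V 2. wt e) = 1 \<and>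
      equipartition V r P \<and>
      (\<forall>x\<in>V. vnorm d (v x) = 1) \<and>
      real (card V) \<le> 2 powr (2 powr (400 / \<epsilon> ^ 3)) \<and>
      (\<forall>A \<in> V \<rightarrow> {-1, 1}. piecewise_balanced (5 / 6) r P A \<longrightarrow>
         (\<Sum>e\<in>cut_edges V A. wt e) \<ge> \<epsilon> powr t) \<and>
      (\<forall>x\<in>V. \<forall>y\<in>V. \<forall>z\<in>V.
         (vdist d (v x) (v y))\<^sup>2 + (vdist d (v y) (v z))\<^sup>2 \<ge> (vdist d (v x) (v z))\<^sup>2) \<and>
      (\<forall>i\<in>{1..r}.
         1 / 2 * measure_pmf.expectation (pair_pmf (pmf_of_set (P i)) (pmf_of_set (P i)))
                   (\<lambda>(x, y). (vdist d (v x) (v y))\<^sup>2) = 1) \<and>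
      sdp_value d V wt v \<le> \<epsilon>"
  proof (rule gap_graph_exists[where n="20 * k" and k=k and m=m and \<rho>="1 - 2 * \<delta>"])
    show "0 \<le> 1 - 2 * \<delta>" using \<delta> by simp
    show "1 - 2 * \<delta> \<le> cos (pi / (2 * real m))"
    proof -
      have "(pi / (2 * real m))\<^sup>2 \<le> (2 / real m)\<^sup>2"
        using m1 pi_less_4 by (intro power_mono) (auto simp: field_simps)
      also have "\<dots> = 4 * (1 / real m)\<^sup>2" by (simp add: power_divide)
      also have "\<dots> \<le> 4 * s\<^sup>2"
        using m_lb m1 s by (intro mult_left_mono power_mono) (auto simp: field_simps)
      finally show ?thesis
        using one_minus_cos_le[of "pi / (2 * real m)"] s(2) by linarith
    qed
    show "(1 - 2 * \<delta>) ^ k \<le> 1 / 2"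
    proof -
      have "(1 - 2 * \<delta>) ^ k \<le> exp (- 2 * \<delta>) ^ k"
        using exp_ge_add_one_self[of "- 2 * \<delta>"] \<delta> by (intro power_mono) auto
      also have "\<dots> = exp (- 2 * (\<delta> * real k))"
        by (simp add: exp_of_nat_mult[symmetric] ac_simps)
      also have "\<dots> \<le> exp (- 2)"
        using k_lb \<delta> by (simp add: field_simps)
      also have "\<dots> \<le> 1 / 2"
        using exp_ge_add_one_self[of "2 :: real"] by (simp add: exp_minus field_simps)
      finally show ?thesis .
    qed
    show "m \<ge> 1" using m1 by simp
    show "9 * (1 - (1 - 2 * \<delta>)) + 2 / 2 ^ (20 * k) \<le> 2 * \<epsilon>"
    proof -
      have "18 / \<epsilon> \<le> N" using k_lb kN by (simp add: \<delta>_def)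
      then have "2 / N \<le> \<epsilon>" using \<epsilon>0 N by (simp add: field_simps)
      then show ?thesis by (simp add: \<delta>_def N_def)
    qed
    show "2 ^ (2 * 2 ^ (20 * k)) \<le> 2 powr (2 powr (400 / \<epsilon> ^ 3))"
    proof -
      \<comment> \<open>Since \<open>k\<close> is at most 18/\<epsilon> + 1, the inner exponent is
        already below 400/\<epsilon>.\<close>
      have "real (20 * k + 1) \<le> 20 * (1 / \<delta> + 1) + 1" using k_ub by simp
      also have "\<dots> = 360 / \<epsilon> + 21" by (simp add: \<delta>_def)
      also have "\<dots> \<le> 400 / \<epsilon>" using \<epsilon>0 \<epsilon>1 by (simp add: field_simps)
      also have "\<dots> \<le> 400 / \<epsilon> ^ 3"
        using \<epsilon>0 \<epsilon>1 power_decreasing[of 1 3 \<epsilon>] by (intro divide_left_mono) auto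
      finally have "2 powr real (20 * k + 1) \<le> 2 powr (400 / \<epsilon> ^ 3)"
        by (rule powr_mono) simp
      moreover have "2 powr real (20 * k + 1) = real (2 * 2 ^ (20 * k))"
        by (subst powr_realpow) auto
      ultimately have "real (2 * 2 ^ (20 * k)) \<le> 2 powr (400 / \<epsilon> ^ 3)" by (simp only:)
      then have "2 powr real (2 * 2 ^ (20 * k)) \<le> 2 powr (2 powr (400 / \<epsilon> ^ 3))"
        by (rule powr_mono) simp
      moreover have "2 powr real (2 * 2 ^ (20 * k)) = (2 :: real) ^ (2 * 2 ^ (20 * k))"
        by (rule powr_realpow) simp
      ultimately show ?thesis by (simp only:)
    qed
    fix \<eta> :: real
    assume \<eta>: "1 / 12 \<le> 8 * \<eta> + real m * (48 * \<eta> + 2 ^ (20 * k) * (32 * (3 ^ k * (real k / 2 ^ (20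
        * k)))\<^sup>2))"
    have "real m * (N * (32 * (3 ^ k * (real k / N))\<^sup>2)) = 32 * (real m * (9 ^ k * (real k * real
        k))) / N"
    proof -
      have "((3 :: real) ^ k)\<^sup>2 = 9 ^ k"
        by (simp add: power2_eq_square flip: power_mult_distrib)
      then show ?thesis
        unfolding power_mult_distrib power_divide using N by (simp add: power2_eq_square)
    qed
    also have "\<dots> \<le> 32 * (2 ^ k * (16 ^ k * (2 ^ k * 2 ^ k))) / N"
    proof -
      have "real k \<le> 2 ^ k" by (rule of_nat_less_two_power[THEN less_imp_le])
      moreover have "real m \<le> 2 ^ k" using mk \<open>real k \<le> 2 ^ k\<close> by linarith
      ultimately show ?thesis
        using N by (intro divide_right_mono mult_left_mono mult_mono power_mono) auto
    qed
    also have "(2::real) ^ k * (16 ^ k * (2 ^ k * 2 ^ k)) = 128 ^ k"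
      by (simp flip: power_mult_distrib)
    also have "32 * 128 ^ k / N = 32 / 8192 ^ k"
    proof -
      have "N = (2 ^ 20) ^ k" by (simp only: N_def power_mult)
      also have "\<dots> = 128 ^ k * 8192 ^ k" unfolding power_mult_distrib[symmetric] by simp
      finally show ?thesis by simp
    qed
    also have "\<dots> \<le> 1 / 24"
      using power_increasing[of 1 k "8192 :: real"] k1 by (simp add: field_simps)
    finally have err: "real m * (N * (32 * (3 ^ k * (real k / N))\<^sup>2)) \<le> 1 / 24" .
    have \<eta>': "1 / 24 \<le> 8 * \<eta> + 48 * (real m * \<eta>)"
      using \<eta> err unfolding N_def by (simp add: distrib_left)
    have "\<eta> > 0"
    proof (rule ccontr)
      assume "\<not> \<eta> > 0"
      then have "8 * \<eta> \<le> 0" "real m * \<eta> \<le> 0" by (auto simp: mult_nonneg_nonpos)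
      with \<eta>' show False by simp
    qed
    then have "\<eta> \<le> real m * \<eta>" using m1 by simp
    then have "1 / 24 \<le> 56 * (real m * \<eta>)" using \<eta>' by linarith
    also have "\<dots> \<le> 56 * (2 / s * \<eta>)"
      using m_ub2 \<open>\<eta> > 0\<close> by (intro mult_left_mono mult_right_mono) auto
    \<comment> \<open>2688 = 24 * 56 * 2.\<close>
    finally have \<eta>s: "s \<le> 2688 * \<eta>" using s by (simp add: field_simps)
    have "\<epsilon> powr t = \<epsilon> powr (1/2) * \<epsilon> powr (t - 1/2)"
      by (simp flip: powr_add)
    also have "\<dots> \<le> sqrt \<epsilon> * (1 / 12000)"
      unfolding powr_half_sqrt[OF less_imp_le[OF \<epsilon>0]] using gap \<epsilon>0 by (intro mult_left_mono) auto
    \<comment> \<open>4.4 exceeds the square root of 18, the exact ratio of the two sides.\<close>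
    also have "sqrt \<epsilon> \<le> 4.4 * s"
    proof (rule real_le_lsqrt)
      show "\<epsilon> \<le> (4.4 * s)\<^sup>2"
        using s(2) \<epsilon>0 by (simp add: power_mult_distrib \<delta>_def power2_eq_square)
    qed (use s \<epsilon>0 in auto)
    then have "sqrt \<epsilon> * (1 / 12000) \<le> 4.4 * s * (1 / 12000)" by simp
    also have "\<dots> \<le> \<eta>" using \<eta>s s by simp
    finally show "\<epsilon> powr t \<le> \<eta>" .
  qed
qed

end
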